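(* Let $\mu\ge 0$, let $m\ge 0$ be an integer, and let $\phi_\nu=\frac{2\nu\pi}{2m+1}$, $\zeta_\nu=(\cos\phi_\nu,\sin\phi_\nu,0)$ for $0\le\nu\le 2m$. Let $f\in L^2(H_\mu;S^2)$ be even in $x_3$, i.e. $f(x_1,x_2,x_3)=f(x_1,x_2,-x_3)$. Then for $\mathbf x=(x_1,x_2,x_3)\in S^2$ the partial sum $Y_{2m}^\mu(f;\mathbf x)=\sum_{k=0}^{2m}\operatorname{proj}_{\mathcal H_k^\mu}f(\mathbf x)$ satisfies $$Y_{2m}^\mu(f;\mathbf x)=\frac{1}{2m+1}\sum_{\nu=0}^{2m}a_\mu\int_{-1}^1Q^\mu f(\zeta_\nu;t)\,\Phi_{2m}^\mu(\phi_\nu,t;x_1,x_2)\,dt .$$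
   Context: Sphere: $S^2=\{\mathbf x\in\mathbb R^3:\|\mathbf x\|=1\}$ with surface measure $d\omega$ and weight $H_\mu(\mathbf x)=|x_3|^{2\mu}$. $\mathcal H_k^\mu$ is the space of (restrictions to $S^2$ of) homogeneous polynomials of degree $k$ in three variables that are orthogonal, with respect to $H_\mu\,d\omega$ on $S^2$, to all polynomials of degree $<k$; $L^2(H_\mu;S^2)=\bigoplus_{k\ge0}\mathcal H_k^\mu$, and $\operatorname{proj}_{\mathcal H_k^\mu}$ is the orthogonal projection onto $\mathcal H_k^\mu$. Attenuated spherical transform: for $\zeta=(\cos\theta,\sin\theta,0)$ and $-1<t<1$, $Q^\mu f(\zeta;t)$ is the integral of $f(\mathbf x)|x_3|^{2\mu}$ over the circle $\{\mathbf x\in S^2:\langle\mathbf x,\zeta\rangle=t\}$, normalized as $$Q^\mu f(\zeta;t)=\frac12\int_0^{2\pi}f(\mathbf x(\alpha))\,|x_3(\alpha)|^{2\mu}\,d\alpha,$$ $$\mathbf x(\alpha)=\bigl(t\cos\theta-\sqrt{1-t^2}\cos\alpha\sin\theta,\ t\sin\theta+\sqrt{1-t^2}\cos\alpha\cos\theta,\ \sqrt{1-t^2}\sin\alpha\bigr)$$ (defined for a.e. $t$ for $f\in L^2(H_\mu;S^2)$). Disk: $B^2$ is the closed unit disk in $\mathbb R^2$; $W_\mu(x,y)=(1-x^2-y^2)^{\mu-1/2}$; $a_\mu=(\mu+1/2)/\pi=1/\int_{B^2}W_\mu$. $\mathcal V_k^2(W_\mu)$ is the space of polynomials in two variables of degree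 $k$ (together with $0$) orthogonal to all polynomials of degree $<k$ under $\langle P,Q\rangle_\mu=a_\mu\int_{B^2}PQW_\mu\,dx\,dy$. $(a)_k=a(a+1)\cdots(a+k-1)$. $C_k^\lambda$ is the Gegenbauer polynomial of degree $k$, orthogonal for $(1-s^2)^{\lambda-1/2}$ on $[-1,1]$, with $C_k^\lambda(1)=(2\lambda)_k/k!$. $p_l^{(\alpha,\beta)}$ is the Jacobi polynomial of degree $l$ with positive leading coefficient, orthonormal for the weight $(1-t)^\alpha(1+t)^\beta$ normalized to have integral $1$ on $[-1,1]$. Orthonormal basis of $\mathcal V_k^2(W_\mu)$: in polar coordinates $x=r\cos\phi$, $y=r\sin\phi$, $$P_{l,\varepsilon}^k(x,y)=h_{l,k}\,p_l^{(\mu-1/2,\,k-2l)}(2r^2-1)\,r^{k-2l}S_{k-2l,\varepsilon}(\phi),$$ where $S_{j,0}(\phi)=\cos j\phi$, $S_{j,1}(\phi)=\sin j\phi$, $0\le 2l\le k$ if $\varepsilon=0$, $0\le 2l\le k-1$ if $\varepsilon=1$, and $$h_{l,k}^2=\frac1{d_{l,k}}\,\frac{\Gamma(k-2l+\mu+3/2)}{\Gamma(\mu+3/2)\Gamma(k-2l+1)},\quad h_{l,k}>0,\qquad d_{l,k}=\tfrac12\ (2l<k),\quad d_{l,k}=1\ (2l=k).$$ $$\lambda_{l,k}^\mu=\frac{l!\,(k-l)!\,(k-l+\mu+\frac12)}{(\mu+\frac12)_l\,(\mu+\frac32)_{k-l}\,(k+\mu+\frac12)},\qquad D_k^{\mu+1/2}(\xi;x,y)=\sum_{l,\varepsilon}\lambda_{l,k}^\mu\,P_{l,\varepsilon}^k(\cos\xi,\sin\xi)\,P_{l,\varepsilon}^k(x,y)$$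 (sum over all admissible pairs $(l,\varepsilon)$), and $$\Phi_{2m}^\mu(\xi,t;x,y)=\sum_{k=0}^{2m}\frac{k+\mu+1/2}{\mu+1/2}\,C_k^{\mu+1/2}(t)\,D_k^{\mu+1/2}(\xi;x,y).$$ *)

theory Defs
  imports "HOL-Analysis.Analysis"
begin

section \<open>The weighted sphere\<close>

text \<open>
  The surface measure on the unit sphere of \<open>\<real>\<^sup>3\<close>, described by polar coordinates: a Borel set
  \<open>A\<close> has measure \<open>3\<close> times the volume of the cone \<open>{r x | 0 < r < 1, x \<in> A}\<close>. The factor
  \<open>3\<close> is \<open>1 / \<integral>\<^sub>0\<^sup>1 r\<^sup>2 dr\<close>; the total mass is \<open>4\<pi>\<close>. Note that \<open>sgn x = x / norm x\<close>.
\<close>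

definition sphere_measure :: "(real^3) measure" where
  "sphere_measure =
     distr (scale_measure 3 (restrict_space lborel (ball 0 1 - {0})))
       (restrict_space borel (sphere 0 1)) sgn"

text \<open>
  The weight \<open>\<bar>x\<^sub>3\<bar>\<^sup>2\<^sup>\<mu>\<close>. The case distinction is needed because \<open>0 powr 0 = 0\<close>.
\<close>

definition sphere_weight :: "real \<Rightarrow> real^3 \<Rightarrow> real" where
  "sphere_weight \<mu> x = (if \<mu> = 0 then 1 else \<bar>x $ 3\<bar> powr (2 * \<mu>))"

definition sphere_inner :: "real \<Rightarrow> (real^3 \<Rightarrow> real) \<Rightarrow> (real^3 \<Rightarrow> real) \<Rightarrow> real" where
  "sphere_inner \<mu> f g = (LINT x|sphere_measure. f x * g x * sphere_weight \<mu> x)"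

text \<open>
  Representatives of the classes in \<open>L\<^sup>2(H\<^sub>\<mu>; S\<^sup>2)\<close>; the values of a member off the sphere are
  irrelevant.
\<close>

definition L2_sphere :: "real \<Rightarrow> (real^3 \<Rightarrow> real) set" where
  "L2_sphere \<mu> = {f. f \<in> borel_measurable sphere_measure \<and>
                     integrable sphere_measure (\<lambda>x. (f x)\<^sup>2 * sphere_weight \<mu> x)}"

definition homogeneous_poly :: "nat \<Rightarrow> (real^3 \<Rightarrow> real) \<Rightarrow> bool" where
  "homogeneous_poly k P \<longleftrightarrow>
     (\<exists>c. \<forall>x. P x = (\<Sum>(i, j, l) \<in> {(i, j, l). i + j + l = k}.
                        c i j l * x $ 1 ^ i * x $ 2 ^ j * x $ 3 ^ l))"

definition poly_degree_less :: "nat \<Rightarrow> (real^3 \<Rightarrow> real) \<Rightarrow> bool" where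
  "poly_degree_less k P \<longleftrightarrow>
     (\<exists>c. \<forall>x. P x = (\<Sum>(i, j, l) \<in> {(i, j, l). i + j + l < k}.
                        c i j l * x $ 1 ^ i * x $ 2 ^ j * x $ 3 ^ l))"

text \<open>
  Members of \<open>\<H>\<^sub>k\<^sup>\<mu>\<close> are kept as polynomial functions on \<open>\<real>\<^sup>3\<close>; being homogeneous of known
  degree, they are determined by their restriction to the sphere.
\<close>

definition harmonic_space :: "real \<Rightarrow> nat \<Rightarrow> (real^3 \<Rightarrow> real) set" where
  "harmonic_space \<mu> k = {P. homogeneous_poly k P \<and>
                           (\<forall>Q. poly_degree_less k Q \<longrightarrow> sphere_inner \<mu> P Q = 0)}"

definition harmonic_proj :: "real \<Rightarrow> nat \<Rightarrow> (real^3 \<Rightarrow> real) \<Rightarrow> real^3 \<Rightarrow> real" where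
  "harmonic_proj \<mu> k f =
     (THE g. g \<in> harmonic_space \<mu> k \<and>
             (\<forall>h \<in> harmonic_space \<mu> k. sphere_inner \<mu> (\<lambda>x. f x - g x) h = 0))"

definition partial_sum_Y :: "real \<Rightarrow> nat \<Rightarrow> (real^3 \<Rightarrow> real) \<Rightarrow> real^3 \<Rightarrow> real" where
  "partial_sum_Y \<mu> n f x = (\<Sum>k\<le>n. harmonic_proj \<mu> k f x)"

section \<open>The attenuated spherical transform\<close>

text \<open>
  For \<open>\<zeta> = (cos \<theta>, sin \<theta>, 0)\<close> this parametrizes the circle \<open>{x \<in> S\<^sup>2. x \<bullet> \<zeta> = t}\<close>.
\<close>

definition circle_point :: "real^3 \<Rightarrow> real \<Rightarrow> real \<Rightarrow> real^3" where
  "circle_point \<zeta> t \<alpha> =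
     vector [t * \<zeta> $ 1 - sqrt (1 - t\<^sup>2) * cos \<alpha> * \<zeta> $ 2,
             t * \<zeta> $ 2 + sqrt (1 - t\<^sup>2) * cos \<alpha> * \<zeta> $ 1,
             sqrt (1 - t\<^sup>2) * sin \<alpha>]"

definition Q_transform :: "real \<Rightarrow> (real^3 \<Rightarrow> real) \<Rightarrow> real^3 \<Rightarrow> real \<Rightarrow> real" where
  "Q_transform \<mu> f \<zeta> t =
     1 / 2 * (LBINT \<alpha>:{0..2 * pi}.
               f (circle_point \<zeta> t \<alpha>) * sphere_weight \<mu> (circle_point \<zeta> t \<alpha>))"

section \<open>Gegenbauer and Jacobi polynomials\<close>

definition gegenbauer :: "real \<Rightarrow> nat \<Rightarrow> real poly" where
  "gegenbauer \<gamma> k =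
     (THE p. degree p = k \<and>
             (\<forall>q. degree q < k \<longrightarrow>
                (LBINT s:{-1..1}. poly p s * poly q s * (1 - s\<^sup>2) powr (\<gamma> - 1 / 2)) = 0) \<and>
             poly p 1 = pochhammer (2 * \<gamma>) k / fact k)"

definition jacobi_weight :: "real \<Rightarrow> real \<Rightarrow> real \<Rightarrow> real" where
  "jacobi_weight \<alpha> \<beta> t = (1 - t) powr \<alpha> * (1 + t) powr \<beta>"

definition jacobi_inner :: "real \<Rightarrow> real \<Rightarrow> real poly \<Rightarrow> real poly \<Rightarrow> real" where
  "jacobi_inner \<alpha> \<beta> p q =
     (LBINT t:{-1..1}. poly p t * poly q t * jacobi_weight \<alpha> \<beta> t) /
     (LBINT t:{-1..1}. jacobi_weight \<alpha> \<beta> t)"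

definition jacobi_orthonormal :: "nat \<Rightarrow> real \<Rightarrow> real \<Rightarrow> real poly" where
  "jacobi_orthonormal l \<alpha> \<beta> =
     (THE p. degree p = l \<and> lead_coeff p > 0 \<and>
             (\<forall>q. degree q < l \<longrightarrow> jacobi_inner \<alpha> \<beta> p q = 0) \<and>
             jacobi_inner \<alpha> \<beta> p p = 1)"

section \<open>The disk basis and the reconstruction kernel\<close>

text \<open>\<open>a\<^sub>\<mu> = 1 / \<integral> (1 - x\<^sup>2 - y\<^sup>2)\<^sup>\<mu>\<^sup>-\<^sup>1\<^sup>/\<^sup>2 dx dy\<close>, the integral being over the unit disk.\<close>

definition a_const :: "real \<Rightarrow> real" where
  "a_const \<mu> = (\<mu> + 1 / 2) / pi"

definition S_angular :: "nat \<Rightarrow> nat \<Rightarrow> real \<Rightarrow> real" where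
  "S_angular j e \<phi> = (if e = 0 then cos (real j * \<phi>) else sin (real j * \<phi>))"

definition d_coeff :: "nat \<Rightarrow> nat \<Rightarrow> real" where
  "d_coeff l k = (if 2 * l < k then 1 / 2 else 1)"

definition h_coeff :: "real \<Rightarrow> nat \<Rightarrow> nat \<Rightarrow> real" where
  "h_coeff \<mu> l k =
     sqrt (1 / d_coeff l k * (Gamma (real (k - 2 * l) + \<mu> + 3 / 2) /
                              (Gamma (\<mu> + 3 / 2) * Gamma (real (k - 2 * l) + 1))))"

text \<open>
  The polar angle of \<open>(x, y)\<close> is taken to be the principal argument. At the origin the choice of
  the angle does not matter: there \<open>r ^ (k - 2 * l)\<close> vanishes unless \<open>k = 2 * l\<close>, and in that case
  \<open>S_angular\<close> is constant.
\<close>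

definition disk_basis :: "real \<Rightarrow> nat \<Rightarrow> nat \<Rightarrow> nat \<Rightarrow> real \<Rightarrow> real \<Rightarrow> real" where
  "disk_basis \<mu> k l e x y =
     (let r = sqrt (x\<^sup>2 + y\<^sup>2); \<phi> = Arg (Complex x y) in
        h_coeff \<mu> l k * poly (jacobi_orthonormal l (\<mu> - 1 / 2) (real (k - 2 * l))) (2 * r\<^sup>2 - 1)
          * r ^ (k - 2 * l) * S_angular (k - 2 * l) e \<phi>)"

definition disk_index :: "nat \<Rightarrow> (nat \<times> nat) set" where
  "disk_index k = {(l, e). e = 0 \<and> 2 * l \<le> k \<or> e = 1 \<and> 2 * l + 1 \<le> k}"

definition lam_coeff :: "real \<Rightarrow> nat \<Rightarrow> nat \<Rightarrow> real" where
  "lam_coeff \<mu> l k =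
     fact l * fact (k - l) * (real (k - l) + \<mu> + 1 / 2) /
     (pochhammer (\<mu> + 1 / 2) l * pochhammer (\<mu> + 3 / 2) (k - l) * (real k + \<mu> + 1 / 2))"

text \<open>\<open>D_kernel \<mu> k\<close> is the kernel \<open>D\<^sub>k\<close> with superscript \<open>\<mu> + 1/2\<close>.\<close>

definition D_kernel :: "real \<Rightarrow> nat \<Rightarrow> real \<Rightarrow> real \<Rightarrow> real \<Rightarrow> real" where
  "D_kernel \<mu> k \<xi> x y =
     (\<Sum>(l, e) \<in> disk_index k.
        lam_coeff \<mu> l k * disk_basis \<mu> k l e (cos \<xi>) (sin \<xi>) * disk_basis \<mu> k l e x y)"

definition Phi_kernel :: "real \<Rightarrow> nat \<Rightarrow> real \<Rightarrow> real \<Rightarrow> real \<Rightarrow> real \<Rightarrow> real" where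
  "Phi_kernel \<mu> n \<xi> t x y =
     (\<Sum>k\<le>n. (real k + \<mu> + 1 / 2) / (\<mu> + 1 / 2)
               * poly (gegenbauer (\<mu> + 1 / 2) k) t * D_kernel \<mu> k \<xi> x y)"

definition node_angle :: "nat \<Rightarrow> nat \<Rightarrow> real" where
  "node_angle m \<nu> = 2 * real \<nu> * pi / (2 * real m + 1)"

definition node :: "nat \<Rightarrow> nat \<Rightarrow> real^3" where
  "node m \<nu> = vector [cos (node_angle m \<nu>), sin (node_angle m \<nu>), 0]"

end

theory Submission
  imports Defs
begin

text \<open>
  Write \<open>\<lambda> = \<mu> + 1/2\<close>. Let \<open>D\<^sub>\<nu>\<close> be the homogeneous extension of \<open>D_kernel \<mu> k \<phi>\<^sub>\<nu>\<close> to
  \<open>\<real>\<^sup>3\<close>, and let \<open>c\<^sub>\<nu>(u) = (k + \<lambda>) / (2 \<pi>) C\<^sub>k\<^sup>\<lambda>(u \<bullet> \<zeta>\<^sub>\<nu>)\<close> on the sphere. Both are elements of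
  \<open>\<H>\<^sub>k\<^sup>\<mu>\<close> that are even in \<open>x\<^sub>3\<close>. By the Funk-Hecke argument \<open>c\<^sub>\<nu>\<close> evaluates every \<open>h \<in> \<H>\<^sub>k\<^sup>\<mu>\<close> at the
  equatorial point \<open>\<zeta>\<^sub>\<nu>\<close>, and integrating \<open>Q f(\<zeta>\<^sub>\<nu>; t) C\<^sub>k\<^sup>\<lambda>(t)\<close> over \<open>t\<close> gives \<open>\<langle>f, c\<^sub>\<nu>\<rangle>\<close> up to a constant.

  An even \<open>h \<in> \<H>\<^sub>k\<^sup>\<mu>\<close> that vanishes on the equator is \<open>0\<close>: it has the form \<open>x\<^sub>3\<^sup>2 q\<close> with \<open>q\<close> of
  degree \<open>k - 2\<close>, and \<open>0 = \<langle>h, q\<rangle>\<close> is the integral of \<open>x\<^sub>3\<^sup>2 q\<^sup>2\<close> against the weight. So identities between even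
  elements can be checked on the equator. There the coefficients \<open>\<lambda>\<^sub>l\<^sub>,\<^sub>k\<close> turn \<open>D\<^sub>\<nu>\<close> into the
  trigonometric Dirichlet kernel of the frequencies \<open>k, k - 2, \<dots>, -k\<close>, which interpolates exactly at
  the \<open>2m + 1\<close> nodes because \<open>k \<le> 2m\<close> and \<open>2m + 1\<close> is odd. Hence every even \<open>h\<close> satisfies
  \<open>(2m + 1) h = \<Sum>\<^sub>\<nu> h(\<zeta>\<^sub>\<nu>) D\<^sub>\<nu>\<close>, by duality also \<open>(2m + 1) h = \<Sum>\<^sub>\<nu> \<langle>h, D\<^sub>\<nu>\<rangle> c\<^sub>\<nu>\<close>, and therefore
  \<open>(2m + 1)\<^sup>-\<^sup>1 \<Sum>\<^sub>\<nu> \<langle>f, c\<^sub>\<nu>\<rangle> D\<^sub>\<nu>\<close> is the projection of an even \<open>f\<close>.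
\<close>

section \<open>Spherical coordinates\<close>

text \<open>Two slicings of the sphere carry the computations. Perpendicular to an equatorial axis,
  the slices are the circles of \<open>Q_transform\<close>; the weight splits into
  \<open>(1 - t\<^sup>2) powr \<mu>\<close> and a function of the angle, and averages of polynomials
  over the circles lead to Gegenbauer polynomials. Perpendicular to the third axis, the weight is
  constant on each slice, and the radial and angular parts of the disk basis separate. Both come
  from one parametrization followed by a rotation, because the surface measure is dt d\<alpha> for
  any choice of the axis. The spaces consist of polynomial functions on all of
  \<open>real^3\<close>, while the kernels live on the sphere. Extending C_k homogeneously uses its
  parity; extending the disk basis uses 2 r^2 - 1 = x_1^2 + x_2^2 - x_3^2 on the sphere. Gegenbauer
  and Jacobi polynomials are given by definite descriptions, so their values at 1 and their norms
  are read off an explicit terminating series. Since \<open>0 powr 0 = 0\<close>, several formulas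
  fail at the ends of the intervals and are stated on open intervals or almost everywhere.\<close>

definition sph_point :: "real \<Rightarrow> real \<Rightarrow> real^3" where
  "sph_point t \<alpha> = vector [t, sqrt (1 - t\<^sup>2) * cos \<alpha>, sqrt (1 - t\<^sup>2) * sin \<alpha>]"

text \<open>The polar axis is the first one, as in \<open>circle_point\<close> with \<zeta> = (1, 0,
  0). The entries of \<open>v\<close> are the radius, the height on the unit sphere and the
  longitude.\<close>

definition spherical_coords :: "real^3 \<Rightarrow> real^3" where
  "spherical_coords v = v $ 1 *\<^sub>R sph_point (v $ 2) (v $ 3)"

definition coord_box :: "(real^3) set" where
  "coord_box = {v. 0 < v $ 1 \<and> v $ 1 < 1 \<and> -1 < v $ 2 \<and> v $ 2 < 1 \<and> 0 < v $ 3 \<and> v $ 3 < 2 * pi}"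

lemma vec3_eq_iff: "(x::'a^3) = y \<longleftrightarrow> x $ 1 = y $ 1 \<and> x $ 2 = y $ 2 \<and> x $ 3 = y $ 3"
  by (simp add: vec_eq_iff forall_3)

lemma norm_vec3_sq: "(norm (x::real^3))\<^sup>2 = (x $ 1)\<^sup>2 + (x $ 2)\<^sup>2 + (x $ 3)\<^sup>2"
  by (simp add: norm_vec_def L2_set_def sum_3)

lemma sph_point_nth [simp]:
  "sph_point t \<alpha> $ 1 = t" "sph_point t \<alpha> $ 2 = sqrt (1 - t\<^sup>2) * cos \<alpha>"
  "sph_point t \<alpha> $ 3 = sqrt (1 - t\<^sup>2) * sin \<alpha>"
  by (simp_all add: sph_point_def)

lemma norm_sph_point:
  assumes "\<bar>t\<bar> \<le> 1" shows "norm (sph_point t \<alpha>) = 1"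
proof -
  have t: "t\<^sup>2 \<le> 1" using assms by (simp add: abs_square_le_1)
  have "(norm (sph_point t \<alpha>))\<^sup>2 = t\<^sup>2 + (1 - t\<^sup>2) * ((cos \<alpha>)\<^sup>2 + (sin \<alpha>)\<^sup>2)"
    using t by (simp add: norm_vec3_sq power_mult_distrib ring_distribs del: sin_cos_squared_add sin_cos_squared_add2)
  then have "(norm (sph_point t \<alpha>))\<^sup>2 = 1" by simp
  then show ?thesis by (simp add: power2_eq_1_iff) (metis norm_ge_zero not_one_le_zero order_trans zero_le_one neg_0_le_iff_le)
qed

lemma has_derivative_spherical_coords:
  fixes v :: "real^3"
  assumes "-1 < v $ 2" "v $ 2 < 1"
  defines "s \<equiv> sqrt (1 - (v $ 2)\<^sup>2)"
  shows "(spherical_coords has_derivative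
     (\<lambda>h. vector [h $ 1 * v $ 2 + v $ 1 * h $ 2,
        (h $ 1 * s - v $ 1 * (v $ 2 / s) * h $ 2) * cos (v $ 3) - v $ 1 * s * sin (v $ 3) * h $ 3,
        (h $ 1 * s - v $ 1 * (v $ 2 / s) * h $ 2) * sin (v $ 3) + v $ 1 * s * cos (v $ 3) * h $ 3])) (at v within A)"
proof -
  have "\<bar>v $ 2\<bar> < 1" using assms by auto
  then have p: "1 - (v $ 2)\<^sup>2 > 0" by (simp add: abs_square_less_1)
  have c: "((\<lambda>x::real^3. x $ i) has_derivative (\<lambda>x. x $ i)) (at v within A)" for i
    by (intro bounded_linear_imp_has_derivative bounded_linear_vec_nth)
  have sq: "((\<lambda>x::real^3. sqrt (1 - (x $ 2)\<^sup>2)) has_derivative (\<lambda>h. - (v $ 2 / s) * h $ 2)) (at v within A)"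
    unfolding s_def by (rule derivative_eq_intros c refl p | simp)+ (use p in \<open>auto simp: field_simps fun_eq_iff\<close>)
  have B: "(Basis :: (real^3) set) = {axis 1 1, axis 2 1, axis 3 1}"
    by (auto simp: Basis_vec_def UNIV_3)
  show ?thesis
    unfolding has_derivative_componentwise_within[of spherical_coords] B
    apply (simp add: inner_axis spherical_coords_def)
    apply (intro conjI)
    subgoal by (rule derivative_eq_intros c refl | simp add: fun_eq_iff algebra_simps)+
    subgoal by (rule derivative_eq_intros c sq refl | simp)+ (simp add: s_def fun_eq_iff algebra_simps)
    subgoal by (rule derivative_eq_intros c sq refl | simp)+ (simp add: s_def fun_eq_iff algebra_simps)
    done
qed

text \<open>The factor 1/s from differentiating the square root in the height cancels the s from the
  longitude: with q = t/s one has t (q s) + s^2 = 1. Only the radial factor survives, so the surface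
  measure has constant density in height and longitude.\<close>

lemma det_spherical_coords:
  fixes v :: "real^3"
  assumes "-1 < v $ 2" "v $ 2 < 1"
  defines "s \<equiv> sqrt (1 - (v $ 2)\<^sup>2)"
  shows "\<bar>det (matrix (\<lambda>h::real^3. vector [h $ 1 * v $ 2 + v $ 1 * h $ 2,
        (h $ 1 * s - v $ 1 * (v $ 2 / s) * h $ 2) * cos (v $ 3) - v $ 1 * s * sin (v $ 3) * h $ 3,
        (h $ 1 * s - v $ 1 * (v $ 2 / s) * h $ 2) * sin (v $ 3) + v $ 1 * s * cos (v $ 3) * h $ 3] :: real^3))\<bar>
       = (v $ 1)\<^sup>2" (is "\<bar>?D\<bar> = _")
proof -
  have "\<bar>v $ 2\<bar> < 1" using assms by auto
  then have p: "1 - (v $ 2)\<^sup>2 > 0" by (simp add: abs_square_less_1)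
  then have s: "s > 0" "s * s = 1 - (v $ 2)\<^sup>2" by (auto simp: s_def)
  have cs: "sin (v $ 3) * sin (v $ 3) = 1 - cos (v $ 3) * cos (v $ 3)"
    by (metis sin_squared_eq power2_eq_square)
  define c n where "c = cos (v $ 3)" and "n = sin (v $ 3)"
  define q where "q = v $ 2 / s"
  have q: "q * s = v $ 2" using s by (simp add: q_def)
  have "?D = - ((v $ 1)\<^sup>2 * ((v $ 2 * (q * s) + s * s) * (c * c + n * n)))"
    unfolding q_def[symmetric] c_def[symmetric] n_def[symmetric] by (simp add: det_3 matrix_def axis_def algebra_simps power2_eq_square)
  also have "\<dots> = - (v $ 1)\<^sup>2" unfolding q s c_def n_def cs by (simp add: power2_eq_square)
  finally show ?thesis by simp
qed

lemma sgn_spherical_coords: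
  assumes "v \<in> coord_box" shows "sgn (spherical_coords v) = sph_point (v $ 2) (v $ 3)"
    "norm (spherical_coords v) = v $ 1"
proof -
  have "norm (sph_point (v $ 2) (v $ 3)) = 1" using assms
    by (intro norm_sph_point) (auto simp: coord_box_def)
  then show "sgn (spherical_coords v) = sph_point (v $ 2) (v $ 3)" "norm (spherical_coords v) = v $ 1"
    using assms by (auto simp: spherical_coords_def sgn_div_norm coord_box_def)
qed

lemma cos_sin_inj:
  assumes "cos x = cos y" "sin x = sin y" "0 \<le> x" "x < 2 * pi" "0 \<le> y" "y < 2 * pi"
  shows "x = y"
proof -
  have "sin x = sin y \<and> cos x = cos y" using assms by simp
  then obtain n :: int where n: "x = y + 2 * pi * n" by (auto simp: sin_cos_eq_iff)
  have "2 * pi * \<bar>real_of_int n\<bar> = \<bar>x - y\<bar>" using n by (simp add: abs_mult)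
  then have "2 * pi * \<bar>real_of_int n\<bar> < 2 * pi * 1" using assms by linarith
  then have "n = 0" by (subst (asm) mult_less_cancel_left_pos) auto
  then show ?thesis using n by simp
qed

lemma inj_spherical_coords: "inj_on spherical_coords coord_box"
proof (rule inj_onI)
  fix u v assume uv: "u \<in> coord_box" "v \<in> coord_box" "spherical_coords u = spherical_coords v"
  have 1: "u $ 1 = v $ 1" using sgn_spherical_coords(2) uv by metis
  have e: "sph_point (u $ 2) (u $ 3) = sph_point (v $ 2) (v $ 3)" using sgn_spherical_coords(1) uv by metis
  then have 2: "u $ 2 = v $ 2" by (metis sph_point_nth(1))
  have "\<bar>v $ 2\<bar> < 1" using uv by (auto simp: coord_box_def)
  then have p: "1 - (v $ 2)\<^sup>2 > 0" by (simp add: abs_square_less_1)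
  have cs: "cos (u $ 3) = cos (v $ 3) \<and> sin (u $ 3) = sin (v $ 3)"
  proof -
    have "sqrt (1 - (v $ 2)\<^sup>2) \<noteq> 0" using p by (metis less_irrefl real_sqrt_eq_zero_cancel_iff)
    moreover have "sqrt (1 - (v $ 2)\<^sup>2) * cos (u $ 3) = sqrt (1 - (v $ 2)\<^sup>2) * cos (v $ 3)"
      using arg_cong[OF e, of "\<lambda>x. x $ 2"] unfolding sph_point_nth 2 .
    moreover have "sqrt (1 - (v $ 2)\<^sup>2) * sin (u $ 3) = sqrt (1 - (v $ 2)\<^sup>2) * sin (v $ 3)"
      using arg_cong[OF e, of "\<lambda>x. x $ 3"] unfolding sph_point_nth 2 .
    ultimately show ?thesis by (metis mult_cancel_left)
  qed
  have "u $ 3 = v $ 3"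
    using uv(1,2) by (intro cos_sin_inj[OF cs[THEN conjunct1] cs[THEN conjunct2]]) (auto simp: coord_box_def)
  with 1 2 show "u = v" by (simp add: vec3_eq_iff)
qed

text \<open>Excluding the plane x_3 = 0 takes care of both gaps of the open coordinate box at once:
  the polar axis, where the height is 1 or -1, and the half plane of longitude 0.\<close>

lemma spherical_coords_surj:
  assumes "norm x < 1" "x $ 3 \<noteq> 0" shows "x \<in> spherical_coords ` coord_box"
proof -
  define r where "r = norm x"
  define t where "t = x $ 1 / r"
  have r: "r > 0" "r < 1" using assms by (auto simp: r_def)
  have rr: "r\<^sup>2 = (x $ 1)\<^sup>2 + (x $ 2)\<^sup>2 + (x $ 3)\<^sup>2" by (simp add: r_def norm_vec3_sq)
  have d: "r\<^sup>2 - (x $ 1)\<^sup>2 > 0" using rr assms(2) by (simp add: add_nonneg_pos)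
  have t2: "1 - t\<^sup>2 = (r\<^sup>2 - (x $ 1)\<^sup>2) / r\<^sup>2" using r by (simp add: t_def field_simps)
  then have p: "1 - t\<^sup>2 > 0" using d r by simp
  then have tt: "-1 < t" "t < 1" using abs_square_less_1[of t] by auto
  define s where "s = sqrt (1 - t\<^sup>2)"
  have s: "s > 0" "s\<^sup>2 = 1 - t\<^sup>2" using p by (auto simp: s_def)
  have "(x $ 2 / (r * s))\<^sup>2 + (x $ 3 / (r * s))\<^sup>2 = ((x $ 2)\<^sup>2 + (x $ 3)\<^sup>2) / (r\<^sup>2 * s\<^sup>2)"
    by (simp add: power_divide power_mult_distrib add_divide_distrib)
  also have "r\<^sup>2 * s\<^sup>2 = (x $ 2)\<^sup>2 + (x $ 3)\<^sup>2"
  proof -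
    have "r\<^sup>2 * s\<^sup>2 = r\<^sup>2 - (x $ 1)\<^sup>2" unfolding s(2) t2 using r(1) by simp
    then show ?thesis unfolding rr by simp
  qed
  also have "((x $ 2)\<^sup>2 + (x $ 3)\<^sup>2) / \<dots> = 1"
    using d unfolding rr by (intro divide_self) linarith
  finally obtain a where a: "0 \<le> a" "a < 2 * pi" "x $ 2 / (r * s) = cos a" "x $ 3 / (r * s) = sin a"
    using sincos_total_2pi by metis
  have "a \<noteq> 0" using a assms(2) r s by auto
  define v :: "real^3" where "v = vector [r, t, a]"
  have "v \<in> coord_box" using a \<open>a \<noteq> 0\<close> r tt by (auto simp: v_def coord_box_def)
  moreover have "spherical_coords v = x"
  proof -
    have "r * t = x $ 1" using r by (simp add: t_def)
    moreover have "r * (s * cos a) = x $ 2" "r * (s * sin a) = x $ 3"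
      unfolding a(3,4)[symmetric] using r s by simp_all
    ultimately show ?thesis by (simp add: v_def spherical_coords_def vec3_eq_iff s_def)
  qed
  ultimately show ?thesis by blast
qed

section \<open>Lebesgue measure and surface measure in spherical parameters\<close>

lemma borel_measurable_vector3:
  fixes f g h :: "'a \<Rightarrow> real"
  assumes [measurable]: "f \<in> borel_measurable M" "g \<in> borel_measurable M" "h \<in> borel_measurable M"
  shows "(\<lambda>x. vector [f x, g x, h x] :: real^3) \<in> borel_measurable M"
proof (subst borel_measurable_euclidean_space, intro ballI)
  fix b :: "real^3" assume "b \<in> Basis"
  then obtain i where b: "b = axis i 1" by (auto simp: Basis_vec_def)
  have "i = 1 \<or> i = 2 \<or> i = 3" using exhaust_3 by blast
  then show "(\<lambda>x. vector [f x, g x, h x] \<bullet> b) \<in> borel_measurable M"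
    by (auto simp: b inner_axis)
qed

lemma measurable_sph_point [measurable]: "(\<lambda>p. sph_point (fst p) (snd p)) \<in> borel_measurable borel"
  unfolding sph_point_def borel_prod[symmetric] by (intro borel_measurable_vector3) measurable

lemma borel_measurable_nth3 [measurable]: "(\<lambda>x::real^3. x $ i) \<in> borel_measurable borel"
  by (intro borel_measurable_continuous_onI continuous_intros)

text \<open>Lebesgue measure is determined by its values on boxes. The product form makes Tonelli's
  theorem available for the three spherical coordinates.\<close>

lemma lborel_vector3:
  "(lborel :: (real^3) measure) = distr (lborel \<Otimes>\<^sub>M (lborel \<Otimes>\<^sub>M lborel)) borel (\<lambda>(a, b, c). vector [a, b, c])"
proof (rule lborel_eqI)
  have m: "(\<lambda>(a, b, c). vector [a, b, c] :: real^3) \<in> borel_measurable (lborel \<Otimes>\<^sub>M (lborel \<Otimes>\<^sub>M lborel))"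
    unfolding split_beta by (intro borel_measurable_vector3) measurable
  fix l u :: "real^3" assume le: "\<And>b. b \<in> Basis \<Longrightarrow> l \<bullet> b \<le> u \<bullet> b"
  have B: "(Basis :: (real^3) set) = {axis 1 1, axis 2 1, axis 3 1}"
    by (auto simp: Basis_vec_def UNIV_3)
  have l: "l $ 1 \<le> u $ 1" "l $ 2 \<le> u $ 2" "l $ 3 \<le> u $ 3"
    using le[of "axis 1 1"] le[of "axis 2 1"] le[of "axis 3 1"] by (simp_all add: B inner_axis)
  have pre: "(\<lambda>(a, b, c). vector [a, b, c]) -` box l u \<inter> space (lborel \<Otimes>\<^sub>M (lborel \<Otimes>\<^sub>M lborel))
     = {l $ 1<..<u $ 1} \<times> ({l $ 2<..<u $ 2} \<times> {l $ 3<..<u $ 3})"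
    by (auto simp: space_pair_measure mem_box_cart forall_3)
  have e: "emeasure (lborel \<Otimes>\<^sub>M lborel) ({l $ 2<..<u $ 2} \<times> {l $ 3<..<u $ 3}) = ennreal (u $ 2 - l $ 2) * ennreal (u $ 3 - l $ 3)"
    unfolding lborel_prod[symmetric] using l by (subst lborel.emeasure_pair_measure_Times) auto
  have "emeasure (distr (lborel \<Otimes>\<^sub>M (lborel \<Otimes>\<^sub>M lborel)) borel (\<lambda>(a, b, c). vector [a, b, c])) (box l u)
    = ennreal (u $ 1 - l $ 1) * (ennreal (u $ 2 - l $ 2) * ennreal (u $ 3 - l $ 3))"
    unfolding emeasure_distr[OF m, of "box l u", simplified] pre[simplified]
    using l by (subst sigma_finite_measure.emeasure_pair_measure_Times) (auto simp: e[unfolded lborel_prod] lborel_prod lborel.sigma_finite_measure_axioms)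
  also have "\<dots> = ennreal (\<Prod>b\<in>Basis. (u - l) \<bullet> b)"
    using l by (simp add: B inner_axis axis_eq_axis ennreal_mult[symmetric] mult.assoc)
  finally show "emeasure (distr (lborel \<Otimes>\<^sub>M (lborel \<Otimes>\<^sub>M lborel)) borel (\<lambda>(a, b, c). vector [a, b, c])) (box l u)
     = ennreal (\<Prod>b\<in>Basis. (u - l) \<bullet> b)" .
qed simp

lemma coord_box_borel [measurable]: "coord_box \<in> sets borel"
  unfolding coord_box_def by measurable

lemma sgn_vimage_borel:
  assumes "X \<in> sets borel" shows "{x :: real^3. sgn x \<in> X} \<in> sets borel"
proof -
  have "sgn \<in> borel_measurable (borel :: (real^3) measure)" unfolding sgn_div_norm by measurable
  from measurable_sets[OF this assms] show ?thesis by (simp add: vimage_def)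
qed

lemma measurable_sgn_sphere:
  "sgn \<in> restrict_space lborel (ball 0 1 - {0}) \<rightarrow>\<^sub>M restrict_space borel (sphere 0 1 :: (real^3) set)"
proof (rule measurable_restrict_space2)
  show "sgn \<in> space (restrict_space lborel (ball 0 1 - {0})) \<rightarrow> (sphere 0 1 :: (real^3) set)"
    by (auto simp: space_restrict_space norm_sgn)
  show "sgn \<in> borel_measurable (restrict_space lborel (ball 0 1 - {0 :: real^3}))"
    unfolding sgn_div_norm by (intro measurable_restrict_space1) measurable
qed

lemma space_sphere_measure [simp]: "space sphere_measure = sphere 0 1"
  by (simp add: sphere_measure_def space_restrict_space)

abbreviation "sphere_borel \<equiv> restrict_space borel (sphere (0 :: real^3) 1)"

lemma sets_sphere_measure [simp, measurable_cong]: "sets sphere_measure = sets sphere_borel"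
  by (simp add: sphere_measure_def)

lemma emeasure_sphere_measure_cone:
  assumes "X \<in> sets borel" "X \<subseteq> sphere 0 1"
  shows "emeasure sphere_measure X = 3 * emeasure lborel {x \<in> ball 0 1 - {0}. sgn x \<in> X}"
proof -
  have "X \<in> sets sphere_borel"
    using assms by (subst sets_restrict_space_iff) auto
  moreover have "sgn -` X \<inter> space (restrict_space lborel (ball 0 1 - {0})) = {x \<in> ball 0 1 - {0}. sgn x \<in> X}"
    by (auto simp: space_restrict_space)
  moreover have "emeasure (restrict_space lborel (ball 0 1 - {0})) {x \<in> ball 0 1 - {0}. sgn x \<in> X}
      = emeasure lborel {x \<in> ball 0 1 - {0}. sgn x \<in> X}"
    by (intro emeasure_restrict_space) auto
  ultimately show ?thesis
    unfolding sphere_measure_def using measurable_sgn_sphere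
    by (subst emeasure_distr) (simp_all add: space_scale_measure)
qed

text \<open>Closed, so that the iterated integrals run over the same closed intervals as in
  \<open>Q_transform\<close>; its edges are null sets.\<close>

definition param_set :: "(real \<times> real) set" where
  "param_set = {-1..1} \<times> {0..2 * pi}"

text \<open>Up to a null set the cone over \<open>X\<close> is the injective image of (0, 1) times
  \<open>Y\<close> under \<open>spherical_coords\<close>. The Jacobian r^2 depends on the radius
  alone, and its integral 1/3 cancels the factor 3 from \<open>sphere_measure\<close>.\<close>

lemma emeasure_cone:
  assumes X: "X \<in> sets borel" "X \<subseteq> sphere (0 :: real^3) 1"
  defines "Y \<equiv> {p \<in> {-1<..<1} \<times> {0<..<2 * pi}. sph_point (fst p) (snd p) \<in> X}"
  shows "3 * emeasure lborel {x \<in> ball 0 1 - {0}. sgn x \<in> X} = emeasure lborel Y"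
proof -
  define K where "K = {x \<in> ball 0 1 - {0}. sgn x \<in> X}"
  define S where "S = {v \<in> coord_box. sph_point (v $ 2) (v $ 3) \<in> X}"
  let ?g = "\<lambda>v::real^3. indicator S v * (v $ 1)\<^sup>2"
  have mp: "(\<lambda>v::real^3. sph_point (v $ 2) (v $ 3)) \<in> borel_measurable borel"
    unfolding sph_point_def by (intro borel_measurable_vector3) measurable
  have Smeas[measurable]: "S \<in> sets borel"
  proof -
    have "S = coord_box \<inter> ((\<lambda>v. sph_point (v $ 2) (v $ 3)) -` X \<inter> space borel)" by (auto simp: S_def)
    then show ?thesis using measurable_sets[OF mp X(1)] by simp
  qed
  have mp2: "(\<lambda>p. sph_point (fst p) (snd p)) \<in> borel_measurable borel"
    by (rule measurable_sph_point)
  have Ymeas[measurable]: "Y \<in> sets borel"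
  proof -
    have "Y = ({-1<..<1} \<times> {0<..<2 * pi}) \<inter> ((\<lambda>p. sph_point (fst p) (snd p)) -` X \<inter> space borel)" by (auto simp: Y_def)
    then show ?thesis using measurable_sets[OF mp2 X(1)] by (simp add: borel_open open_Times)
  qed
  have Kmeas: "K \<in> sets borel"
  proof -
    have "K = (ball 0 1 - {0}) \<inter> {x. sgn x \<in> X}" by (auto simp: K_def)
    then show ?thesis using sgn_vimage_borel[OF X(1)] by auto
  qed
  have le1: "\<bar>?g v\<bar> \<le> indicator (cbox (vector [0, -1, 0]) (vector [1, 1, 2 * pi])) v" for v :: "real^3"
    by (auto simp: indicator_def S_def coord_box_def mem_box_cart forall_3 power_le_one)
  have gint: "integrable lborel ?g"
    by (rule Bochner_Integration.integrable_bound[of _ "indicator (cbox (vector [0, -1, 0]) (vector [1, 1, 2 * pi])) :: real^3 \<Rightarrow> real"])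
       (use le1 in \<open>auto intro!: integrable_real_indicator simp: emeasure_lborel_cbox_eq\<close>)
  define I where "I = integral\<^sup>L lborel ?g"
  define D where "D = (\<lambda>(v::real^3) (h::real^3). vector [h $ 1 * v $ 2 + v $ 1 * h $ 2,
        (h $ 1 * sqrt (1 - (v $ 2)\<^sup>2) - v $ 1 * (v $ 2 / sqrt (1 - (v $ 2)\<^sup>2)) * h $ 2) * cos (v $ 3) - v $ 1 * sqrt (1 - (v $ 2)\<^sup>2) * sin (v $ 3) * h $ 3,
        (h $ 1 * sqrt (1 - (v $ 2)\<^sup>2) - v $ 1 * (v $ 2 / sqrt (1 - (v $ 2)\<^sup>2)) * h $ 2) * sin (v $ 3) + v $ 1 * sqrt (1 - (v $ 2)\<^sup>2) * cos (v $ 3) * h $ 3] :: real^3)"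
  have sub: "S \<subseteq> coord_box" by (auto simp: S_def)
  have D: "\<bar>det (matrix (D v))\<bar> = (v $ 1)\<^sup>2" "(spherical_coords has_derivative D v) (at v within S)"
    if "v \<in> S" for v
  proof -
    have v: "-1 < v $ 2" "v $ 2 < 1" using that sub by (auto simp: coord_box_def)
    show "\<bar>det (matrix (D v))\<bar> = (v $ 1)\<^sup>2" unfolding D_def by (rule det_spherical_coords[OF v])
    show "(spherical_coords has_derivative D v) (at v within S)"
      unfolding D_def by (rule has_derivative_spherical_coords[OF v])
  qed
  have "(?g has_integral I) UNIV" unfolding I_def by (rule has_integral_integral_lborel[OF gint])
  moreover have g_eq: "(\<lambda>v. if v \<in> S then (v $ 1)\<^sup>2 else 0) = ?g" by auto
  ultimately have "((\<lambda>v. (v $ 1)\<^sup>2) has_integral I) S"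
    by (subst has_integral_restrict_UNIV[symmetric])
       (simp add: g_eq)
  then have hI: "((\<lambda>v. \<bar>det (matrix (D v))\<bar>) has_integral I) S"
    by (rule has_integral_eq[rotated]) (simp add: D)
  have "spherical_coords ` S \<in> lmeasurable \<and> measure lebesgue (spherical_coords ` S) = I"
  proof -
    have SL: "S \<in> sets lebesgue" using Smeas by simp
    have inj: "inj_on spherical_coords S" by (rule inj_on_subset[OF inj_spherical_coords sub])
    show ?thesis using has_measure_differentiable_image[OF SL D(2) inj, of I] hI by (rule iffD2)
  qed
  then have eI: "emeasure lebesgue (spherical_coords ` S) = ennreal I"
    using emeasure_eq_ennreal_measure[OF fmeasurableD2] by metis
  have im: "spherical_coords ` S \<subseteq> K"
  proof
    fix x assume "x \<in> spherical_coords ` S"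
    then obtain v where v: "v \<in> S" "x = spherical_coords v" by auto
    with sub sgn_spherical_coords[of v] show "x \<in> K"
      by (force simp: K_def S_def coord_box_def)
  qed
  \<comment> \<open>The coordinates may miss points of the cone, but only in the null plane x_3 =
    0.\<close>
  have im2: "K \<subseteq> spherical_coords ` S \<union> {x. x $ 3 = 0}"
  proof
    fix x assume x: "x \<in> K"
    show "x \<in> spherical_coords ` S \<union> {x. x $ 3 = 0}"
    proof (cases "x $ 3 = 0")
      case False
      then obtain v where v: "v \<in> coord_box" "x = spherical_coords v"
        using spherical_coords_surj[of x] x by (auto simp: K_def)
      then have "v \<in> S" using x sgn_spherical_coords(1)[OF v(1)] by (simp add: K_def S_def)
      then show ?thesis using v by auto
    qed auto
  qed
  have "emeasure lebesgue K = emeasure lebesgue (spherical_coords ` S)"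
  proof (rule emeasure_eq_AE)
    have "{x::real^3. x $ 3 = 0} \<in> null_sets lebesgue"
      using negligible_standard_hyperplane_cart[of 3] by (simp add: negligible_iff_null_sets)
    then show "AE x in lebesgue. x \<in> K \<longleftrightarrow> x \<in> spherical_coords ` S"
      by (rule AE_I') (use im im2 in auto)
  qed (use Kmeas \<open>_ \<and> measure lebesgue (spherical_coords ` S) = I\<close> in \<open>auto simp: fmeasurable_def\<close>)
  then have K: "emeasure lborel K = ennreal I" using eI Kmeas by (simp add: emeasure_completion)
  have "ennreal I = (\<integral>\<^sup>+ v. ennreal (?g v) \<partial>lborel)"
    unfolding I_def by (rule nn_integral_eq_integral[symmetric, OF gint]) auto
  also have "\<dots> = (\<integral>\<^sup>+ x. ennreal (?g (case x of (a, b, c) \<Rightarrow> vector [a, b, c])) \<partial>(lborel \<Otimes>\<^sub>M (lborel \<Otimes>\<^sub>M lborel)))"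
    unfolding lborel_vector3
  proof (subst nn_integral_distr)
    show "(\<lambda>(a, b, c). vector [a, b, c]) \<in> (lborel \<Otimes>\<^sub>M (lborel \<Otimes>\<^sub>M lborel)) \<rightarrow>\<^sub>M (borel :: (real^3) measure)"
      unfolding split_beta by (intro borel_measurable_vector3) measurable
  qed simp_all
  also have "\<dots> = (\<integral>\<^sup>+ x. ennreal (indicator {0<..<1} (fst x) * (fst x)\<^sup>2) * indicator Y (snd x) \<partial>(lborel \<Otimes>\<^sub>M lborel))"
    unfolding lborel_prod
    by (intro nn_integral_cong) (auto simp: indicator_def S_def Y_def coord_box_def)
  also have "\<dots> = (\<integral>\<^sup>+ a. \<integral>\<^sup>+ p. ennreal (indicator {0<..<1} a * a\<^sup>2) * indicator Y p \<partial>lborel \<partial>lborel)"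
    by (subst lborel.nn_integral_fst[symmetric]) auto
  also have "\<dots> = (\<integral>\<^sup>+ a. ennreal (indicator {0<..<1::real} a * a\<^sup>2) * emeasure lborel Y \<partial>lborel)"
    by (simp add: nn_integral_cmult_indicator)
  also have "\<dots> = (\<integral>\<^sup>+ a. ennreal (indicator {0<..<1::real} a * a\<^sup>2) \<partial>lborel) * emeasure lborel Y"
    by (subst nn_integral_multc) auto
  also have "(\<integral>\<^sup>+ a. ennreal (indicator {0<..<1::real} a * a\<^sup>2) \<partial>lborel) = (\<integral>\<^sup>+ a. ennreal (a\<^sup>2) * indicator {0..1} a \<partial>lborel)"
    by (rule nn_integral_cong_AE, rule eventually_mono[OF AE_conjI[OF AE_lborel_singleton[of 0] AE_lborel_singleton[of 1]]])
       (auto simp: indicator_def)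
  also have "\<dots> = ennreal (1 ^ 3 / 3 - 0 ^ 3 / 3)"
    by (rule nn_integral_FTC_Icc) (auto intro!: derivative_eq_intros)
  finally have "emeasure lborel K = ennreal (1 / 3) * emeasure lborel Y" using K by simp
  then have "3 * emeasure lborel K = (ennreal 3 * ennreal (1 / 3)) * emeasure lborel Y" by (simp add: mult.assoc)
  also have "ennreal 3 * ennreal (1 / 3) = 1" by (subst ennreal_mult[symmetric]) auto
  finally show ?thesis by (simp add: K_def)
qed

lemma measurable_sph_point_param:
  "(\<lambda>p. sph_point (fst p) (snd p)) \<in> restrict_space lborel param_set \<rightarrow>\<^sub>M sphere_borel"
proof (rule measurable_restrict_space2)
  show "(\<lambda>p. sph_point (fst p) (snd p)) \<in> space (restrict_space lborel param_set) \<rightarrow> sphere 0 1"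
    by (auto simp: space_restrict_space param_set_def intro!: norm_sph_point)
  show "(\<lambda>p. sph_point (fst p) (snd p)) \<in> borel_measurable (restrict_space lborel param_set)"
    by (intro measurable_restrict_space1) (use measurable_sph_point in simp)
qed

lemma param_set_borel [measurable]: "param_set \<in> sets borel"
  by (auto simp: param_set_def intro!: borel_closed closed_Times)

text \<open>This is Archimedes' theorem that projecting the sphere to the circumscribed cylinder
  preserves area. Passing from the open to the closed rectangle adds only pieces of four
  lines.\<close>

lemma sphere_measure_param:
  "sphere_measure = distr (restrict_space lborel param_set) sphere_borel (\<lambda>p. sph_point (fst p) (snd p))"
  (is "_ = ?D")
proof (rule measure_eqI)
  let ?B = "{-1..1::real} \<times> {0..2 * pi} - {-1<..<1} \<times> {0<..<2 * pi}"
  fix X assume "X \<in> sets sphere_measure"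
  then have X: "X \<in> sets sphere_borel" by simp
  then have X': "X \<in> sets borel" "X \<subseteq> sphere 0 1" by (auto simp: sets_restrict_space_iff)
  define Y where "Y = {p \<in> {-1<..<1} \<times> {0<..<2 * pi}. sph_point (fst p) (snd p) \<in> X}"
  define Z where "Z = {p \<in> param_set. sph_point (fst p) (snd p) \<in> X}"
  have mp2: "(\<lambda>p. sph_point (fst p) (snd p)) \<in> borel_measurable borel"
    by (rule measurable_sph_point)
  have pre: "(\<lambda>p. sph_point (fst p) (snd p)) -` X \<in> sets borel" using measurable_sets[OF mp2 X'(1)] by simp
  have "Y = ({-1<..<1} \<times> {0<..<2 * pi}) \<inter> (\<lambda>p. sph_point (fst p) (snd p)) -` X" by (auto simp: Y_def)
  then have Y: "Y \<in> sets borel" using pre by (simp add: borel_open open_Times)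
  have "Z = param_set \<inter> (\<lambda>p. sph_point (fst p) (snd p)) -` X" by (auto simp: Z_def)
  then have Z: "Z \<in> sets borel" using pre by simp
  have "?B \<subseteq> {p. (1, 0) \<bullet> p = -1} \<union> {p. (1, 0) \<bullet> p = 1} \<union> {p. (0, 1) \<bullet> p = 0} \<union> {p. (0, 1) \<bullet> p = 2 * pi}"
    by (auto simp: inner_real_def)
  moreover have "negligible ({p. (1::real, 0::real) \<bullet> p = -1} \<union> {p. (1, 0) \<bullet> p = 1} \<union> {p. (0, 1) \<bullet> p = 0} \<union> {p. (0, 1) \<bullet> p = 2 * pi})"
    by (intro negligible_Un negligible_hyperplane) (auto simp: zero_prod_def)
  ultimately have N: "negligible (?B)" by (rule negligible_subset[rotated])
  have "emeasure lebesgue Y = emeasure lebesgue Z"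
  proof (rule emeasure_eq_AE)
    show "AE x in lebesgue. x \<in> Y \<longleftrightarrow> x \<in> Z"
      by (rule AE_I'[of "?B"])
         (use N in \<open>auto simp: Y_def Z_def param_set_def negligible_iff_null_sets\<close>)
  qed (use Y Z in auto)
  then have YZ: "emeasure lborel Y = emeasure lborel Z" using Y Z by (simp add: emeasure_completion)
  have "emeasure ?D X
    = emeasure (restrict_space lborel param_set) Z"
    by (subst emeasure_distr[OF measurable_sph_point_param X]) (auto simp: Z_def space_restrict_space intro!: arg_cong[of _ _ "emeasure _"])
  also have "\<dots> = emeasure lborel Z" by (subst emeasure_restrict_space) (auto simp: Z_def)
  finally show "emeasure sphere_measure X = emeasure ?D X"
    using emeasure_sphere_measure_cone[OF X'] emeasure_cone[OF X'] YZ by (simp add: Y_def)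
qed simp

section \<open>Integration over the sphere\<close>

lemma borel_measurable_orthogonal:
  fixes T :: "real^3 \<Rightarrow> real^3"
  assumes "orthogonal_transformation T" shows "T \<in> borel_measurable borel"
  using assms by (intro borel_measurable_continuous_onI linear_continuous_on)
    (simp add: orthogonal_transformation_linear linear_linear)

lemma distr_lborel_orthogonal:
  fixes T :: "real^3 \<Rightarrow> real^3"
  assumes T: "orthogonal_transformation T"
  shows "distr lborel borel T = lborel"
proof (rule lborel_eqI[symmetric])
  have [measurable]: "T \<in> borel_measurable borel"
    by (rule borel_measurable_orthogonal[OF T])
  fix l u :: "real^3" assume le: "\<And>b. b \<in> Basis \<Longrightarrow> l \<bullet> b \<le> u \<bullet> b"
  have inv: "orthogonal_transformation (inv T)" "T -` box l u = inv T ` box l u"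
    using T by (simp_all add: orthogonal_transformation_inv orthogonal_transformation_bij bij_vimage_eq_inv_image)
  have m: "inv T ` box l u \<in> lmeasurable" by (rule measurable_orthogonal_image[OF inv(1)]) simp
  have meas: "inv T ` box l u \<in> sets borel"
    using measurable_sets[of T borel borel "box l u"] inv(2) by simp
  have "emeasure (distr lborel borel T) (box l u) = emeasure lborel (inv T ` box l u)"
    by (subst emeasure_distr) (auto simp: inv(2))
  also have "\<dots> = emeasure lebesgue (inv T ` box l u)" using meas by (simp add: emeasure_completion)
  also have "\<dots> = ennreal (measure lebesgue (inv T ` box l u))"
    by (rule emeasure_eq_ennreal_measure[OF fmeasurableD2[OF m]])
  also have "\<dots> = ennreal (measure lebesgue (box l u))"
    using measure_orthogonal_image[OF inv(1), of "box l u"] by simp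
  also have "\<dots> = ennreal (\<Prod>b\<in>Basis. (u - l) \<bullet> b)" using le by simp
  finally show "emeasure (distr lborel borel T) (box l u) = ennreal (\<Prod>b\<in>Basis. (u - l) \<bullet> b)" .
qed simp

lemma measurable_orthogonal_sphere:
  assumes T: "orthogonal_transformation (T :: real^3 \<Rightarrow> real^3)"
  shows "T \<in> sphere_measure \<rightarrow>\<^sub>M sphere_borel"
proof -
  have b: "T \<in> borel_measurable borel"
    by (rule borel_measurable_orthogonal[OF T])
  have "T \<in> sphere_borel \<rightarrow>\<^sub>M sphere_borel"
    using T by (intro measurable_restrict_space2 measurable_restrict_space1 b)
      (auto simp: orthogonal_transformation_norm space_restrict_space)
  then show ?thesis by (simp cong: measurable_cong_sets)
qed

text \<open>An orthogonal map commutes with \<open>sgn\<close>, so it carries cones to cones, and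
  the invariance is inherited from Lebesgue measure.\<close>

lemma distr_sphere_measure_orthogonal:
  assumes T: "orthogonal_transformation (T :: real^3 \<Rightarrow> real^3)"
  shows "distr sphere_measure sphere_borel T = sphere_measure"
proof (rule measure_eqI)
  have Tb[measurable]: "T \<in> borel_measurable borel"
    by (rule borel_measurable_orthogonal[OF T])
  have lin: "linear T" and n: "norm (T x) = norm x" for x
    using T by (auto simp: orthogonal_transformation)
  have sgnT: "sgn (T x) = T (sgn x)" for x using lin by (simp add: sgn_div_norm n linear_scale)
  fix X assume "X \<in> sets (distr sphere_measure sphere_borel T)"
  then have X: "X \<in> sets sphere_borel" by simp
  then have X': "X \<in> sets borel" "X \<subseteq> sphere 0 1" by (auto simp: sets_restrict_space_iff)
  have X2: "T -` X \<in> sets borel" "T -` X \<subseteq> sphere 0 1"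
    using measurable_sets[OF Tb X'(1)] X'(2) n by auto
  have C: "{x \<in> ball 0 1 - {0}. sgn x \<in> X} \<in> sets borel"
    using sgn_vimage_borel[OF X'(1)] by (auto simp: Collect_conj_eq)
  have "emeasure (distr sphere_measure sphere_borel T) X = emeasure sphere_measure (T -` X)"
    using X2 by (subst emeasure_distr[OF measurable_orthogonal_sphere[OF T] X]) (simp add: Int_absorb2)
  also have "\<dots> = 3 * emeasure lborel {x \<in> ball 0 1 - {0}. T (sgn x) \<in> X}"
    using emeasure_sphere_measure_cone[OF X2] by simp
  also have "{x \<in> ball 0 1 - {0}. T (sgn x) \<in> X} = T -` {x \<in> ball 0 1 - {0}. sgn x \<in> X} \<inter> space lborel"
    using n by (auto simp: sgnT) (metis n norm_eq_zero)+
  also have "emeasure lborel \<dots> = emeasure (distr lborel borel T) {x \<in> ball 0 1 - {0}. sgn x \<in> X}"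
    using C by (subst emeasure_distr) auto
  also have "\<dots> = emeasure lborel {x \<in> ball 0 1 - {0}. sgn x \<in> X}"
    by (simp add: distr_lborel_orthogonal[OF T])
  finally show "emeasure (distr sphere_measure sphere_borel T) X = emeasure sphere_measure X"
    using emeasure_sphere_measure_cone[OF X'] by simp
qed simp

lemma integrable_sphere_orthogonal:
  fixes g :: "real^3 \<Rightarrow> real"
  assumes T: "orthogonal_transformation T" and g: "integrable sphere_measure g"
  shows "integrable sphere_measure (\<lambda>x. g (T x))"
    "(LINT x|sphere_measure. g (T x)) = (LINT x|sphere_measure. g x)"
proof -
  have gm: "g \<in> borel_measurable sphere_borel"
    using borel_measurable_integrable[OF g] by (simp cong: measurable_cong_sets)
  have "integrable (distr sphere_measure sphere_borel T) g"
    using g by (simp add: distr_sphere_measure_orthogonal[OF T])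
  then show "integrable sphere_measure (\<lambda>x. g (T x))"
    by (rule integrable_distr[OF measurable_orthogonal_sphere[OF T]])
  show "(LINT x|sphere_measure. g (T x)) = (LINT x|sphere_measure. g x)"
    using integral_distr[OF measurable_orthogonal_sphere[OF T] gm]
    by (simp add: distr_sphere_measure_orthogonal[OF T])
qed

text \<open>The map \<open>T\<close> chooses the axis of the slicing: \<open>rot3 \<theta>\<close>
  yields the circles of the spherical transform, \<open>cycle3\<close> the circles of constant
  x_3.\<close>

lemma sphere_integral_iterated:
  fixes g :: "real^3 \<Rightarrow> real"
  assumes T: "orthogonal_transformation T" and g: "integrable sphere_measure g"
  shows "(LINT x|sphere_measure. g x) = (LBINT t:{-1..1}. (LBINT \<alpha>:{0..2 * pi}. g (T (sph_point t \<alpha>))))"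
    "set_integrable lborel {-1..1} (\<lambda>t. LBINT \<alpha>:{0..2 * pi}. g (T (sph_point t \<alpha>)))"
proof -
  let ?h = "\<lambda>p. g (T (sph_point (fst p) (snd p)))"
  note i = integrable_sphere_orthogonal[OF T g]
  have gm: "(\<lambda>x. g (T x)) \<in> borel_measurable sphere_borel"
    using borel_measurable_integrable[OF i(1)] by (simp cong: measurable_cong_sets)
  have "integrable (restrict_space lborel param_set) ?h"
    using i(1)[unfolded sphere_measure_param] by (rule integrable_distr[OF measurable_sph_point_param])
  then have hi: "integrable (lborel \<Otimes>\<^sub>M lborel) (\<lambda>p. indicator param_set p *\<^sub>R ?h p)"
    by (subst (asm) integrable_restrict_space) (auto simp: lborel_prod)
  have slice: "(LINT \<alpha>|lborel. indicator param_set (t, \<alpha>) *\<^sub>R ?h (t, \<alpha>)) =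
      indicator {-1..1} t *\<^sub>R (LBINT \<alpha>:{0..2 * pi}. g (T (sph_point t \<alpha>)))" for t
    unfolding set_lebesgue_integral_def by (auto simp: param_set_def indicator_def)
  from lborel_pair.integrable_fst'[OF hi]
  show "set_integrable lborel {-1..1} (\<lambda>t. LBINT \<alpha>:{0..2 * pi}. g (T (sph_point t \<alpha>)))"
    unfolding slice set_integrable_def .
  have "(LINT x|sphere_measure. g x) = (LINT p|restrict_space lborel param_set. ?h p)"
    using integral_distr[OF measurable_sph_point_param gm] i(2) by (simp add: sphere_measure_param[symmetric])
  also have "\<dots> = (LINT p|(lborel \<Otimes>\<^sub>M lborel). indicator param_set p *\<^sub>R ?h p)"
    by (subst integral_restrict_space) (auto simp: lborel_prod)
  also have "\<dots> = (LINT t|lborel. LINT \<alpha>|lborel. indicator param_set (t, \<alpha>) *\<^sub>R ?h (t, \<alpha>))"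
    by (rule lborel_pair.integral_fst'[symmetric, OF hi])
  also have "\<dots> = (LBINT t:{-1..1}. (LBINT \<alpha>:{0..2 * pi}. g (T (sph_point t \<alpha>))))"
    unfolding slice by (simp add: set_lebesgue_integral_def)
  finally show "(LINT x|sphere_measure. g x) = (LBINT t:{-1..1}. (LBINT \<alpha>:{0..2 * pi}. g (T (sph_point t \<alpha>))))" .
qed

lemma finite_measure_sphere_measure: "finite_measure sphere_measure"
proof (rule finite_measureI)
  have "emeasure (restrict_space lborel param_set) param_set = emeasure lborel param_set"
    by (intro emeasure_restrict_space) auto
  also have "\<dots> < \<infinity>" unfolding param_set_def lborel_prod[symmetric]
    by (subst lborel.emeasure_pair_measure_Times) (auto simp: ennreal_mult_less_top)
  finally have "emeasure (restrict_space lborel param_set) param_set < \<infinity>" .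
  moreover have "(\<lambda>p. sph_point (fst p) (snd p)) -` sphere 0 1 \<inter> param_set = param_set"
    using measurable_sph_point_param[THEN measurable_space] by (auto simp: space_restrict_space)
  ultimately show "emeasure sphere_measure (space sphere_measure) \<noteq> \<infinity>"
    unfolding space_sphere_measure unfolding sphere_measure_param
    by (subst emeasure_distr[OF measurable_sph_point_param])
       (auto simp: sets_restrict_space_iff space_restrict_space)
qed

section \<open>The weight, integrability, and definiteness of the inner product\<close>

lemma sphere_weight_nonneg: "0 \<le> sphere_weight \<mu> x"
  by (simp add: sphere_weight_def)

lemma sphere_weight_le_1:
  assumes "\<mu> \<ge> 0" "x \<in> sphere 0 1" shows "sphere_weight \<mu> x \<le> 1"
proof -
  have "\<bar>x $ 3\<bar> \<le> 1" using component_le_norm_cart[of x 3] assms by simp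
  then show ?thesis using assms by (auto simp: sphere_weight_def intro!: powr_le1)
qed

lemma borel_measurable_sphere_weight [measurable]: "sphere_weight \<mu> \<in> borel_measurable borel"
  unfolding sphere_weight_def by measurable

lemma borel_measurable_sphereI:
  "g \<in> borel_measurable borel \<Longrightarrow> g \<in> borel_measurable sphere_measure"
  by (simp add: measurable_restrict_space1 cong: measurable_cong_sets)

lemma integrable_sphere_continuous:
  fixes g :: "real^3 \<Rightarrow> real"
  assumes g: "continuous_on UNIV g" and "\<mu> \<ge> 0"
  shows "integrable sphere_measure (\<lambda>x. g x * sphere_weight \<mu> x)"
proof -
  have "compact (g ` sphere 0 1)" using g by (intro compact_continuous_image) (auto intro: continuous_on_subset)
  then obtain B where B: "\<And>x. x \<in> sphere 0 1 \<Longrightarrow> \<bar>g x\<bar> \<le> B"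
    using compact_imp_bounded by (fastforce simp: bounded_iff)
  interpret finite_measure sphere_measure by (rule finite_measure_sphere_measure)
  show ?thesis
  proof (rule integrable_const_bound[of _ B])
    have "\<bar>g x * sphere_weight \<mu> x\<bar> \<le> B * 1" if "x \<in> sphere 0 1" for x
      unfolding abs_mult using B[OF that] sphere_weight_le_1[OF \<open>\<mu> \<ge> 0\<close> that] sphere_weight_nonneg[of \<mu> x]
      by (intro mult_mono) auto
    then show "AE x in sphere_measure. norm (g x * sphere_weight \<mu> x) \<le> B" by (intro AE_I2) auto
    show "(\<lambda>x. g x * sphere_weight \<mu> x) \<in> borel_measurable sphere_measure"
      by (intro borel_measurable_sphereI borel_measurable_times borel_measurable_continuous_onI[OF g]
        borel_measurable_sphere_weight)
  qed
qed

text \<open>Dominated through 2 |f g| \<le> f^2 + g^2; the second square is integrable because a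
  continuous function is bounded on the sphere.\<close>

lemma integrable_sphere_L2:
  fixes g :: "real^3 \<Rightarrow> real"
  assumes f: "f \<in> L2_sphere \<mu>" and g: "continuous_on UNIV g" and "\<mu> \<ge> 0"
  shows "integrable sphere_measure (\<lambda>x. f x * g x * sphere_weight \<mu> x)"
proof (rule Bochner_Integration.integrable_bound)
  have [measurable]: "f \<in> borel_measurable sphere_measure" "g \<in> borel_measurable sphere_measure"
      "sphere_weight \<mu> \<in> borel_measurable sphere_measure"
    using f borel_measurable_continuous_onI[OF g] by (auto simp: L2_sphere_def intro: borel_measurable_sphereI)
  have "continuous_on UNIV (\<lambda>x. (g x)\<^sup>2)" using g by (intro continuous_intros)
  from integrable_sphere_continuous[OF this \<open>\<mu> \<ge> 0\<close>]
  show "integrable sphere_measure (\<lambda>x. (f x)\<^sup>2 * sphere_weight \<mu> x + (g x)\<^sup>2 * sphere_weight \<mu> x)"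
    using f by (intro Bochner_Integration.integrable_add) (auto simp: L2_sphere_def)
  show "(\<lambda>x. f x * g x * sphere_weight \<mu> x) \<in> borel_measurable sphere_measure" by measurable
  show "AE x in sphere_measure. norm (f x * g x * sphere_weight \<mu> x)
     \<le> norm ((f x)\<^sup>2 * sphere_weight \<mu> x + (g x)\<^sup>2 * sphere_weight \<mu> x)"
  proof (rule AE_I2)
    fix x
    have "2 * \<bar>f x * g x\<bar> \<le> (f x)\<^sup>2 + (g x)\<^sup>2"
      using sum_squares_bound[of "\<bar>f x\<bar>" "\<bar>g x\<bar>"] by (simp add: abs_mult)
    moreover have "0 \<le> \<bar>f x * g x\<bar>" by simp
    ultimately have "\<bar>f x * g x\<bar> * sphere_weight \<mu> x \<le> ((f x)\<^sup>2 + (g x)\<^sup>2) * sphere_weight \<mu> x"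
      using sphere_weight_nonneg[of \<mu> x] by (intro mult_right_mono) linarith+
    then show "norm (f x * g x * sphere_weight \<mu> x) \<le> norm ((f x)\<^sup>2 * sphere_weight \<mu> x + (g x)\<^sup>2 * sphere_weight \<mu> x)"
      using sphere_weight_nonneg[of \<mu> x] by (simp add: abs_mult ring_distribs)
  qed
qed

text \<open>For \<mu> > 0 the weight vanishes on the equator, so a zero norm gives no information
  there; the equator has to be discarded as a null set.\<close>

lemma AE_sphere_nth3: "AE x in sphere_measure. x $ 3 \<noteq> 0"
proof (rule AE_I')
  let ?X = "{x \<in> sphere (0::real^3) 1. x $ 3 = 0}"
  have X: "?X \<in> sets borel" by measurable
  have "{x \<in> ball 0 1 - {0}. sgn x \<in> ?X} \<subseteq> {x. x $ 3 = 0}" by (auto simp: sgn_div_norm)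
  moreover have "{x::real^3. x $ 3 = 0} \<in> null_sets lborel"
  proof -
    have "{x::real^3. x $ 3 = 0} \<in> sets borel" by measurable
    moreover have "{x::real^3. x $ 3 = 0} \<in> null_sets lebesgue"
      using negligible_standard_hyperplane_cart[of 3] by (simp add: negligible_iff_null_sets)
    ultimately show ?thesis by (auto simp: null_sets_def emeasure_completion)
  qed
  moreover have "{x \<in> ball 0 1 - {0}. sgn x \<in> ?X} \<in> sets borel"
  proof -
    have "(ball 0 1 - {0}) \<inter> {x. sgn x \<in> ?X} \<in> sets borel" using sgn_vimage_borel[OF X] by (intro sets.Int) auto
    then show ?thesis by (simp only: Int_def mem_Collect_eq)
  qed
  ultimately have "emeasure lborel {x \<in> ball 0 1 - {0}. sgn x \<in> ?X} = 0"
    by (metis (no_types, lifting) null_setsD1 null_sets_subset sets_lborel)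
  then have "emeasure sphere_measure ?X = 0"
    by (subst emeasure_sphere_measure_cone) (use X in auto)
  then show "?X \<in> null_sets sphere_measure"
    using X by (auto simp: null_sets_def sets_restrict_space_iff)
qed auto

text \<open>A nonzero value persists by continuity on a nonempty open truncated cone, and open sets
  are not negligible.\<close>

lemma sphere_AE_zero_imp_zero:
  fixes g :: "real^3 \<Rightarrow> real"
  assumes g: "continuous_on UNIV g" and AE: "AE x in sphere_measure. g x = 0" and x: "x \<in> sphere 0 1"
  shows "g x = 0"
proof (rule ccontr)
  assume "g x \<noteq> 0"
  let ?X = "{x \<in> sphere 0 1. g x \<noteq> 0}"
  have gm[measurable]: "g \<in> borel_measurable borel" by (rule borel_measurable_continuous_onI[OF g])
  have X: "?X \<in> sets borel" by measurable
  have "{x \<in> space sphere_measure. g x \<noteq> 0} \<in> null_sets sphere_measure"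
  proof -
    note [measurable] = borel_measurable_sphereI[OF gm]
    have "{x \<in> space sphere_measure. \<not> g x = 0} \<in> sets sphere_measure" by measurable
    then show ?thesis using AE by (simp add: AE_iff_null)
  qed
  then have "emeasure sphere_measure ?X = 0" by (auto simp: null_sets_def)
  then have z: "emeasure lborel {x \<in> ball 0 1 - {0}. sgn x \<in> ?X} = 0"
    by (subst (asm) emeasure_sphere_measure_cone) (use X in auto)
  have eq: "{x \<in> ball 0 1 - {0}. sgn x \<in> ?X} = (ball 0 1 - {0}) \<inter> (\<lambda>x. g (sgn x)) -` (- {0})"
    by (auto simp: norm_sgn)
  have "continuous_on (ball 0 1 - {0}) (\<lambda>x. g (sgn x))"
    by (rule continuous_on_compose2[OF g]) (auto intro!: continuous_intros simp: sgn_div_norm)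
  then have op: "open {x \<in> ball 0 1 - {0}. sgn x \<in> ?X}"
    unfolding eq by (intro continuous_open_preimage) auto
  moreover have "negligible {x \<in> ball 0 1 - {0}. sgn x \<in> ?X}"
    using z op by (auto simp: negligible_iff_null_sets null_sets_def emeasure_completion borel_open)
  ultimately have "{x \<in> ball 0 1 - {0}. sgn x \<in> ?X} = {}" using open_not_negligible by blast
  moreover have "(1 / 2) *\<^sub>R x \<in> {x \<in> ball 0 1 - {0}. sgn x \<in> ?X}"
    using x \<open>g x \<noteq> 0\<close> by (auto simp: sgn_scaleR sgn_div_norm[of x])
  ultimately show False by blast
qed

lemma sphere_inner_self_zero:
  assumes g: "continuous_on UNIV g" and "\<mu> \<ge> 0" "sphere_inner \<mu> g g = 0" "x \<in> sphere 0 1"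
  shows "g x = 0"
proof (rule sphere_AE_zero_imp_zero[OF g _ assms(4)])
  have "continuous_on UNIV (\<lambda>x. g x * g x)" using g by (intro continuous_intros)
  from integrable_sphere_continuous[OF this assms(2)]
  have "AE x in sphere_measure. g x * g x * sphere_weight \<mu> x = 0"
    using assms(3) unfolding sphere_inner_def
    by (subst (asm) integral_nonneg_eq_0_iff_AE) (auto simp: sphere_weight_nonneg)
  with AE_sphere_nth3 show "AE x in sphere_measure. g x = 0"
    by eventually_elim (auto simp: sphere_weight_def split: if_splits)
qed

section \<open>Rotations, reflection, and the form of the weight in each coordinate system\<close>

definition rot3 :: "real \<Rightarrow> real^3 \<Rightarrow> real^3" where
  "rot3 \<theta> y = vector [y $ 1 * cos \<theta> - y $ 2 * sin \<theta>, y $ 1 * sin \<theta> + y $ 2 * cos \<theta>, y $ 3]"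

text \<open>Moves the polar axis of \<open>sph_point\<close> to the third coordinate, so that the
  height becomes x_3 and the longitude becomes the polar angle of (x_1, x_2).\<close>

definition cycle3 :: "real^3 \<Rightarrow> real^3" where
  "cycle3 y = vector [y $ 2, y $ 3, y $ 1]"

definition reflect3 :: "real^3 \<Rightarrow> real^3" where
  "reflect3 y = vector [y $ 1, y $ 2, - (y $ 3)]"

lemma rot3_nth [simp]: "rot3 \<theta> y $ 1 = y $ 1 * cos \<theta> - y $ 2 * sin \<theta>"
  "rot3 \<theta> y $ 2 = y $ 1 * sin \<theta> + y $ 2 * cos \<theta>" "rot3 \<theta> y $ 3 = y $ 3"
  by (simp_all add: rot3_def)

abbreviation "circ \<theta> t \<alpha> \<equiv> rot3 \<theta> (sph_point t \<alpha>)"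

lemma cycle3_nth [simp]: "cycle3 y $ 1 = y $ 2" "cycle3 y $ 2 = y $ 3" "cycle3 y $ 3 = y $ 1"
  by (simp_all add: cycle3_def)

lemma reflect3_nth [simp]: "reflect3 y $ 1 = y $ 1" "reflect3 y $ 2 = y $ 2" "reflect3 y $ 3 = - (y $ 3)"
  by (simp_all add: reflect3_def)

lemma orthogonal_rot3: "orthogonal_transformation (rot3 \<theta>)"
  unfolding orthogonal_transformation
proof
  show "linear (rot3 \<theta>)" by (rule linearI) (auto simp: vec3_eq_iff algebra_simps)
  have "(norm (rot3 \<theta> v))\<^sup>2 = ((v $ 1)\<^sup>2 + (v $ 2)\<^sup>2) * ((sin \<theta>)\<^sup>2 + (cos \<theta>)\<^sup>2) + (v $ 3)\<^sup>2" for v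
    unfolding norm_vec3_sq rot3_nth by algebra
  then have "(norm (rot3 \<theta> v))\<^sup>2 = (norm v)\<^sup>2" for v by (simp add: norm_vec3_sq)
  then show "\<forall>v. norm (rot3 \<theta> v) = norm v" by (metis norm_ge_zero power2_eq_iff_nonneg)
qed

lemma orthogonal_cycle3: "orthogonal_transformation cycle3"
  unfolding orthogonal_transformation
proof
  show "linear cycle3" by (rule linearI) (auto simp: vec3_eq_iff algebra_simps)
  have "(norm (cycle3 v))\<^sup>2 = (norm v)\<^sup>2" for v by (simp add: norm_vec3_sq)
  then show "\<forall>v. norm (cycle3 v) = norm v" by (metis norm_ge_zero power2_eq_iff_nonneg)
qed

lemma orthogonal_reflect3: "orthogonal_transformation reflect3"
  unfolding orthogonal_transformation
proof
  show "linear reflect3" by (rule linearI) (auto simp: vec3_eq_iff algebra_simps)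
  have "(norm (reflect3 v))\<^sup>2 = (norm v)\<^sup>2" for v by (simp add: norm_vec3_sq)
  then show "\<forall>v. norm (reflect3 v) = norm v" by (metis norm_ge_zero power2_eq_iff_nonneg)
qed

lemma circle_point_eq_rot3:
  "circle_point (vector [cos \<theta>, sin \<theta>, 0]) t \<alpha> = circ \<theta> t \<alpha>"
  by (simp add: circle_point_def vec3_eq_iff)

text \<open>The angular factor of the weight on a circle of the transform. The case distinction
  mirrors \<open>sphere_weight\<close>.\<close>

definition sin_weight :: "real \<Rightarrow> real \<Rightarrow> real" where
  "sin_weight \<mu> \<alpha> = (if \<mu> = 0 then 1 else \<bar>sin \<alpha>\<bar> powr (2 * \<mu>))"

definition abs_weight :: "real \<Rightarrow> real \<Rightarrow> real" where
  "abs_weight \<mu> s = (if \<mu> = 0 then 1 else \<bar>s\<bar> powr (2 * \<mu>))"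

text \<open>The inequality has to be strict: at |t| = 1 and \<mu> = 0 the right-hand side is 0,
  because \<open>0 powr 0 = 0\<close>, while the weight is 1.\<close>

lemma sphere_weight_rot3:
  assumes "\<bar>t\<bar> < 1"
  shows "sphere_weight \<mu> (circ \<theta> t \<alpha>) = (1 - t\<^sup>2) powr \<mu> * sin_weight \<mu> \<alpha>"
proof -
  have p: "1 - t\<^sup>2 > 0" using assms by (simp add: abs_square_less_1)
  have "sqrt (1 - t\<^sup>2) powr (2 * \<mu>) = (1 - t\<^sup>2) powr \<mu>"
    using p by (simp add: powr_half_sqrt[symmetric] powr_powr)
  then show ?thesis using p by (auto simp: sphere_weight_def sin_weight_def abs_mult powr_mult)
qed

lemma sphere_weight_cycle3: "sphere_weight \<mu> (cycle3 (sph_point s \<phi>)) = abs_weight \<mu> s"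
  by (simp add: sphere_weight_def abs_weight_def)

lemma sphere_weight_reflect3: "sphere_weight \<mu> (reflect3 x) = sphere_weight \<mu> x"
  by (simp add: sphere_weight_def)

section \<open>Homogeneous polynomials\<close>

abbreviation monomial_sum :: "(nat \<times> nat \<times> nat) set \<Rightarrow> (nat \<Rightarrow> nat \<Rightarrow> nat \<Rightarrow> real) \<Rightarrow> real^3 \<Rightarrow> real" where
  "monomial_sum I c x \<equiv> \<Sum>(i, j, l)\<in>I. c i j l * x $ 1 ^ i * x $ 2 ^ j * x $ 3 ^ l"

lemma finite_triples_eq: "finite {(i, j, l). i + j + l = (k::nat)}"
  by (rule finite_subset[of _ "{..k} \<times> {..k} \<times> {..k}"]) auto

lemma finite_triples_less: "finite {(i, j, l). i + j + l < (k::nat)}"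
  by (rule finite_subset[of _ "{..k} \<times> {..k} \<times> {..k}"]) auto

lemma monomial_as_sum:
  assumes "finite I" "(i, j, l) \<in> I"
  shows "c * x $ 1 ^ i * x $ 2 ^ j * x $ 3 ^ l =
    (\<Sum>(i', j', l')\<in>I. (if i' = i \<and> j' = j \<and> l' = l then c else 0) * x $ 1 ^ i' * x $ 2 ^ j' * (x::real^3) $ 3 ^ l')"
proof -
  have "(\<Sum>(i', j', l')\<in>I. (if i' = i \<and> j' = j \<and> l' = l then c else 0) * x $ 1 ^ i' * x $ 2 ^ j' * x $ 3 ^ l')
     = (\<Sum>s\<in>I. if s = (i, j, l) then c * x $ 1 ^ i * x $ 2 ^ j * x $ 3 ^ l else 0)"
    by (intro sum.cong refl) (simp add: split_beta prod_eq_iff)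
  then show ?thesis using assms by simp
qed

lemma homogeneous_monomial:
  "i + j + l = k \<Longrightarrow> homogeneous_poly k (\<lambda>x. c * x $ 1 ^ i * x $ 2 ^ j * x $ 3 ^ l)"
  unfolding homogeneous_poly_def
  by (intro exI allI, rule monomial_as_sum[OF finite_triples_eq]) simp

lemma homogeneous_add:
  "homogeneous_poly k P \<Longrightarrow> homogeneous_poly k Q \<Longrightarrow> homogeneous_poly k (\<lambda>x. P x + Q x)"
  unfolding homogeneous_poly_def
proof (elim exE)
  fix c d
  assume c: "\<forall>x. P x = monomial_sum {(i, j, l). i + j + l = k} c x"
    and d: "\<forall>x. Q x = monomial_sum {(i, j, l). i + j + l = k} d x"
  show "\<exists>c. \<forall>x. P x + Q x = monomial_sum {(i, j, l). i + j + l = k} c x"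
    by (intro exI[of _ "\<lambda>i j l. c i j l + d i j l"] allI)
       (simp add: c d sum.distrib[symmetric] split_beta ring_distribs)
qed

lemma homogeneous_scale: "homogeneous_poly k P \<Longrightarrow> homogeneous_poly k (\<lambda>x. a * P x)"
  unfolding homogeneous_poly_def
proof (elim exE)
  fix c
  assume c: "\<forall>x. P x = monomial_sum {(i, j, l). i + j + l = k} c x"
  show "\<exists>c. \<forall>x. a * P x = monomial_sum {(i, j, l). i + j + l = k} c x"
    by (intro exI[of _ "\<lambda>i j l. a * c i j l"] allI)
       (simp add: c sum_distrib_left split_beta mult.assoc)
qed

lemma homogeneous_zero: "homogeneous_poly k (\<lambda>x. 0)"
  unfolding homogeneous_poly_def by (intro exI[of _ "\<lambda>i j l. 0"]) simp

lemma homogeneous_sum: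
  "(\<And>s. s \<in> A \<Longrightarrow> homogeneous_poly k (P s)) \<Longrightarrow> homogeneous_poly k (\<lambda>x. \<Sum>s\<in>A. P s x)"
  by (induction A rule: infinite_finite_induct) (auto intro: homogeneous_zero homogeneous_add)

lemma homogeneous_expand:
  assumes "homogeneous_poly k P"
  obtains c where "\<And>x. P x = monomial_sum {(i, j, l). i + j + l = k} c x"
  using assms unfolding homogeneous_poly_def by blast

lemma homogeneous_mult:
  assumes "homogeneous_poly a P" "homogeneous_poly b Q"
  shows "homogeneous_poly (a + b) (\<lambda>x. P x * Q x)"
proof -
  obtain c where c: "\<And>x. P x = monomial_sum {(i, j, l). i + j + l = a} c x"
    using homogeneous_expand[OF assms(1)] by blast
  obtain d where d: "\<And>x. Q x = monomial_sum {(i, j, l). i + j + l = b} d x"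
    using homogeneous_expand[OF assms(2)] by blast
  have "homogeneous_poly (a + b) (\<lambda>x. \<Sum>s\<in>{(i, j, l). i + j + l = a}. \<Sum>t\<in>{(i, j, l). i + j + l = b}.
     (case s of (i, j, l) \<Rightarrow> c i j l * x $ 1 ^ i * x $ 2 ^ j * x $ 3 ^ l) * (case t of (i, j, l) \<Rightarrow> d i j l * x $ 1 ^ i * x $ 2 ^ j * x $ 3 ^ l))"
  proof (intro homogeneous_sum)
    fix s t assume "s \<in> {(i, j, l). i + j + l = a}" "t \<in> {(i, j, l). i + j + l = b}"
    then obtain i j l i' j' l' where s: "s = (i, j, l)" "t = (i', j', l')" "i + j + l = a" "i' + j' + l' = b" by auto
    then have "homogeneous_poly (a + b) (\<lambda>x. (c i j l * d i' j' l') * x $ 1 ^ (i + i') * x $ 2 ^ (j + j') * x $ 3 ^ (l + l'))"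
      by (intro homogeneous_monomial) auto
    then show "homogeneous_poly (a + b) (\<lambda>x. (case s of (i, j, l) \<Rightarrow> c i j l * x $ 1 ^ i * x $ 2 ^ j * x $ 3 ^ l) *
          (case t of (i, j, l) \<Rightarrow> d i j l * x $ 1 ^ i * x $ 2 ^ j * x $ 3 ^ l))"
      by (simp add: s power_add mult_ac)
  qed
  then show ?thesis by (simp add: c d sum_product)
qed

lemma homogeneous_const: "homogeneous_poly 0 (\<lambda>x. c)"
  using homogeneous_monomial[of 0 0 0 0 c] by simp

lemma homogeneous_nth: "homogeneous_poly (Suc 0) (\<lambda>x. x $ i)"
proof -
  have "i = 1 \<or> i = 2 \<or> i = 3" using exhaust_3 by blast
  then show ?thesis
    using homogeneous_monomial[of 1 0 0 "Suc 0" 1] homogeneous_monomial[of 0 1 0 "Suc 0" 1]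
      homogeneous_monomial[of 0 0 1 "Suc 0" 1] by auto
qed

lemma homogeneous_power:
  "homogeneous_poly k P \<Longrightarrow> homogeneous_poly (k * n) (\<lambda>x. P x ^ n)"
proof (induction n)
  case 0
  then show ?case using homogeneous_const by simp
next
  case (Suc n)
  then show ?case using homogeneous_mult[of k P "k * n" "\<lambda>x. P x ^ n"] by simp
qed

lemma homogeneous_continuous:
  assumes "homogeneous_poly k P" shows "continuous_on A P"
proof -
  obtain c where c: "\<And>x. P x = monomial_sum {(i, j, l). i + j + l = k} c x"
    using homogeneous_expand[OF assms] by blast
  show ?thesis unfolding c[abs_def] by (auto intro!: continuous_intros)
qed

lemma homogeneous_scaleR:
  assumes "homogeneous_poly k P" shows "P (a *\<^sub>R x) = a ^ k * P x"
proof -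
  obtain c where c: "\<And>x. P x = monomial_sum {(i, j, l). i + j + l = k} c x"
    using homogeneous_expand[OF assms] by blast
  show ?thesis unfolding c sum_distrib_left
    by (intro sum.cong refl) (auto simp: power_add power_mult_distrib)
qed

lemma homogeneous_compose:
  assumes "homogeneous_poly k P" and "\<And>i. homogeneous_poly (Suc 0) (\<lambda>x. T x $ i)"
  shows "homogeneous_poly k (\<lambda>x. P (T x))"
proof -
  obtain c where c: "\<And>x. P x = monomial_sum {(i, j, l). i + j + l = k} c x"
    using homogeneous_expand[OF assms(1)] by blast
  show ?thesis unfolding c
  proof (intro homogeneous_sum)
    fix s assume "s \<in> {(i, j, l). i + j + l = k}"
    then obtain i j l where s: "s = (i, j, l)" "k = (0 + Suc 0 * i + Suc 0 * j) + Suc 0 * l" by auto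
    show "homogeneous_poly k (\<lambda>x. case s of (i, j, l) \<Rightarrow> c i j l * T x $ 1 ^ i * T x $ 2 ^ j * T x $ 3 ^ l)"
      unfolding s prod.case
      by (intro homogeneous_mult homogeneous_const homogeneous_power assms(2))
  qed
qed

lemma homogeneous_zero_sphere:
  assumes P: "homogeneous_poly k P" and z: "\<And>x. x \<in> sphere 0 1 \<Longrightarrow> P x = 0"
  shows "P x = 0"
proof -
  have "\<exists>y \<in> sphere 0 1. x = norm x *\<^sub>R y"
  proof (cases "x = 0")
    case True
    then show ?thesis by (intro bexI[of _ "axis 1 1"]) auto
  next
    case False
    then show ?thesis by (intro bexI[of _ "sgn x"]) (auto simp: norm_sgn sgn_div_norm)
  qed
  then show ?thesis using homogeneous_scaleR[OF P] z by (metis mult_zero_right)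
qed

lemma poly_degree_less_zero: "poly_degree_less k (\<lambda>x. 0)"
  unfolding poly_degree_less_def by (intro exI[of _ "\<lambda>i j l. 0"]) simp

lemma poly_degree_less_add:
  "poly_degree_less k P \<Longrightarrow> poly_degree_less k Q \<Longrightarrow> poly_degree_less k (\<lambda>x. P x + Q x)"
  unfolding poly_degree_less_def
proof (elim exE)
  fix c d
  assume c: "\<forall>x. P x = monomial_sum {(i, j, l). i + j + l < k} c x"
    and d: "\<forall>x. Q x = monomial_sum {(i, j, l). i + j + l < k} d x"
  show "\<exists>c. \<forall>x. P x + Q x = monomial_sum {(i, j, l). i + j + l < k} c x"
    by (intro exI[of _ "\<lambda>i j l. c i j l + d i j l"] allI)
       (simp add: c d sum.distrib[symmetric] split_beta ring_distribs)
qed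

lemma poly_degree_less_monomial:
  "i + j + l < k \<Longrightarrow> poly_degree_less k (\<lambda>x. c * x $ 1 ^ i * x $ 2 ^ j * x $ 3 ^ l)"
  unfolding poly_degree_less_def
  by (intro exI allI, rule monomial_as_sum[OF finite_triples_less]) simp

lemma poly_degree_less_sum:
  "(\<And>s. s \<in> A \<Longrightarrow> poly_degree_less k (P s)) \<Longrightarrow> poly_degree_less k (\<lambda>x. \<Sum>s\<in>A. P s x)"
  by (induction A rule: infinite_finite_induct) (auto intro: poly_degree_less_zero poly_degree_less_add)

lemma poly_degree_less_continuous:
  assumes "poly_degree_less k P" shows "continuous_on A P"
proof -
  obtain c where c: "\<forall>x. P x = monomial_sum {(i, j, l). i + j + l < k} c x"
    using assms unfolding poly_degree_less_def by blast
  then have P: "P = (monomial_sum {(i, j, l). i + j + l < k} c)" by (intro ext) simp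
  show ?thesis unfolding P by (auto intro!: continuous_intros)
qed

text \<open>Averaging \<open>h\<close> with its reflection removes the odd powers of x_3. What is
  left is free of x_3 or divisible by x_3^2. The degree bound on \<open>q\<close> is what allows it
  to be used as a test polynomial against \<open>h\<close>.\<close>

lemma homogeneous_even_decomp:
  assumes h: "homogeneous_poly k h" and even: "\<And>x. h (reflect3 x) = h x"
  obtains q where "poly_degree_less k q" "\<And>x. h x = h (vector [x $ 1, x $ 2, 0]) + (x $ 3)\<^sup>2 * q x"
proof -
  let ?I = "{(i, j, l). i + j + l = k}"
  obtain c where c: "\<And>x. h x = monomial_sum ?I c x"
    using homogeneous_expand[OF h] by blast
  \<comment> \<open>The truncated difference \<open>l - 2\<close> is harmless, since the coefficient
    is 0 for l < 2.\<close>
  define q where "q x = (\<Sum>s\<in>?I. case s of (i, j, l) \<Rightarrow> (if even l \<and> 2 \<le> l then c i j l else 0) * x $ 1 ^ i * x $ 2 ^ j * x $ 3 ^ (l - 2))" for x :: "real^3"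
  have "poly_degree_less k q"
    unfolding q_def
  proof (rule poly_degree_less_sum)
    fix s assume "s \<in> ?I"
    then obtain i j l where s: "s = (i, j, l)" "i + j + l = k" by auto
    show "poly_degree_less k (\<lambda>x. case s of (i, j, l) \<Rightarrow> (if even l \<and> 2 \<le> l then c i j l else 0) * x $ 1 ^ i * x $ 2 ^ j * x $ 3 ^ (l - 2))"
    proof (cases "even l \<and> 2 \<le> l")
      case True
      then show ?thesis using s poly_degree_less_monomial[of i j "l - 2" k "c i j l"] by auto
    next
      case False
      then show ?thesis unfolding s by (simp only: if_False prod.case mult_zero_left poly_degree_less_zero)
    qed
  qed
  moreover have "h x = h (vector [x $ 1, x $ 2, 0]) + (x $ 3)\<^sup>2 * q x" for x
  proof -
    have "h x = (h x + h (reflect3 x)) / 2" using even by simp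
    also have "\<dots> = (\<Sum>(i, j, l)\<in>?I. c i j l * x $ 1 ^ i * x $ 2 ^ j * ((x $ 3 ^ l + (- (x $ 3)) ^ l) / 2))"
      unfolding c sum.distrib[symmetric] sum_divide_distrib
      by (intro sum.cong refl) (auto simp: field_simps)
    \<comment> \<open>\<open>0 ^ l\<close> is 1 for l = 0 and 0 otherwise, so the first summand
      collects the part free of x_3.\<close>
    also have "\<dots> = (\<Sum>(i, j, l)\<in>?I. c i j l * x $ 1 ^ i * x $ 2 ^ j * 0 ^ l +
        (x $ 3)\<^sup>2 * ((if even l \<and> 2 \<le> l then c i j l else 0) * x $ 1 ^ i * x $ 2 ^ j * x $ 3 ^ (l - 2)))"
    proof (intro sum.cong refl, clarsimp simp only: split_paired_all prod.case)
      fix i j l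
      show "c i j l * x $ 1 ^ i * x $ 2 ^ j * ((x $ 3 ^ l + (- (x $ 3)) ^ l) / 2) = c i j l * x $ 1 ^ i * x $ 2 ^ j * 0 ^ l +
        (x $ 3)\<^sup>2 * ((if even l \<and> 2 \<le> l then c i j l else 0) * x $ 1 ^ i * x $ 2 ^ j * x $ 3 ^ (l - 2))"
      proof (cases "even l \<and> 2 \<le> l")
        case True
        then obtain n where n: "l = n + 2" "even n" by (metis add.commute dvd_diff_nat le_add_diff_inverse even_numeral)
        then have "(x $ 3)\<^sup>2 * x $ 3 ^ n = x $ 3 ^ l" by (simp add: power_add power2_eq_square)
        then show ?thesis using True n by (simp add: power2_eq_square)
      next
        case False
        then have "odd l \<or> l = 0" by presburger
        then show ?thesis by auto
      qed
    qed
    also have "\<dots> = h (vector [x $ 1, x $ 2, 0]) + (x $ 3)\<^sup>2 * q x"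
      unfolding c q_def by (simp add: split_beta sum.distrib sum_distrib_left)
    finally show ?thesis .
  qed
  ultimately show ?thesis by (rule that)
qed

section \<open>Linearity of the inner product and the spaces of weighted harmonics\<close>

lemma sphere_inner_commute: "sphere_inner \<mu> f g = sphere_inner \<mu> g f"
  by (simp add: sphere_inner_def mult.commute)

lemma sphere_inner_sum_left:
  assumes "\<And>s. s \<in> A \<Longrightarrow> integrable sphere_measure (\<lambda>x. P s x * g x * sphere_weight \<mu> x)"
  shows "sphere_inner \<mu> (\<lambda>x. \<Sum>s\<in>A. c s * P s x) g = (\<Sum>s\<in>A. c s * sphere_inner \<mu> (P s) g)"
proof -
  have "sphere_inner \<mu> (\<lambda>x. \<Sum>s\<in>A. c s * P s x) g = (LINT x|sphere_measure. (\<Sum>s\<in>A. c s * (P s x * g x * sphere_weight \<mu> x)))"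
    unfolding sphere_inner_def sum_distrib_right by (simp only: mult.assoc)
  also have "\<dots> = (\<Sum>s\<in>A. c s * sphere_inner \<mu> (P s) g)"
    unfolding sphere_inner_def using assms by (subst Bochner_Integration.integral_sum) auto
  finally show ?thesis .
qed

lemma integrable_sphere_continuous2:
  "continuous_on UNIV f \<Longrightarrow> continuous_on UNIV g \<Longrightarrow> \<mu> \<ge> 0 \<Longrightarrow> integrable sphere_measure (\<lambda>x. f x * g x * sphere_weight \<mu> x)"
  by (intro integrable_sphere_continuous continuous_intros)

lemma sphere_inner_diff_left:
  assumes "integrable sphere_measure (\<lambda>x. f x * h x * sphere_weight \<mu> x)"
    "integrable sphere_measure (\<lambda>x. g x * h x * sphere_weight \<mu> x)"
  shows "sphere_inner \<mu> (\<lambda>x. f x - g x) h = sphere_inner \<mu> f h - sphere_inner \<mu> g h"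
  unfolding sphere_inner_def using Bochner_Integration.integral_diff[OF assms]
  by (simp add: left_diff_distrib)

lemma harmonic_spaceI:
  assumes mu: "\<mu> \<ge> 0" and P: "homogeneous_poly k P"
    and orth: "\<And>i j l. i + j + l < k \<Longrightarrow> sphere_inner \<mu> P (\<lambda>x. x $ 1 ^ i * x $ 2 ^ j * x $ 3 ^ l) = 0"
  shows "P \<in> harmonic_space \<mu> k"
proof -
  have "sphere_inner \<mu> P Q = 0" if Q: "poly_degree_less k Q" for Q
  proof -
    obtain c where c: "\<forall>x. Q x = monomial_sum {(i, j, l). i + j + l < k} c x"
      using Q unfolding poly_degree_less_def by blast
    have "Q = (\<lambda>x. \<Sum>s\<in>{(i, j, l). i + j + l < k}. c (fst s) (fst (snd s)) (snd (snd s)) * (x $ 1 ^ fst s * x $ 2 ^ fst (snd s) * x $ 3 ^ snd (snd s)))"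
      by (rule ext) (simp add: c split_beta mult.assoc)
    then have "sphere_inner \<mu> P Q = (\<Sum>s\<in>{(i, j, l). i + j + l < k}. c (fst s) (fst (snd s)) (snd (snd s)) *
        sphere_inner \<mu> (\<lambda>x. x $ 1 ^ fst s * x $ 2 ^ fst (snd s) * x $ 3 ^ snd (snd s)) P)"
      using homogeneous_continuous[OF P] mu
      by (subst sphere_inner_commute) (auto intro!: sphere_inner_sum_left integrable_sphere_continuous2 continuous_intros)
    also have "\<dots> = 0" by (intro sum.neutral) (auto simp: sphere_inner_commute[of \<mu> _ P] orth)
    finally show ?thesis .
  qed
  then show ?thesis using P by (simp add: harmonic_space_def)
qed

lemma harmonic_space_homogeneous: "P \<in> harmonic_space \<mu> k \<Longrightarrow> homogeneous_poly k P"
  by (simp add: harmonic_space_def)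

lemma harmonic_space_continuous: "P \<in> harmonic_space \<mu> k \<Longrightarrow> continuous_on A P"
  using harmonic_space_homogeneous homogeneous_continuous by blast

lemma harmonic_space_sum:
  assumes mu: "\<mu> \<ge> 0" and "\<And>s. s \<in> A \<Longrightarrow> P s \<in> harmonic_space \<mu> k"
  shows "(\<lambda>x. \<Sum>s\<in>A. c s * P s x) \<in> harmonic_space \<mu> k"
proof -
  have cont: "continuous_on UNIV (P s)" if "s \<in> A" for s
    by (rule harmonic_space_continuous[OF assms(2)[OF that]])
  have "sphere_inner \<mu> (\<lambda>x. \<Sum>s\<in>A. c s * P s x) Q = 0" if Q: "poly_degree_less k Q" for Q
    using Q assms by (subst sphere_inner_sum_left)
      (auto intro!: integrable_sphere_continuous2 cont poly_degree_less_continuous[OF Q] simp: harmonic_space_def)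
  then show ?thesis using assms by (auto simp: harmonic_space_def intro!: homogeneous_sum homogeneous_scale)
qed

lemma harmonic_space_lincomb2:
  assumes "\<mu> \<ge> 0" "P \<in> harmonic_space \<mu> k" "Q \<in> harmonic_space \<mu> k"
  shows "(\<lambda>x. a * P x + b * Q x) \<in> harmonic_space \<mu> k"
  using harmonic_space_sum[OF assms(1), of "{True, False}" "\<lambda>s. if s then P else Q" k "\<lambda>s. if s then a else b"] assms
  by simp

lemma harmonic_space_self_zero:
  assumes "\<mu> \<ge> 0" "P \<in> harmonic_space \<mu> k" "sphere_inner \<mu> P P = 0"
  shows "P x = 0"
  by (rule homogeneous_zero_sphere[OF harmonic_space_homogeneous[OF assms(2)]])
     (rule sphere_inner_self_zero[OF harmonic_space_continuous[OF assms(2)] assms(1,3)])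

lemma harmonic_space_zero_equator:
  assumes mu: "\<mu> \<ge> 0" and h: "h \<in> harmonic_space \<mu> k" and even: "\<And>x. h (reflect3 x) = h x"
    and eq: "\<And>\<phi>. h (vector [cos \<phi>, sin \<phi>, 0]) = 0"
  shows "h x = 0"
proof -
  note hp = harmonic_space_homogeneous[OF h]
  \<comment> \<open>Homogeneity spreads the zeros from the unit circle over the whole plane x_3 = 0,
    where the decomposition below evaluates \<open>h\<close>.\<close>
  have plane: "h (vector [a, b, 0]) = 0" for a b
  proof -
    define z where "z = Complex a b"
    have "vector [a, b, 0] = cmod z *\<^sub>R (vector [cos (Arg z), sin (Arg z), 0] :: real^3)"
    proof (cases "z = 0")
      case True
      then show ?thesis by (auto simp: vec3_eq_iff z_def complex_eq_iff)
    next
      case False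
      have "z = cmod z * cis (Arg z)" using rcis_cmod_Arg[of z] by (simp add: rcis_def)
      then have "a = cmod z * cos (Arg z)" "b = cmod z * sin (Arg z)"
        by (simp_all add: z_def complex_eq_iff)
      then show ?thesis by (simp add: vec3_eq_iff)
    qed
    then show ?thesis using homogeneous_scaleR[OF hp] eq by simp
  qed
  obtain q where q: "poly_degree_less k q" "\<And>x. h x = h (vector [x $ 1, x $ 2, 0]) + (x $ 3)\<^sup>2 * q x"
    using homogeneous_even_decomp[OF hp even] by blast
  have hq: "h x = (x $ 3)\<^sup>2 * q x" for x using q(2) plane by simp
  have "sphere_inner \<mu> h q = 0" using h q(1) by (simp add: harmonic_space_def)
  then have z: "sphere_inner \<mu> (\<lambda>x. x $ 3 * q x) (\<lambda>x. x $ 3 * q x) = 0"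
    unfolding sphere_inner_def hq by (simp add: power2_eq_square mult_ac)
  have "continuous_on UNIV (\<lambda>x. x $ 3 * q x)"
    by (intro continuous_intros poly_degree_less_continuous[OF q(1)])
  from sphere_inner_self_zero[OF this mu z] have "x $ 3 * q x = 0" if "x \<in> sphere 0 1" for x using that by blast
  then have "h x = 0" if "x \<in> sphere 0 1" for x using that by (auto simp: hq power2_eq_square)
  then show ?thesis by (rule homogeneous_zero_sphere[OF hp])
qed

lemma sphere_inner_reflect:
  assumes "integrable sphere_measure (\<lambda>x. f x * g x * sphere_weight \<mu> x)"
  shows "sphere_inner \<mu> (\<lambda>x. f (reflect3 x)) (\<lambda>x. g (reflect3 x)) = sphere_inner \<mu> f g"
  unfolding sphere_inner_def
  using integrable_sphere_orthogonal(2)[OF orthogonal_reflect3 assms] by (simp add: sphere_weight_reflect3)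

lemma homogeneous_reflect:
  assumes "homogeneous_poly k P" shows "homogeneous_poly k (\<lambda>x. P (reflect3 x))"
proof (rule homogeneous_compose[OF assms])
  fix i :: 3
  have "i = 1 \<or> i = 2 \<or> i = 3" using exhaust_3 by blast
  then show "homogeneous_poly (Suc 0) (\<lambda>x. reflect3 x $ i)"
    using homogeneous_nth[of 1] homogeneous_nth[of 2] homogeneous_scale[OF homogeneous_nth[of 3], of "-1"]
    by auto
qed

lemma harmonic_space_reflect:
  assumes mu: "\<mu> \<ge> 0" and h: "h \<in> harmonic_space \<mu> k"
  shows "(\<lambda>x. h (reflect3 x)) \<in> harmonic_space \<mu> k"
proof (rule harmonic_spaceI[OF mu homogeneous_reflect[OF harmonic_space_homogeneous[OF h]]])
  fix i j l :: nat assume ijl: "i + j + l < k"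
  \<comment> \<open>The sign is chosen so that composing with the reflection returns the given
    monomial.\<close>
  let ?M = "\<lambda>x::real^3. (-1) ^ l * x $ 1 ^ i * x $ 2 ^ j * x $ 3 ^ l"
  have M: "poly_degree_less k ?M" by (rule poly_degree_less_monomial[OF ijl])
  have "?M (reflect3 x) = x $ 1 ^ i * x $ 2 ^ j * x $ 3 ^ l" for x
  proof -
    have "?M (reflect3 x) = x $ 1 ^ i * x $ 2 ^ j * ((-1) ^ l * (- (x $ 3)) ^ l)" by (simp add: mult_ac)
    also have "(-1) ^ l * (- (x $ 3)) ^ l = x $ 3 ^ l" by (simp flip: power_mult_distrib)
    finally show ?thesis .
  qed
  then have "sphere_inner \<mu> (\<lambda>x. h (reflect3 x)) (\<lambda>x. x $ 1 ^ i * x $ 2 ^ j * x $ 3 ^ l) = sphere_inner \<mu> (\<lambda>x. h (reflect3 x)) (\<lambda>x. ?M (reflect3 x))"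
    by (simp only:)
  also have "\<dots> = sphere_inner \<mu> h ?M"
    using mu by (intro sphere_inner_reflect integrable_sphere_continuous2 harmonic_space_continuous[OF h] poly_degree_less_continuous[OF M])
  also have "\<dots> = 0" using h M by (simp add: harmonic_space_def)
  finally show "sphere_inner \<mu> (\<lambda>x. h (reflect3 x)) (\<lambda>x. x $ 1 ^ i * x $ 2 ^ j * x $ 3 ^ l) = 0" .
qed

section \<open>Jacobi and Gegenbauer polynomials\<close>

definition beta_int :: "real \<Rightarrow> real \<Rightarrow> real poly \<Rightarrow> real" where
  "beta_int \<alpha> \<beta> p = (LBINT u:{0..1}. poly p u * (u powr \<alpha> * (1 - u) powr \<beta>))"

lemma set_integrable_poly_weight:
  assumes "set_integrable lborel {a..b} (w :: real \<Rightarrow> real)"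
  shows "set_integrable lborel {a..b} (\<lambda>u. poly p u * w u)"
proof -
  have "compact (poly p ` {a..b})" by (intro compact_continuous_image continuous_intros) auto
  then obtain B where B: "\<And>u. u \<in> {a..b} \<Longrightarrow> \<bar>poly p u\<bar> \<le> B"
    using compact_imp_bounded by (fastforce simp: bounded_iff)
  show ?thesis
  proof (rule set_integrable_bound)
    show "set_integrable lborel {a..b} (\<lambda>u. B * w u)" using assms by simp
    have "poly p \<in> borel_measurable borel"
      by (intro borel_measurable_continuous_onI continuous_intros)
    then show "set_borel_measurable lborel {a..b} (\<lambda>u. poly p u * w u)"
      using borel_measurable_integrable[OF assms[unfolded set_integrable_def]]
      unfolding set_borel_measurable_def by (simp add: mult.left_commute)
    show "AE u in lborel. u \<in> {a..b} \<longrightarrow> norm (poly p u * w u) \<le> norm (B * w u)"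
    proof (intro AE_I2 impI)
      fix u assume "u \<in> {a..b}"
      then have "\<bar>poly p u\<bar> \<le> \<bar>B\<bar>" using B[of u] by linarith
      then show "norm (poly p u * w u) \<le> norm (B * w u)" by (simp add: abs_mult mult_right_mono)
    qed
  qed
qed

text \<open>The Beta integral is available as a gauge integral; since the integrand is nonnegative,
  it is also absolutely integrable, which gives the Lebesgue integral.\<close>

lemma beta_set_integrable:
  assumes "\<alpha> > -1" "\<beta> > -1"
  shows "set_integrable lborel {0..1} (\<lambda>u::real. u powr \<alpha> * (1 - u) powr \<beta>)"
    "(LBINT u:{0..1}. u powr \<alpha> * (1 - u) powr \<beta>) = Beta (\<alpha> + 1) (\<beta> + 1)"
proof -
  have h: "((\<lambda>u. u powr \<alpha> * (1 - u) powr \<beta>) has_integral Beta (\<alpha> + 1) (\<beta> + 1)) {0..1}"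
    using has_integral_Beta_real[of "\<alpha> + 1" "\<beta> + 1"] assms by simp
  have a: "(\<lambda>u. u powr \<alpha> * (1 - u) powr \<beta>) absolutely_integrable_on {0..1}"
    by (rule nonnegative_absolutely_integrable_1) (use h in \<open>auto simp: integrable_on_def\<close>)
  then show i: "set_integrable lborel {0..1} (\<lambda>u::real. u powr \<alpha> * (1 - u) powr \<beta>)"
    unfolding set_integrable_def by (subst (asm) integrable_completion) auto
  show "(LBINT u:{0..1}. u powr \<alpha> * (1 - u) powr \<beta>) = Beta (\<alpha> + 1) (\<beta> + 1)"
    using set_borel_integral_eq_integral(2)[OF i] h by (simp add: integral_unique)
qed

context
  fixes \<alpha> \<beta> :: real
  assumes a: "\<alpha> > -1" and b: "\<beta> > -1"
begin

lemma beta_poly_integrable: "set_integrable lborel {0..1} (\<lambda>u. poly p u * (u powr \<alpha> * (1 - u) powr \<beta>))"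
  by (rule set_integrable_poly_weight[OF beta_set_integrable(1)[OF a b]])

lemma beta_int_add: "beta_int \<alpha> \<beta> (p + q) = beta_int \<alpha> \<beta> p + beta_int \<alpha> \<beta> q"
  unfolding beta_int_def using set_integral_add(2)[OF beta_poly_integrable beta_poly_integrable]
  by (simp add: ring_distribs)

lemma beta_int_smult: "beta_int \<alpha> \<beta> (smult c p) = c * beta_int \<alpha> \<beta> p"
  unfolding beta_int_def by (simp add: mult.assoc)

lemma beta_int_0: "beta_int \<alpha> \<beta> 0 = 0"
  unfolding beta_int_def by simp

lemma beta_int_sum: "beta_int \<alpha> \<beta> (\<Sum>i\<in>A. p i) = (\<Sum>i\<in>A. beta_int \<alpha> \<beta> (p i))"
  by (induction A rule: infinite_finite_induct) (simp_all add: beta_int_0 beta_int_add)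

lemma beta_int_monom:
  "beta_int \<alpha> \<beta> (monom 1 i * [:1, -1:] ^ s) = Beta (\<alpha> + 1 + real i) (\<beta> + 1 + real s)"
proof -
  have "beta_int \<alpha> \<beta> (monom 1 i * [:1, -1:] ^ s)
      = (LBINT u:{0..1}. u powr (\<alpha> + real i) * (1 - u) powr (\<beta> + real s))"
    unfolding beta_int_def
  proof (rule set_lebesgue_integral_cong, simp, intro allI impI)
    fix u :: real assume u: "u \<in> {0..1}"
    have "u ^ i * u powr \<alpha> = u powr (\<alpha> + real i)"
      using u by (cases "u = 0") (auto simp: powr_add powr_realpow)
    moreover have "(1 - u) ^ s * (1 - u) powr \<beta> = (1 - u) powr (\<beta> + real s)"
      using u by (cases "u = 1") (auto simp: powr_add powr_realpow)
    ultimately show "poly (monom 1 i * [:1, -1:] ^ s) u * (u powr \<alpha> * (1 - u) powr \<beta>)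
       = u powr (\<alpha> + real i) * (1 - u) powr (\<beta> + real s)"
      by (simp add: poly_monom algebra_simps flip: power_mult_distrib)
  qed
  also have "\<dots> = Beta (\<alpha> + 1 + real i) (\<beta> + 1 + real s)"
    using a b by (subst beta_set_integrable(2)) (auto simp: algebra_simps)
  finally show ?thesis .
qed

text \<open>The weight is positive inside the interval, and a nonzero polynomial has only finitely
  many roots there.\<close>

lemma beta_int_pos_definite:
  assumes "beta_int \<alpha> \<beta> (q * q) = 0" shows "q = 0"
proof (rule ccontr)
  assume "q \<noteq> 0"
  have "AE u in lborel. indicator {0..1} u *\<^sub>R (poly (q * q) u * (u powr \<alpha> * (1 - u) powr \<beta>)) = 0"
    using assms beta_poly_integrable[of "q * q"]
    unfolding beta_int_def set_lebesgue_integral_def set_integrable_def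
    by (subst (asm) integral_nonneg_eq_0_iff_AE) (auto simp: indicator_def)
  moreover have "AE u in lborel. poly q u \<noteq> 0"
    by (rule AE_I'[of "{u. poly q u = 0}"])
       (use poly_roots_finite[OF \<open>q \<noteq> 0\<close>] in \<open>auto intro: finite_imp_null_set_lborel\<close>)
  ultimately have "AE u in lborel. u \<notin> {0<..<1::real}"
    by eventually_elim (auto simp: indicator_def)
  then have "emeasure lborel {0<..<1::real} = 0"
    by (subst (asm) AE_iff_measurable[where N = "{0<..<1}"]) auto
  then show False by simp
qed

end

text \<open>
  The Jacobi polynomial in \<open>u = (1 - t) / 2\<close> as a terminating \<open>\<^sub>2F\<^sub>1\<close>; integrating it against
  \<open>(1 - u)\<^sup>s\<close> gives a Chu-Vandermonde sum.
\<close>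

definition jacobi01 :: "nat \<Rightarrow> real \<Rightarrow> real \<Rightarrow> real poly" where
  "jacobi01 n \<alpha> \<beta> = (\<Sum>i\<in>{0..n}. monom (pochhammer (- real n) i * pochhammer (real n + \<alpha> + \<beta> + 1) i /
      (pochhammer (\<alpha> + 1) i * fact i)) i)"

text \<open>The squared norm of \<open>jacobi01\<close> for the weight of total mass 1: the value of
  the Chu-Vandermonde sum at s = n times the leading coefficient, signs cancelled.\<close>

definition jacobi_sqnorm :: "nat \<Rightarrow> real \<Rightarrow> real \<Rightarrow> real" where
  "jacobi_sqnorm n \<alpha> \<beta> = pochhammer (real n + \<alpha> + \<beta> + 1) n * fact n * pochhammer (\<beta> + 1) n /
     (pochhammer (\<alpha> + 1) n * pochhammer (\<alpha> + \<beta> + 2 + real n) n * pochhammer (\<alpha> + \<beta> + 2) n)"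

lemma coeff_jacobi01: "coeff (jacobi01 n \<alpha> \<beta>) i = (if i \<le> n then
    pochhammer (- real n) i * pochhammer (real n + \<alpha> + \<beta> + 1) i / (pochhammer (\<alpha> + 1) i * fact i) else 0)"
  by (simp add: jacobi01_def coeff_sum)

lemma degree_jacobi01_le: "degree (jacobi01 n \<alpha> \<beta>) \<le> n"
  by (rule degree_le) (simp add: coeff_jacobi01)

lemma poly_jacobi01_0: "poly (jacobi01 n \<alpha> \<beta>) 0 = 1"
  by (simp add: poly_0_coeff_0 coeff_jacobi01)

text \<open>Powers of 1 - u are the test functions against which the moments of
  \<open>jacobi01\<close> have a closed form.\<close>

lemma poly_expand_at_1:
  fixes q :: "real poly"
  assumes "degree q \<le> n"
  shows "q = (\<Sum>s\<le>n. smult (coeff (q \<circ>\<^sub>p [:1, -1:]) s) ([:1, -1:] ^ s))"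
proof -
  have "degree (q \<circ>\<^sub>p [:1, -1:]) \<le> n" using assms by (simp add: degree_pcompose)
  then have e: "poly (q \<circ>\<^sub>p [:1, -1:]) y = (\<Sum>s\<le>n. coeff (q \<circ>\<^sub>p [:1, -1:]) s * y ^ s)" for y
    by (subst poly_as_sum_of_monoms'[symmetric, of "q \<circ>\<^sub>p [:1, -1:]" n]) (simp_all add: poly_sum poly_monom)
  have "poly q x = poly (\<Sum>s\<le>n. smult (coeff (q \<circ>\<^sub>p [:1, -1:]) s) ([:1, -1:] ^ s)) x" for x
  proof -
    have "poly q x = poly (q \<circ>\<^sub>p [:1, -1:]) (1 - x)" by (simp add: poly_pcompose)
    then show ?thesis by (simp add: e poly_sum)
  qed
  then show ?thesis by (simp add: poly_eq_poly_eq_iff[symmetric] fun_eq_iff)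
qed

context
  fixes \<alpha> \<beta> :: real
  assumes a: "\<alpha> > -1" and b: "\<beta> > -1"
begin

lemma Beta_shift:
  "Beta (\<alpha> + 1 + real i) (\<beta> + 1 + real s) =
    Beta (\<alpha> + 1) (\<beta> + 1) * (pochhammer (\<beta> + 1) s / pochhammer (\<alpha> + \<beta> + 2) s) *
    (pochhammer (\<alpha> + 1) i / pochhammer (\<alpha> + \<beta> + 2 + real s) i)"
proof -
  have n: "x \<notin> \<int>\<^sub>\<le>\<^sub>0" if "x > 0" for x :: real using that by (auto simp: nonpos_Ints_def)
  have G: "Gamma (x + real i) = Gamma x * pochhammer x i" if "x > 0" for x i
    using pochhammer_Gamma[OF n[OF that], of i] Gamma_real_pos[OF that] by (simp add: field_simps)
  have 1: "\<alpha> + 1 > 0" "\<beta> + 1 > 0" "\<alpha> + \<beta> + 2 > 0" "\<alpha> + \<beta> + 2 + real s > 0" using a b by auto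
  have "Gamma (\<alpha> + 1 + real i + (\<beta> + 1 + real s)) = Gamma (\<alpha> + \<beta> + 2) * pochhammer (\<alpha> + \<beta> + 2) s * pochhammer (\<alpha> + \<beta> + 2 + real s) i"
    using G[OF 1(3), of s] G[OF 1(4), of i] by (simp add: algebra_simps)
  then show ?thesis unfolding Beta_def G[OF 1(1)] G[OF 1(2)] by (simp add: algebra_simps)
qed

text \<open>Integrating term by term, the Beta quotient replaces the lower parameter \<alpha> + 1 of
  the series by c = \<alpha> + \<beta> + 2 + s. With b = n + \<alpha> + \<beta> + 1, Chu-Vandermonde
  produces the Pochhammer symbol of c - b = s + 1 - n.\<close>

lemma beta_int_jacobi01_power:
  "beta_int \<alpha> \<beta> (jacobi01 n \<alpha> \<beta> * [:1, -1:] ^ s) =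
     Beta (\<alpha> + 1) (\<beta> + 1) * (pochhammer (\<beta> + 1) s / pochhammer (\<alpha> + \<beta> + 2) s) *
     (pochhammer (real s + 1 - real n) n / pochhammer (\<alpha> + \<beta> + 2 + real s) n)" (is "_ = ?C * _")
proof -
  let ?c = "\<lambda>i. pochhammer (- real n) i * pochhammer (real n + \<alpha> + \<beta> + 1) i / (pochhammer (\<alpha> + 1) i * fact i)"
  have "jacobi01 n \<alpha> \<beta> * [:1, -1:] ^ s = (\<Sum>i\<in>{0..n}. smult (?c i) (monom 1 i * [:1, -1:] ^ s))"
    unfolding jacobi01_def sum_distrib_right
    by (intro sum.cong refl) (simp add: smult_monom flip: mult_smult_left)
  then have "beta_int \<alpha> \<beta> (jacobi01 n \<alpha> \<beta> * [:1, -1:] ^ s) =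
     (\<Sum>i\<in>{0..n}. ?c i * Beta (\<alpha> + 1 + real i) (\<beta> + 1 + real s))"
    by (simp only: beta_int_sum[OF a b] beta_int_smult[OF a b] beta_int_monom[OF a b])
  also have "\<dots> = (\<Sum>i\<in>{0..n}. ?C * ((pochhammer (real n + \<alpha> + \<beta> + 1) i * pochhammer (- real n) i) / (fact i * pochhammer (\<alpha> + \<beta> + 2 + real s) i)))"
  proof (intro sum.cong refl)
    fix i
    have "pochhammer (\<alpha> + 1) i \<noteq> 0" using a by (intro less_imp_neq[symmetric] pochhammer_pos) auto
    then show "?c i * Beta (\<alpha> + 1 + real i) (\<beta> + 1 + real s) = ?C * ((pochhammer (real n + \<alpha> + \<beta> + 1) i * pochhammer (- real n) i) / (fact i * pochhammer (\<alpha> + \<beta> + 2 + real s) i))"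
      unfolding Beta_shift by (simp add: mult_ac)
  qed
  also have "\<dots> = ?C * (pochhammer ((\<alpha> + \<beta> + 2 + real s) - (real n + \<alpha> + \<beta> + 1)) n / pochhammer (\<alpha> + \<beta> + 2 + real s) n)"
  proof -
    have "\<forall>i\<in>{0..<n}. \<alpha> + \<beta> + 2 + real s \<noteq> - real i" using a b by auto
    from Vandermonde_pochhammer[OF this, of "real n + \<alpha> + \<beta> + 1"]
    show ?thesis unfolding sum_distrib_left[symmetric] by simp
  qed
  finally show ?thesis by (simp add: algebra_simps)
qed

lemma Beta_weight_pos: "Beta (\<alpha> + 1) (\<beta> + 1) > 0"
  using a b by (simp add: Beta_def)

text \<open>All powers (1 - u)^s with s < n integrate to 0, so only the top coefficient counts. This
  gives orthogonality and, for q the polynomial itself, the norm.\<close>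

lemma beta_int_jacobi01:
  assumes "degree q \<le> n"
  shows "beta_int \<alpha> \<beta> (jacobi01 n \<alpha> \<beta> * q) = coeff (q \<circ>\<^sub>p [:1, -1:]) n * (Beta (\<alpha> + 1) (\<beta> + 1) *
     (pochhammer (\<beta> + 1) n / pochhammer (\<alpha> + \<beta> + 2) n) * (fact n / pochhammer (\<alpha> + \<beta> + 2 + real n) n))"
proof -
  let ?J = "jacobi01 n \<alpha> \<beta>"
  have z: "beta_int \<alpha> \<beta> (?J * [:1, -1:] ^ s) = 0" if "s < n" for s
  proof -
    \<comment> \<open>The factor with index n - 1 - s is (s + 1 - n) + (n - 1 - s) = 0.\<close>
    have "pochhammer (real s + 1 - real n) n = 0"
      using that by (subst pochhammer_eq_0_iff, intro exI[of _ "n - 1 - s"]) auto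
    then show ?thesis by (simp add: beta_int_jacobi01_power)
  qed
  have "beta_int \<alpha> \<beta> (?J * q) = beta_int \<alpha> \<beta> (\<Sum>s\<le>n. smult (coeff (q \<circ>\<^sub>p [:1, -1:]) s) (?J * [:1, -1:] ^ s))"
    by (subst poly_expand_at_1[OF assms]) (simp add: sum_distrib_left)
  also have "\<dots> = (\<Sum>s\<le>n. coeff (q \<circ>\<^sub>p [:1, -1:]) s * beta_int \<alpha> \<beta> (?J * [:1, -1:] ^ s))"
    by (simp only: beta_int_sum[OF a b] beta_int_smult[OF a b])
  also have "\<dots> = coeff (q \<circ>\<^sub>p [:1, -1:]) n * beta_int \<alpha> \<beta> (?J * [:1, -1:] ^ n)"
    by (subst sum.remove[of _ n]) (auto intro!: sum.neutral simp: z)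
  also have "\<dots> = coeff (q \<circ>\<^sub>p [:1, -1:]) n * (Beta (\<alpha> + 1) (\<beta> + 1) *
     (pochhammer (\<beta> + 1) n / pochhammer (\<alpha> + \<beta> + 2) n) * (fact n / pochhammer (\<alpha> + \<beta> + 2 + real n) n))"
    by (simp add: beta_int_jacobi01_power pochhammer_fact)
  finally show ?thesis .
qed

lemma coeff_pcompose_reflect_top:
  assumes "degree (q :: real poly) \<le> n"
  shows "coeff (q \<circ>\<^sub>p [:1, -1:]) n = (-1) ^ n * coeff q n"
proof (cases "degree q = n")
  case True
  then show ?thesis using lead_coeff_comp[of "[:1, -1:]" q] by (simp add: degree_pcompose)
next
  case False
  then have "degree q < n" using assms by simp
  then show ?thesis by (simp add: coeff_eq_0 degree_pcompose)
qed

lemma beta_int_jacobi01_orth: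
  assumes "degree q < n" shows "beta_int \<alpha> \<beta> (jacobi01 n \<alpha> \<beta> * q) = 0"
  using assms by (simp add: beta_int_jacobi01 coeff_pcompose_reflect_top coeff_eq_0)

lemma beta_int_jacobi01_self:
  "beta_int \<alpha> \<beta> (jacobi01 n \<alpha> \<beta> * jacobi01 n \<alpha> \<beta>) = Beta (\<alpha> + 1) (\<beta> + 1) * jacobi_sqnorm n \<alpha> \<beta>"
  unfolding beta_int_jacobi01[OF degree_jacobi01_le] coeff_pcompose_reflect_top[OF degree_jacobi01_le]
  by (simp add: coeff_jacobi01 pochhammer_same jacobi_sqnorm_def field_simps flip: power_mult_distrib)

text \<open>For n \<ge> 1 the base n + \<alpha> + \<beta> + 1 is positive. For n = 0 it may be
  negative, but then the product is empty.\<close>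

lemma jacobi_pochhammer_pos: "pochhammer (real n + \<alpha> + \<beta> + 1) n > 0"
  using a b by (cases n) (auto intro: pochhammer_pos)

lemma jacobi_sqnorm_pos: "jacobi_sqnorm n \<alpha> \<beta> > 0"
proof -
  have "pochhammer (\<alpha> + 1) n > 0" "pochhammer (\<beta> + 1) n > 0" "pochhammer (\<alpha> + \<beta> + 2 + real n) n > 0"
    "pochhammer (\<alpha> + \<beta> + 2) n > 0" using a b by (auto intro!: pochhammer_pos)
  then show ?thesis unfolding jacobi_sqnorm_def using jacobi_pochhammer_pos[of n]
    by simp
qed

end

section \<open>Jacobi polynomials on [-1, 1], normalized by their value at 1\<close>

definition jacobi_std :: "nat \<Rightarrow> real \<Rightarrow> real \<Rightarrow> real poly" where
  "jacobi_std n \<alpha> \<beta> = jacobi01 n \<alpha> \<beta> \<circ>\<^sub>p [:1/2, -1/2:]"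

lemma poly_jacobi_std_1: "poly (jacobi_std n \<alpha> \<beta>) 1 = 1"
  by (simp add: jacobi_std_def poly_pcompose poly_jacobi01_0)

text \<open>The substitution t = 1 - 2 u attaches \<alpha> to u and \<beta> to 1 - u. The powers of
  2 cancel in the quotient that defines \<open>jacobi_inner\<close>.\<close>

lemma jacobi_weight_integral:
  "(LBINT t:{-1..1}. poly p t * jacobi_weight \<alpha> \<beta> t) = 2 * 2 powr (\<alpha> + \<beta>) * beta_int \<alpha> \<beta> (p \<circ>\<^sub>p [:1, -2:])"
proof -
  let ?f = "\<lambda>u. indicator {-1..1} (1 + (-2) * u) *\<^sub>R (poly p (1 + (-2) * u) * jacobi_weight \<alpha> \<beta> (1 + (-2) * u))"
  let ?g = "\<lambda>u. 2 powr (\<alpha> + \<beta>) * (indicator {0..1} u *\<^sub>R (poly (p \<circ>\<^sub>p [:1, -2:]) u * (u powr \<alpha> * (1 - u) powr \<beta>)))"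
  have "(LBINT t:{-1..1}. poly p t * jacobi_weight \<alpha> \<beta> t)
     = 2 * (LINT u|lborel. ?f u)"
    unfolding set_lebesgue_integral_def by (subst lborel_integral_real_affine[where c = "-2" and t = 1]) auto
  also have "(LINT u|lborel. ?f u)
     = (LINT u|lborel. ?g u)"
  proof (intro Bochner_Integration.integral_cong refl)
    fix u :: real
    show "?f u
      = ?g u"
    proof (cases "u \<in> {0..1}")
      case True
      have h1: "(2 * u) powr \<alpha> = 2 powr \<alpha> * u powr \<alpha>" using True by (simp add: powr_mult)
      have h2: "(2 * (1 - u)) powr \<beta> = 2 powr \<beta> * (1 - u) powr \<beta>" using True by (subst powr_mult) auto
      have e: "1 + (1 + (-2) * u) = 2 * (1 - u)" "1 - (1 + (-2) * u) = 2 * u" by auto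
      have "jacobi_weight \<alpha> \<beta> (1 + (-2) * u) = 2 powr (\<alpha> + \<beta>) * (u powr \<alpha> * (1 - u) powr \<beta>)"
        unfolding jacobi_weight_def e h1 h2 powr_add by (simp only: mult_ac)
      then show ?thesis using True by (simp add: poly_pcompose algebra_simps)
    qed (auto simp: indicator_def)
  qed
  finally show ?thesis by (simp add: beta_int_def set_lebesgue_integral_def)
qed

context
  fixes \<alpha> \<beta> :: real
  assumes a: "\<alpha> > -1" and b: "\<beta> > -1"
begin

lemma jacobi_inner_eq: "jacobi_inner \<alpha> \<beta> p q = beta_int \<alpha> \<beta> ((p \<circ>\<^sub>p [:1, -2:]) * (q \<circ>\<^sub>p [:1, -2:])) / Beta (\<alpha> + 1) (\<beta> + 1)"
proof -
  have "jacobi_inner \<alpha> \<beta> p q = (LBINT t:{-1..1}. poly (p * q) t * jacobi_weight \<alpha> \<beta> t) /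
     (LBINT t:{-1..1}. poly 1 t * jacobi_weight \<alpha> \<beta> t)"
    by (simp add: jacobi_inner_def)
  also have "beta_int \<alpha> \<beta> (1 \<circ>\<^sub>p [:1, -2:]) = Beta (\<alpha> + 1) (\<beta> + 1)"
    using beta_int_monom[OF a b, of 0 0] by (simp add: pcompose_1)
  then have "(LBINT t:{-1..1}. poly (p * q) t * jacobi_weight \<alpha> \<beta> t) /
     (LBINT t:{-1..1}. poly 1 t * jacobi_weight \<alpha> \<beta> t) = beta_int \<alpha> \<beta> ((p \<circ>\<^sub>p [:1, -2:]) * (q \<circ>\<^sub>p [:1, -2:])) / Beta (\<alpha> + 1) (\<beta> + 1)"
    unfolding jacobi_weight_integral by (simp add: pcompose_mult)
  finally show ?thesis .
qed

lemma jacobi_std_pcompose: "jacobi_std n \<alpha> \<beta> \<circ>\<^sub>p [:1, -2:] = jacobi01 n \<alpha> \<beta>"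
  by (simp add: jacobi_std_def pcompose_assoc[symmetric] pcompose_pCons pcompose_idR)

lemma jacobi_std_orth: "degree q < n \<Longrightarrow> jacobi_inner \<alpha> \<beta> (jacobi_std n \<alpha> \<beta>) q = 0"
  by (simp add: jacobi_inner_eq jacobi_std_pcompose beta_int_jacobi01_orth[OF a b] degree_pcompose)

lemma jacobi_std_self: "jacobi_inner \<alpha> \<beta> (jacobi_std n \<alpha> \<beta>) (jacobi_std n \<alpha> \<beta>) = jacobi_sqnorm n \<alpha> \<beta>"
  using Beta_weight_pos[OF a b] by (simp add: jacobi_inner_eq jacobi_std_pcompose beta_int_jacobi01_self[OF a b])

lemma jacobi_std_degree: "degree (jacobi_std n \<alpha> \<beta>) = n" "lead_coeff (jacobi_std n \<alpha> \<beta>) > 0"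
proof -
  have c: "coeff (jacobi01 n \<alpha> \<beta>) n = (-1) ^ n * (pochhammer (real n + \<alpha> + \<beta> + 1) n / pochhammer (\<alpha> + 1) n)"
    by (simp add: coeff_jacobi01 pochhammer_same)
  have p: "pochhammer (real n + \<alpha> + \<beta> + 1) n / pochhammer (\<alpha> + 1) n > 0"
    using jacobi_pochhammer_pos[OF a b, of n] a by (auto intro!: divide_pos_pos pochhammer_pos)
  then have "coeff (jacobi01 n \<alpha> \<beta>) n \<noteq> 0" by (auto simp: c)
  then have d: "degree (jacobi01 n \<alpha> \<beta>) = n" using degree_jacobi01_le[of n \<alpha> \<beta>] le_degree by (metis antisym)
  then show "degree (jacobi_std n \<alpha> \<beta>) = n" by (simp add: jacobi_std_def degree_pcompose)
  have "lead_coeff (jacobi_std n \<alpha> \<beta>) = coeff (jacobi01 n \<alpha> \<beta>) n * (-1/2) ^ n"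
    unfolding jacobi_std_def by (subst lead_coeff_comp) (auto simp: d)
  also have "\<dots> = (pochhammer (real n + \<alpha> + \<beta> + 1) n / pochhammer (\<alpha> + 1) n) * (((-1) * (-1/2)) ^ n)"
    unfolding c power_mult_distrib by (simp only: mult_ac)
  also have "\<dots> > 0" by (intro mult_pos_pos p) simp
  finally show "lead_coeff (jacobi_std n \<alpha> \<beta>) > 0" .
qed

lemma jacobi_inner_diff: "jacobi_inner \<alpha> \<beta> (p - smult c p') q = jacobi_inner \<alpha> \<beta> p q - c * jacobi_inner \<alpha> \<beta> p' q"
proof -
  have "beta_int \<alpha> \<beta> (((p - smult c p') \<circ>\<^sub>p [:1, -2:]) * (q \<circ>\<^sub>p [:1, -2:]))
    = beta_int \<alpha> \<beta> ((p \<circ>\<^sub>p [:1, -2:]) * (q \<circ>\<^sub>p [:1, -2:]) + smult (-c) ((p' \<circ>\<^sub>p [:1, -2:]) * (q \<circ>\<^sub>p [:1, -2:])))"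
    by (rule arg_cong[of _ _ "beta_int \<alpha> \<beta>"]) (simp add: pcompose_diff pcompose_smult algebra_simps)
  then show ?thesis
    unfolding jacobi_inner_eq by (simp only: beta_int_add[OF a b] beta_int_smult[OF a b]) (simp add: diff_divide_distrib)
qed

lemma jacobi_inner_smult: "jacobi_inner \<alpha> \<beta> (smult c p) q = c * jacobi_inner \<alpha> \<beta> p q"
  using jacobi_inner_diff[of 0 "-c" p q] by (simp add: jacobi_inner_eq beta_int_0[OF a b])

lemma jacobi_inner_commute: "jacobi_inner \<alpha> \<beta> p q = jacobi_inner \<alpha> \<beta> q p"
  by (simp add: jacobi_inner_eq mult.commute)

lemma jacobi_inner_smult_right: "jacobi_inner \<alpha> \<beta> p (smult c q) = c * jacobi_inner \<alpha> \<beta> p q"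
  by (metis jacobi_inner_commute jacobi_inner_smult)

text \<open>Subtracting the multiple that cancels the coefficient of degree n leaves a remainder of
  degree below n, to which both terms are orthogonal; so it is orthogonal to itself and vanishes.
  Requiring only degree \<le> n covers circle averages, whose degree may drop.\<close>

lemma orthogonal_poly_unique:
  assumes "degree p \<le> n" and orth: "\<And>q. degree q < n \<Longrightarrow> jacobi_inner \<alpha> \<beta> p q = 0"
  shows "p = smult (coeff p n / lead_coeff (jacobi_std n \<alpha> \<beta>)) (jacobi_std n \<alpha> \<beta>)"
proof -
  let ?J = "jacobi_std n \<alpha> \<beta>"
  define c where "c = coeff p n / lead_coeff ?J"
  define r where "r = p - smult c ?J"
  have "coeff r n = 0" using jacobi_std_degree[of n] by (simp add: r_def c_def)
  have "degree r \<le> n" unfolding r_def using assms(1) jacobi_std_degree(1)[of n]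
    by (intro degree_diff_le order.trans[OF degree_smult_le]) auto
  have "r = 0"
  proof (rule ccontr)
    assume "r \<noteq> 0"
    then have "degree r \<noteq> n" using \<open>coeff r n = 0\<close> by auto
    then have "degree r < n" using \<open>degree r \<le> n\<close> by simp
    then have "jacobi_inner \<alpha> \<beta> r r = 0"
      unfolding r_def[unfolded atomize_eq] by (subst jacobi_inner_diff) (simp add: orth jacobi_std_orth r_def[symmetric])
    then have "r \<circ>\<^sub>p [:1, -2:] = 0" using Beta_weight_pos[OF a b]
      by (intro beta_int_pos_definite[OF a b]) (simp add: jacobi_inner_eq)
    then show False using \<open>r \<noteq> 0\<close> by (simp add: pcompose_eq_0_iff)
  qed
  then show ?thesis by (simp add: r_def c_def)
qed

text \<open>Any candidate is a multiple of \<open>jacobi_std\<close>; unit norm fixes the square of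
  the factor and the positive leading coefficient its sign.\<close>

lemma jacobi_orthonormal_eq:
  "jacobi_orthonormal n \<alpha> \<beta> = smult (1 / sqrt (jacobi_sqnorm n \<alpha> \<beta>)) (jacobi_std n \<alpha> \<beta>)"
  unfolding jacobi_orthonormal_def
proof (rule the_equality)
  let ?N = "jacobi_sqnorm n \<alpha> \<beta>" and ?J = "jacobi_std n \<alpha> \<beta>"
  have N: "?N > 0" by (rule jacobi_sqnorm_pos[OF a b])
  have self: "jacobi_inner \<alpha> \<beta> (smult c ?J) (smult c ?J) = c\<^sup>2 * ?N" for c
    by (simp add: jacobi_inner_smult jacobi_inner_smult_right jacobi_std_self power2_eq_square)
  show "degree (smult (1 / sqrt ?N) ?J) = n \<and> lead_coeff (smult (1 / sqrt ?N) ?J) > 0 \<and>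
    (\<forall>q. degree q < n \<longrightarrow> jacobi_inner \<alpha> \<beta> (smult (1 / sqrt ?N) ?J) q = 0) \<and>
    jacobi_inner \<alpha> \<beta> (smult (1 / sqrt ?N) ?J) (smult (1 / sqrt ?N) ?J) = 1"
  proof -
    have "jacobi_inner \<alpha> \<beta> (smult (1 / sqrt ?N) ?J) (smult (1 / sqrt ?N) ?J) = 1"
      unfolding self using N by (simp add: power_divide)
    moreover have "jacobi_inner \<alpha> \<beta> (smult (1 / sqrt ?N) ?J) q = 0" if "degree q < n" for q
      using that by (simp only: jacobi_inner_smult jacobi_std_orth mult_zero_right)
    ultimately show ?thesis using N jacobi_std_degree[of n] by simp
  qed
  fix p assume p: "degree p = n \<and> 0 < lead_coeff p \<and> (\<forall>q. degree q < n \<longrightarrow> jacobi_inner \<alpha> \<beta> p q = 0) \<and> jacobi_inner \<alpha> \<beta> p p = 1"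
  define c where "c = coeff p n / lead_coeff ?J"
  have pc: "p = smult c ?J" unfolding c_def by (rule orthogonal_poly_unique) (use p in auto)
  have c: "c > 0" using p jacobi_std_degree(2)[of n] by (auto simp: c_def)
  have "c\<^sup>2 * ?N = 1" using p self[of c] pc by simp
  then have "c\<^sup>2 = 1 / ?N" using N by (simp add: field_simps)
  then have "c = sqrt (1 / ?N)" using c by (metis less_imp_le real_sqrt_unique)
  then show "p = smult (1 / sqrt ?N) ?J" using pc by (simp add: real_sqrt_divide)
qed

lemma jacobi_orthonormal_at_1: "(poly (jacobi_orthonormal n \<alpha> \<beta>) 1)\<^sup>2 = 1 / jacobi_sqnorm n \<alpha> \<beta>"
  using jacobi_sqnorm_pos[OF a b, of n] by (simp add: jacobi_orthonormal_eq poly_jacobi_std_1 power_divide)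

text \<open>The form in which orthogonality is used on the slices x_3 = s, where u = s^2.\<close>

lemma jacobi_orthonormal_orth01:
  assumes "degree q < n"
  shows "(LBINT u:{0..1}. poly (jacobi_orthonormal n \<alpha> \<beta>) (1 - 2 * u) * poly q u * (u powr \<alpha> * (1 - u) powr \<beta>)) = 0"
proof -
  have "beta_int \<alpha> \<beta> (smult (1 / sqrt (jacobi_sqnorm n \<alpha> \<beta>)) (jacobi01 n \<alpha> \<beta> * q)) = 0"
    by (simp only: beta_int_smult[OF a b] beta_int_jacobi01_orth[OF a b assms])
  moreover have "poly (jacobi_std n \<alpha> \<beta>) (1 - 2 * u) = poly (jacobi01 n \<alpha> \<beta>) u" for u
    unfolding jacobi_std_pcompose[symmetric] by (simp add: poly_pcompose algebra_simps)
  ultimately show ?thesis by (simp add: beta_int_def jacobi_orthonormal_eq)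
qed

end

section \<open>Gegenbauer polynomials as symmetric Jacobi polynomials\<close>

context
  fixes \<mu> :: real
  assumes mu: "\<mu> > -1/2"
begin

lemma jacobi_weight_symmetric: "s \<in> {-1..1} \<Longrightarrow> jacobi_weight \<mu> \<mu> s = (1 - s\<^sup>2) powr \<mu>"
  by (simp add: jacobi_weight_def powr_mult[symmetric] power2_eq_square algebra_simps)

lemma gegenbauer_integral_eq:
  "(LBINT s:{-1..1}. poly p s * poly q s * (1 - s\<^sup>2) powr \<mu>) =
     jacobi_inner \<mu> \<mu> p q * (LBINT s:{-1..1}. (1 - s\<^sup>2) powr \<mu>)"
  "(LBINT s:{-1..1}. (1 - s\<^sup>2) powr \<mu>) > 0"
proof -
  have e: "(LBINT s:{-1..1}. F s * (1 - s\<^sup>2) powr \<mu>) = (LBINT s:{-1..1}. F s * jacobi_weight \<mu> \<mu> s)" for F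
    by (rule set_lebesgue_integral_cong) (auto simp: jacobi_weight_symmetric)
  have w: "(LBINT s:{-1..1}. (1 - s\<^sup>2) powr \<mu>) = (LBINT s:{-1..1}. poly 1 s * jacobi_weight \<mu> \<mu> s)"
    using e[of "\<lambda>_. 1"] by simp
  have "beta_int \<mu> \<mu> (1 \<circ>\<^sub>p [:1, -2:]) = Beta (\<mu> + 1) (\<mu> + 1)"
    using beta_int_monom[of \<mu> \<mu> 0 0] mu by (simp add: pcompose_1)
  then show p: "(LBINT s:{-1..1}. (1 - s\<^sup>2) powr \<mu>) > 0"
    unfolding w jacobi_weight_integral using Beta_weight_pos[of \<mu> \<mu>] mu by simp
  show "(LBINT s:{-1..1}. poly p s * poly q s * (1 - s\<^sup>2) powr \<mu>) =
     jacobi_inner \<mu> \<mu> p q * (LBINT s:{-1..1}. (1 - s\<^sup>2) powr \<mu>)"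
    using p w e[of "\<lambda>s. poly p s * poly q s"] by (simp add: jacobi_inner_def)
qed

text \<open>The parameter \<mu> + 1/2 makes the weight exponent equal to \<mu> at both ends, and the
  prescribed value at 1 becomes the Pochhammer symbol of 2 \<mu> + 1 > 0 divided by a factorial,
  hence is nonzero.\<close>

lemma gegenbauer_eq:
  "gegenbauer (\<mu> + 1 / 2) k = smult (pochhammer (2 * \<mu> + 1) k / fact k) (jacobi_std k \<mu> \<mu>)"
  unfolding gegenbauer_def
proof (rule the_equality)
  let ?J = "jacobi_std k \<mu> \<mu>" and ?c = "pochhammer (2 * \<mu> + 1) k / fact k"
  have m: "\<mu> > -1" using mu by simp
  have e: "(LBINT s:{-1..1}. poly p s * poly q s * (1 - s\<^sup>2) powr (\<mu> + 1/2 - 1/2)) = 0 \<longleftrightarrow> jacobi_inner \<mu> \<mu> p q = 0" for p q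
    using gegenbauer_integral_eq by simp
  have two: "2 * (\<mu> + 1 / 2) = 2 * \<mu> + 1" by simp
  have c: "?c \<noteq> 0" using mu pochhammer_pos[of "2 * \<mu> + 1" k] by simp
  show "degree (smult ?c ?J) = k \<and>
    (\<forall>q. degree q < k \<longrightarrow> (LBINT s:{-1..1}. poly (smult ?c ?J) s * poly q s * (1 - s\<^sup>2) powr (\<mu> + 1/2 - 1/2)) = 0) \<and>
    poly (smult ?c ?J) 1 = pochhammer (2 * (\<mu> + 1 / 2)) k / fact k"
    unfolding e two using c by (simp add: jacobi_std_degree[OF m m] jacobi_inner_smult[OF m m] jacobi_std_orth[OF m m] poly_jacobi_std_1)
  fix p assume p: "degree p = k \<and>
    (\<forall>q. degree q < k \<longrightarrow> (LBINT s:{-1..1}. poly p s * poly q s * (1 - s\<^sup>2) powr (\<mu> + 1/2 - 1/2)) = 0) \<and>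
    poly p 1 = pochhammer (2 * (\<mu> + 1 / 2)) k / fact k"
  then obtain d where "p = smult d ?J" using orthogonal_poly_unique[OF m m, of p k] unfolding e by blast
  moreover from this have "d = ?c" using p unfolding two by (simp add: poly_jacobi_std_1)
  ultimately show "p = smult ?c ?J" by simp
qed

abbreviation "geg k \<equiv> gegenbauer (\<mu> + 1 / 2) k"

lemma gegenbauer_degree: "degree (geg k) = k"
  using mu pochhammer_pos[of "2 * \<mu> + 1" k] by (simp add: gegenbauer_eq jacobi_std_degree)

lemma gegenbauer_at_1: "poly (geg k) 1 \<noteq> 0"
  using mu pochhammer_pos[of "2 * \<mu> + 1" k] by (simp add: gegenbauer_eq poly_jacobi_std_1)

lemma gegenbauer_orth: "degree q < k \<Longrightarrow> (LBINT s:{-1..1}. poly (geg k) s * poly q s * (1 - s\<^sup>2) powr \<mu>) = 0"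
  unfolding gegenbauer_integral_eq using mu by (simp add: gegenbauer_eq jacobi_inner_smult jacobi_std_orth)

lemma gegenbauer_unique:
  assumes "degree p \<le> k" "\<And>q. degree q < k \<Longrightarrow> (LBINT s:{-1..1}. poly p s * poly q s * (1 - s\<^sup>2) powr \<mu>) = 0"
  shows "p = smult (poly p 1 / poly (geg k) 1) (geg k)"
proof -
  have m: "\<mu> > -1" using mu by simp
  have "jacobi_inner \<mu> \<mu> p q = 0" if "degree q < k" for q
    using assms(2)[OF that] gegenbauer_integral_eq by simp
  then obtain d where d: "p = smult d (jacobi_std k \<mu> \<mu>)" using orthogonal_poly_unique[OF m m assms(1)] by blast
  then show ?thesis using pochhammer_pos[of "2 * \<mu> + 1" k] mu by (simp add: gegenbauer_eq poly_jacobi_std_1)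
qed

text \<open>In the Jacobi norm the Pochhammer symbols pair up with bases differing by 1. Splitting
  (a)_{k+1} at its first and at its last factor turns each quotient into a fraction, with a = 2
  \<mu> + 1 and a = 2 \<mu> + 1 + k, and the factor 2 \<mu> + 1 + k cancels between them.\<close>

lemma gegenbauer_sqnorm:
  "(LBINT s:{-1..1}. poly (geg k) s * poly (geg k) s * (1 - s\<^sup>2) powr \<mu>) =
     poly (geg k) 1 * ((\<mu> + 1/2) / (real k + \<mu> + 1/2)) * (LBINT s:{-1..1}. (1 - s\<^sup>2) powr \<mu>)"
proof -
  have m: "\<mu> > -1" using mu by simp
  let ?c = "pochhammer (2 * \<mu> + 1) k / fact k"
  have p: "pochhammer x n > 0" if "x > 0" for x :: real and n using that by (rule pochhammer_pos)
  have 1: "(2 * \<mu> + 1 + real k) * pochhammer (2 * \<mu> + 1) k = (2 * \<mu> + 1) * pochhammer (2 * \<mu> + 2) k"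
    using pochhammer_rec[of "2 * \<mu> + 1" k] pochhammer_rec'[of "2 * \<mu> + 1" k] by (simp add: algebra_simps)
  have 2: "(2 * \<mu> + 1 + 2 * real k) * pochhammer (2 * \<mu> + 1 + real k) k = (2 * \<mu> + 1 + real k) * pochhammer (2 * \<mu> + 2 + real k) k"
    using pochhammer_rec[of "2 * \<mu> + 1 + real k" k] pochhammer_rec'[of "2 * \<mu> + 1 + real k" k] by (simp add: algebra_simps)
  have "?c * jacobi_sqnorm k \<mu> \<mu> = (\<mu> + 1/2) / (real k + \<mu> + 1/2)"
  proof -
    have pos: "pochhammer (\<mu> + 1) k > 0" "pochhammer (2 * \<mu> + 2) k > 0" "pochhammer (2 * \<mu> + 2 + real k) k > 0"
      "2 * \<mu> + 1 > 0" "2 * \<mu> + 1 + real k > 0" "2 * \<mu> + 1 + 2 * real k > 0"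
      using mu by (auto intro!: pochhammer_pos)
    have "?c * jacobi_sqnorm k \<mu> \<mu> = (pochhammer (2 * \<mu> + 1) k / pochhammer (2 * \<mu> + 2) k) * (pochhammer (2 * \<mu> + 1 + real k) k / pochhammer (2 * \<mu> + 2 + real k) k)"
      using pos by (simp add: jacobi_sqnorm_def add_ac)
    also have "pochhammer (2 * \<mu> + 1) k / pochhammer (2 * \<mu> + 2) k = (2 * \<mu> + 1) / (2 * \<mu> + 1 + real k)"
      using 1 pos by (simp add: frac_eq_eq mult.commute)
    also have "pochhammer (2 * \<mu> + 1 + real k) k / pochhammer (2 * \<mu> + 2 + real k) k = (2 * \<mu> + 1 + real k) / (2 * \<mu> + 1 + 2 * real k)"
      using 2 pos by (simp add: frac_eq_eq mult.commute)
    also have "(2 * \<mu> + 1) / (2 * \<mu> + 1 + real k) * ((2 * \<mu> + 1 + real k) / (2 * \<mu> + 1 + 2 * real k)) = (2 * \<mu> + 1) / (2 * \<mu> + 1 + 2 * real k)"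
      using pos by simp
    also have "\<dots> = (2 * (\<mu> + 1/2)) / (2 * (real k + \<mu> + 1/2))" by (simp add: algebra_simps)
    finally show ?thesis unfolding mult_divide_mult_cancel_left_if by simp
  qed
  then show ?thesis
    unfolding gegenbauer_integral_eq by (simp add: gegenbauer_integral_eq gegenbauer_eq jacobi_inner_smult[OF m m] jacobi_inner_smult_right[OF m m]
      jacobi_std_self[OF m m] poly_jacobi_std_1)
qed

text \<open>The weight is even, so the reflected polynomial satisfies the same orthogonality and is
  a multiple of the original by uniqueness; comparing coefficients of degree k determines the
  sign.\<close>

lemma gegenbauer_minus: "poly (geg k) (- s) = (-1) ^ k * poly (geg k) s"
proof -
  let ?p = "geg k \<circ>\<^sub>p [:0, -1:]"
  have "(LBINT s:{-1..1}. poly ?p s * poly q s * (1 - s\<^sup>2) powr \<mu>) = 0" if "degree q < k" for q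
  proof -
    have "(LBINT s:{-1..1}. poly ?p s * poly q s * (1 - s\<^sup>2) powr \<mu>)
       = (LINT s|lborel. indicator {-1..1} (0 + (-1) * s) *\<^sub>R (poly ?p (0 + (-1) * s) * poly q (0 + (-1) * s) * (1 - (0 + (-1) * s)\<^sup>2) powr \<mu>))"
      unfolding set_lebesgue_integral_def by (subst lborel_integral_real_affine[where c = "-1" and t = 0]) auto
    also have "\<dots> = (LBINT s:{-1..1}. poly (geg k) s * poly (q \<circ>\<^sub>p [:0, -1:]) s * (1 - s\<^sup>2) powr \<mu>)"
      unfolding set_lebesgue_integral_def
      by (intro Bochner_Integration.integral_cong refl) (auto simp: indicator_def poly_pcompose)
    also have "\<dots> = 0" using that by (intro gegenbauer_orth) (simp add: degree_pcompose)
    finally show ?thesis .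
  qed
  then have e: "?p = smult (poly ?p 1 / poly (geg k) 1) (geg k)"
    by (intro gegenbauer_unique) (simp_all add: degree_pcompose gegenbauer_degree)
  have "geg k \<noteq> 0" using gegenbauer_at_1[of k] by auto
  then have l: "lead_coeff (geg k) \<noteq> 0" by simp
  have "coeff ?p k = (-1) ^ k * coeff (geg k) k" by (simp add: coeff_pcompose_linear)
  then have "poly ?p 1 / poly (geg k) 1 = (-1) ^ k" using arg_cong[OF e, of "\<lambda>p. coeff p k"] l
    unfolding coeff_smult gegenbauer_degree by (metis mult_cancel_right)
  then have "?p = smult ((-1) ^ k) (geg k)" using e by simp
  then have "poly ?p s = (-1) ^ k * poly (geg k) s" by simp
  then show ?thesis by (simp add: poly_pcompose)
qed

end

section \<open>Trigonometric polynomials\<close>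

abbreviation mode :: "nat \<Rightarrow> nat \<Rightarrow> real \<Rightarrow> complex" where
  "mode k n \<phi> \<equiv> cis ((real k - 2 * real n) * \<phi>)"

text \<open>These are the frequencies k, k - 2, ..., -k that occur when homogeneous polynomials of
  degree k in two variables are restricted to the unit circle.\<close>

definition trig_span :: "nat \<Rightarrow> (real \<Rightarrow> complex) \<Rightarrow> bool" where
  "trig_span k T \<longleftrightarrow> (\<exists>c. \<forall>\<phi>. T \<phi> = (\<Sum>n\<le>k. c n * mode k n \<phi>))"

text \<open>Passing from k to k + 1, the factor \<open>cis \<phi>\<close> keeps the index n of a
  mode and \<open>cis (- \<phi>)\<close> raises it by 1.\<close>

lemma trig_span_mult:
  assumes "trig_span k T"
  shows "trig_span (Suc k) (\<lambda>\<phi>. (a * cis \<phi> + b * cis (- \<phi>)) * T \<phi>)"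
proof -
  obtain c where c: "\<And>\<phi>. T \<phi> = (\<Sum>n\<le>k. c n * mode k n \<phi>)"
    using assms by (auto simp: trig_span_def)
  define d where "d n = (if n \<le> k then a * c n else 0) + (if n \<ge> 1 then b * c (n - 1) else 0)" for n
  have "(a * cis \<phi> + b * cis (- \<phi>)) * T \<phi> = (\<Sum>n\<le>Suc k. d n * mode (Suc k) n \<phi>)" for \<phi>
  proof -
    have "(\<Sum>n\<le>Suc k. d n * mode (Suc k) n \<phi>)
      = (\<Sum>n\<le>Suc k. (if n \<le> k then a * c n else 0) * mode (Suc k) n \<phi>)
        + (\<Sum>n\<le>Suc k. (if n \<ge> 1 then b * c (n - 1) else 0) * mode (Suc k) n \<phi>)"
      unfolding d_def ring_distribs sum.distrib ..
    also have "(\<Sum>n\<le>Suc k. (if n \<le> k then a * c n else 0) * mode (Suc k) n \<phi>)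
      = (\<Sum>n\<le>k. a * cis \<phi> * (c n * mode k n \<phi>))"
    proof -
      have "a * c n * mode (Suc k) n \<phi> = a * cis \<phi> * (c n * mode k n \<phi>)" for n
      proof -
        have "(real (Suc k) - 2 * real n) * \<phi> = \<phi> + (real k - 2 * real n) * \<phi>" by (simp add: algebra_simps)
        then show ?thesis by (simp only: cis_mult[symmetric] mult_ac)
      qed
      then show ?thesis by (auto simp del: of_nat_Suc intro!: sum.cong)
    qed
    also have "(\<Sum>n\<le>Suc k. (if n \<ge> 1 then b * c (n - 1) else 0) * mode (Suc k) n \<phi>)
      = (\<Sum>n\<le>k. b * cis (- \<phi>) * (c n * mode k n \<phi>))"
    proof -
      have "b * c n * mode (Suc k) (Suc n) \<phi> = b * cis (- \<phi>) * (c n * mode k n \<phi>)" for n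
      proof -
        have "(real (Suc k) - 2 * real (Suc n)) * \<phi> = - \<phi> + (real k - 2 * real n) * \<phi>" by (simp add: algebra_simps)
        then show ?thesis by (simp only: cis_mult[symmetric] mult_ac)
      qed
      then show ?thesis by (subst sum.atMost_Suc_shift) (auto simp del: of_nat_Suc intro!: sum.cong)
    qed
    finally show ?thesis unfolding c distrib_right sum_distrib_left sum.distrib by (rule sym)
  qed
  then show ?thesis unfolding trig_span_def by blast
qed

lemma trig_span_cos_sin: "trig_span (i + j) (\<lambda>\<phi>. of_real (cos \<phi> ^ i * sin \<phi> ^ j))"
proof -
  have cosine: "complex_of_real (cos \<phi>) = 1/2 * cis \<phi> + 1/2 * cis (- \<phi>)" for \<phi>
    by (simp add: complex_eq_iff)
  have sine: "complex_of_real (sin \<phi>) = - \<i>/2 * cis \<phi> + \<i>/2 * cis (- \<phi>)" for \<phi>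
    by (simp add: complex_eq_iff)
  have s: "trig_span j (\<lambda>\<phi>. of_real (sin \<phi> ^ j))" for j
  proof (induction j)
    case 0
    then show ?case by (auto simp: trig_span_def intro!: exI[of _ "\<lambda>_. 1"])
  next
    case (Suc j)
    from trig_span_mult[OF Suc, of "- \<i>/2" "\<i>/2"] show ?case
      by (simp only: sine[symmetric] power_Suc of_real_mult)
  qed
  show ?thesis
  proof (induction i)
    case 0
    then show ?case using s[of j] by simp
  next
    case (Suc i)
    from trig_span_mult[OF Suc, of "1/2" "1/2"] show ?case
      by (simp only: cosine[symmetric] power_Suc of_real_mult mult.assoc add_Suc)
  qed
qed

lemma trig_span_sum:
  assumes "\<And>x. x \<in> A \<Longrightarrow> trig_span k (T x)"
  shows "trig_span k (\<lambda>\<phi>. \<Sum>x\<in>A. c x * T x \<phi>)"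
proof -
  have "\<forall>x. \<exists>d. x \<in> A \<longrightarrow> (\<forall>\<phi>. T x \<phi> = (\<Sum>n\<le>k. d n * mode k n \<phi>))"
    using assms unfolding trig_span_def by blast
  then obtain d where d: "\<And>x \<phi>. x \<in> A \<Longrightarrow> T x \<phi> = (\<Sum>n\<le>k. d x n * mode k n \<phi>)"
    by metis
  have "(\<Sum>x\<in>A. c x * T x \<phi>) = (\<Sum>n\<le>k. (\<Sum>x\<in>A. c x * d x n) * mode k n \<phi>)" for \<phi>
  proof -
    have "(\<Sum>x\<in>A. c x * T x \<phi>) = (\<Sum>x\<in>A. \<Sum>n\<le>k. c x * d x n * mode k n \<phi>)"
      by (intro sum.cong refl) (simp add: d sum_distrib_left mult.assoc)
    also have "\<dots> = (\<Sum>n\<le>k. \<Sum>x\<in>A. c x * d x n * mode k n \<phi>)" by (rule sum.swap)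
    finally show ?thesis by (simp add: sum_distrib_right)
  qed
  then show ?thesis unfolding trig_span_def by (intro exI allI)
qed

text \<open>The difference of two admissible frequencies is an even number 2 p. The sum is geometric
  with a ratio z satisfying z^(2m+1) = 1. If z were 1, then 2 m + 1 would divide 2 p, hence p
  because it is odd, and the bound on p forbids that.\<close>

lemma sum_cis_nodes:
  fixes p :: int
  assumes "\<bar>p\<bar> \<le> 2 * int m" "p \<noteq> 0"
  shows "(\<Sum>\<nu>\<le>2 * m. cis (2 * real_of_int p * node_angle m \<nu>)) = 0"
proof -
  define z where "z = cis (2 * real_of_int p * (2 * pi / (2 * real m + 1)))"
  have zn: "cis (2 * real_of_int p * node_angle m \<nu>) = z ^ \<nu>" for \<nu>
    by (simp add: z_def node_angle_def Complex.DeMoivre mult_ac)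
  have "z ^ Suc (2 * m) = cis (2 * pi * real_of_int (2 * p))"
    unfolding z_def Complex.DeMoivre by (rule arg_cong[of _ _ cis]) (simp add: field_simps)
  also have "\<dots> = 1" by (rule cis_multiple_2pi) simp
  finally have z1: "z ^ Suc (2 * m) = 1" .
  have "z \<noteq> 1"
  proof
    assume "z = 1"
    then have "Re z = 1" by simp
    then have "cos (2 * real_of_int p * (2 * pi / (2 * real m + 1))) = 1" by (simp add: z_def)
    then obtain N :: int where "2 * real_of_int p * (2 * pi / (2 * real m + 1)) = of_int N * 2 * pi"
      using cos_one_2pi_int by auto
    then have "2 * real_of_int p = of_int N * (2 * real m + 1)"
      by (simp add: divide_simps) (simp add: algebra_simps)
    then have e: "2 * p = N * (2 * int m + 1)"
      by (metis (mono_tags, lifting) of_int_1 of_int_add of_int_eq_iff of_int_mult of_int_numeral of_int_of_nat_eq)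
    have "coprime (2 * int m + 1) 2" by simp
    moreover have "2 * int m + 1 dvd 2 * p" using e by simp
    ultimately have "2 * int m + 1 dvd p" using coprime_dvd_mult_right_iff by blast
    then show False using assms zdvd_imp_le[of "2 * int m + 1" "\<bar>p\<bar>"] by simp
  qed
  then show ?thesis unfolding zn lessThan_Suc_atMost[symmetric] geometric_sum[OF \<open>z \<noteq> 1\<close>] z1 by simp
qed

definition dirichlet :: "nat \<Rightarrow> real \<Rightarrow> complex" where
  "dirichlet k x = (\<Sum>n\<le>k. cis ((real k - 2 * real n) * x))"

text \<open>Expanding both factors into modes, the sum over the nodes is a discrete orthogonality
  relation that leaves only equal indices.\<close>

lemma dirichlet_interpolation:
  assumes T: "trig_span k T" and "k \<le> 2 * m"
  shows "(\<Sum>\<nu>\<le>2 * m. T (node_angle m \<nu>) * dirichlet k (\<phi> - node_angle m \<nu>)) = of_nat (2 * m + 1) * T \<phi>"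
proof -
  obtain c where c: "\<And>\<phi>. T \<phi> = (\<Sum>n\<le>k. c n * mode k n \<phi>)"
    using T by (auto simp: trig_span_def)
  let ?e = "\<lambda>n \<phi>. mode k n \<phi>"
  have "(\<Sum>\<nu>\<le>2 * m. T (node_angle m \<nu>) * dirichlet k (\<phi> - node_angle m \<nu>))
     = (\<Sum>\<nu>\<le>2 * m. \<Sum>n\<le>k. \<Sum>n'\<le>k. c n * ?e n' \<phi> * cis (2 * real_of_int (int n' - int n) * node_angle m \<nu>))"
    unfolding c dirichlet_def sum_product
  proof (intro sum.cong refl)
    fix \<nu> n n'
    have "c n * ?e n (node_angle m \<nu>) * ?e n' (\<phi> - node_angle m \<nu>) = c n * cis ((real k - 2 * real n) * node_angle m \<nu> + (real k - 2 * real n') * (\<phi> - node_angle m \<nu>))"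
      by (simp add: cis_mult mult.assoc)
    also have "(real k - 2 * real n) * node_angle m \<nu> + (real k - 2 * real n') * (\<phi> - node_angle m \<nu>)
      = (real k - 2 * real n') * \<phi> + 2 * real_of_int (int n' - int n) * node_angle m \<nu>"
      by (simp add: algebra_simps)
    finally show "c n * ?e n (node_angle m \<nu>) * ?e n' (\<phi> - node_angle m \<nu>) = c n * ?e n' \<phi> * cis (2 * real_of_int (int n' - int n) * node_angle m \<nu>)"
      by (simp only: cis_mult[symmetric] mult.assoc)
  qed
  also have "\<dots> = (\<Sum>n\<le>k. \<Sum>n'\<le>k. c n * ?e n' \<phi> * (\<Sum>\<nu>\<le>2 * m. cis (2 * real_of_int (int n' - int n) * node_angle m \<nu>)))"
    unfolding sum_distrib_left by (subst sum.swap, rule sum.cong[OF refl], rule sum.swap)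
  also have "\<dots> = (\<Sum>n\<le>k. \<Sum>n'\<le>k. if n' = n then c n * ?e n \<phi> * of_nat (2 * m + 1) else 0)"
  proof (intro sum.cong refl)
    fix n n' assume n: "n \<in> {..k}" "n' \<in> {..k}"
    show "c n * ?e n' \<phi> * (\<Sum>\<nu>\<le>2 * m. cis (2 * real_of_int (int n' - int n) * node_angle m \<nu>))
       = (if n' = n then c n * ?e n \<phi> * of_nat (2 * m + 1) else 0)"
    proof (cases "n' = n")
      case False
      then have "(\<Sum>\<nu>\<le>2 * m. cis (2 * real_of_int (int n' - int n) * node_angle m \<nu>)) = 0"
        using n assms(2) by (intro sum_cis_nodes) auto
      then show ?thesis using False by simp
    qed simp
  qed
  also have "\<dots> = of_nat (2 * m + 1) * T \<phi>" unfolding c by (simp add: sum_distrib_left mult_ac)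
  finally show ?thesis .
qed

text \<open>Cosine and sine terms combine to the cosine of the difference of the angles. The factor
  1/d = 2 accounts for the pair of frequencies k - 2l and -(k - 2l), while the frequency 0, present
  for k = 2l, occurs once.\<close>

lemma dirichlet_disk_index:
  "of_real (\<Sum>(l, e) \<in> disk_index k. 1 / d_coeff l k * S_angular (k - 2 * l) e \<xi> * S_angular (k - 2 * l) e \<phi>)
     = dirichlet k (\<phi> - \<xi>)"
proof -
  let ?L = "{l. 2 * l \<le> k}"
  have finL: "finite ?L" by (rule finite_subset[of _ "{..k}"]) auto
  let ?x = "\<phi> - \<xi>"
  let ?c = "\<lambda>l. 1 / d_coeff l k * cos (real (k - 2 * l) * \<xi>) * cos (real (k - 2 * l) * \<phi>)"
  let ?s = "\<lambda>l. 1 / d_coeff l k * sin (real (k - 2 * l) * \<xi>) * sin (real (k - 2 * l) * \<phi>)"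
  let ?w = "\<lambda>l. 1 / d_coeff l k * cos ((real k - 2 * real l) * ?x)"
  have di: "disk_index k = (\<lambda>l. (l, 0)) ` ?L \<union> (\<lambda>l. (l, 1)) ` {l. 2 * l + 1 \<le> k}"
    by (auto simp: disk_index_def)
  have "(\<Sum>(l, e) \<in> disk_index k. 1 / d_coeff l k * S_angular (k - 2 * l) e \<xi> * S_angular (k - 2 * l) e \<phi>)
     = (\<Sum>l\<in>?L. ?c l)
     + (\<Sum>l\<in>{l. 2 * l + 1 \<le> k}. ?s l)"
    unfolding di using finL
    by (subst sum.union_disjoint) (auto simp: sum.reindex inj_on_def S_angular_def intro!: finite_imageI intro: finite_subset[OF _ finL])
  also have "(\<Sum>l\<in>{l. 2 * l + 1 \<le> k}. ?s l)
     = (\<Sum>l\<in>?L. ?s l)"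
  \<comment> \<open>The sine sum may be extended to k = 2l, where the sine of the zero frequency
    vanishes.\<close>
  proof (rule sum.mono_neutral_left[OF finL], force, intro ballI)
    fix l assume "l \<in> ?L - {l. 2 * l + 1 \<le> k}"
    then have "k - 2 * l = 0" by auto
    then show "?s l = 0"
      unfolding \<open>k - 2 * l = 0\<close> by simp
  qed
  also have "(\<Sum>l\<in>?L. ?c l)
     + (\<Sum>l\<in>?L. ?s l)
     = (\<Sum>l\<in>?L. ?w l)"
    unfolding sum.distrib[symmetric]
  proof (intro sum.cong refl)
    fix l assume "l \<in> ?L"
    then have "(real k - 2 * real l) * ?x = real (k - 2 * l) * \<phi> - real (k - 2 * l) * \<xi>" by (simp add: algebra_simps of_nat_diff)
    then show "?c l +
       ?s l = ?w l"
      by (simp only: cos_diff) (simp add: algebra_simps)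
  qed
  finally have 1: "(\<Sum>(l, e) \<in> disk_index k. 1 / d_coeff l k * S_angular (k - 2 * l) e \<xi> * S_angular (k - 2 * l) e \<phi>)
     = (\<Sum>l\<in>?L. ?w l)" .
  define e where "e n = cis ((real k - 2 * real n) * ?x)" for n
  have ecos: "e n + e (k - n) = of_real (2 * cos ((real k - 2 * real n) * ?x))" if "n \<le> k" for n
  proof -
    have "(real k - 2 * real (k - n)) * ?x = - ((real k - 2 * real n) * ?x)" using that by (simp add: of_nat_diff algebra_simps)
    then show ?thesis unfolding e_def by (simp add: complex_eq_iff)
  qed
  let ?A = "{l. 2 * l < k}"
  have finA: "finite ?A" by (rule finite_subset[OF _ finL]) auto
  have "dirichlet k ?x = (\<Sum>n\<in>?L. e n) + (\<Sum>n\<in>{n. n \<le> k \<and> k < 2 * n}. e n)"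
    unfolding dirichlet_def e_def[symmetric]
    by (subst sum.union_disjoint[symmetric]) (auto intro!: sum.cong intro: finL)
  \<comment> \<open>Replacing n by k - n negates the frequency and folds the upper half onto the
    indices with 2n < k; a middle index stays unpaired.\<close>
  also have "(\<Sum>n\<in>{n. n \<le> k \<and> k < 2 * n}. e n) = (\<Sum>n\<in>?A. e (k - n))"
    by (rule sum.reindex_bij_witness[of _ "\<lambda>n. k - n" "\<lambda>n. k - n"]) auto
  also have "\<dots> = (\<Sum>n\<in>?L. if 2 * n < k then e (k - n) else 0)"
    by (rule sum.mono_neutral_cong_left) (use finL in auto)
  also have "(\<Sum>n\<in>?L. e n) + (\<Sum>n\<in>?L. if 2 * n < k then e (k - n) else 0) = (\<Sum>l\<in>?L. of_real (?w l))"
    unfolding sum.distrib[symmetric]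
  proof (intro sum.cong refl)
    fix l assume l: "l \<in> ?L"
    show "e l + (if 2 * l < k then e (k - l) else 0) = of_real (?w l)"
    proof (cases "2 * l < k")
      case True
      then show ?thesis using ecos[of l] by (simp add: d_coeff_def)
    next
      case False
      then have "real k = 2 * real l" using l by auto
      then show ?thesis using False by (simp add: e_def d_coeff_def)
    qed
  qed
  finally show ?thesis unfolding 1 by simp
qed

section \<open>Fourier orthogonality on the circle\<close>

lemma integral_cis:
  assumes "p \<in> \<int>" "p \<noteq> 0"
  shows "(LBINT \<phi>:{0..2 * pi}. cis (p * \<phi>)) = 0"
proof -
  have d: "((\<lambda>\<phi>. cis (p * \<phi>) / (\<i> * of_real p)) has_vector_derivative cis (p * \<phi>)) (at \<phi> within {0..2 * pi})" for \<phi>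
  proof -
    have "((\<lambda>z. exp (\<i> * of_real p * z) / (\<i> * of_real p)) has_field_derivative exp (\<i> * of_real p * of_real \<phi>)) (at (of_real \<phi>))"
      using assms(2) by (auto intro!: derivative_eq_intros)
    from has_vector_derivative_real_field[OF this] show ?thesis
      by (simp add: cis_conv_exp mult_ac)
  qed
  have "(LBINT \<phi>:{0..2 * pi}. cis (p * \<phi>)) = cis (p * (2 * pi)) / (\<i> * of_real p) - cis (p * 0) / (\<i> * of_real p)"
    unfolding set_lebesgue_integral_def
    by (rule integral_FTC_atLeastAtMost[OF _ d]) (auto intro!: continuous_intros)
  also have "cis (p * (2 * pi)) = 1" using cis_multiple_2pi[OF assms(1)] by (simp add: mult_ac)
  finally show ?thesis by simp
qed

text \<open>A resonance k - 2n + j = 0 forces j and k to have the same parity and, as n \<le> k,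
  also j \<le> k. Under the hypothesis every frequency is therefore a nonzero integer.\<close>

lemma trig_span_orth:
  assumes T: "trig_span k T" and j: "j > k \<or> odd (j + k)"
  shows "(LBINT \<phi>:{0..2 * pi}. T \<phi> * cis (real j * \<phi>)) = 0"
proof -
  obtain c where c: "\<And>\<phi>. T \<phi> = (\<Sum>n\<le>k. c n * mode k n \<phi>)"
    using T by (auto simp: trig_span_def)
  have i: "set_integrable lborel {0..2 * pi} (\<lambda>\<phi>. c n * cis ((real k - 2 * real n + real j) * \<phi>))" for n
    by (intro borel_integrable_atLeastAtMost' continuous_intros)
  have "T \<phi> * cis (real j * \<phi>) = (\<Sum>n\<le>k. c n * cis ((real k - 2 * real n + real j) * \<phi>))" for \<phi>
    unfolding c sum_distrib_right by (intro sum.cong refl) (simp add: mult.assoc cis_mult ring_distribs)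
  then have "(LBINT \<phi>:{0..2 * pi}. T \<phi> * cis (real j * \<phi>)) = (\<Sum>n\<le>k. LBINT \<phi>:{0..2 * pi}. c n * cis ((real k - 2 * real n + real j) * \<phi>))"
    using i unfolding set_lebesgue_integral_def set_integrable_def
    by (simp only: scaleR_sum_right Bochner_Integration.integral_sum)
  also have "\<dots> = 0"
  proof (intro sum.neutral ballI)
    fix n assume n: "n \<in> {..k}"
    have "int k - 2 * int n + int j \<noteq> 0"
    proof
      assume e: "int k - 2 * int n + int j = 0"
      then have "j + k = 2 * n" by linarith
      then have "even (j + k)" by simp
      then show False using j n \<open>j + k = 2 * n\<close> by auto
    qed
    then have "real k - 2 * real n + real j \<noteq> 0" by linarith
    moreover have "real k - 2 * real n + real j \<in> \<int>" by (intro Ints_add Ints_diff Ints_mult) auto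
    ultimately show "(LBINT \<phi>:{0..2 * pi}. c n * cis ((real k - 2 * real n + real j) * \<phi>)) = 0"
      using integral_cis by simp
  qed
  finally show ?thesis .
qed

lemma cos_sin_S_angular_orth:
  assumes "j > a + b \<or> odd (j + (a + b))"
  shows "(LBINT \<phi>:{0..2 * pi}. cos \<phi> ^ a * sin \<phi> ^ b * S_angular j e \<phi>) = 0"
proof -
  let ?T = "\<lambda>\<phi>. complex_of_real (cos \<phi> ^ a * sin \<phi> ^ b) * cis (real j * \<phi>)"
  have i: "set_integrable lborel {0..2 * pi} ?T"
    by (intro borel_integrable_atLeastAtMost' continuous_intros)
  have z: "(LBINT \<phi>:{0..2 * pi}. ?T \<phi>) = 0" by (rule trig_span_orth[OF trig_span_cos_sin assms])
  have "(LBINT \<phi>:{0..2 * pi}. Re (?T \<phi>)) = 0"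
    using integral_Re[OF i[unfolded set_integrable_def]] z by (simp add: set_lebesgue_integral_def)
  moreover have "(LBINT \<phi>:{0..2 * pi}. Im (?T \<phi>)) = 0"
    using integral_Im[OF i[unfolded set_integrable_def]] z by (simp add: set_lebesgue_integral_def)
  ultimately show ?thesis by (cases "e = 0") (simp_all add: S_angular_def)
qed

section \<open>The Funk-Hecke formula\<close>

lemma set_integrable_bounded:
  fixes f :: "real \<Rightarrow> real"
  assumes "f \<in> borel_measurable borel" and "\<And>x. x \<in> {a..b} \<Longrightarrow> \<bar>f x\<bar> \<le> B"
  shows "set_integrable lborel {a..b} f"
  unfolding set_integrable_def
proof (rule Bochner_Integration.integrable_bound)
  show "integrable lborel (\<lambda>x. indicator {a..b} x *\<^sub>R B)"
    by (intro Bochner_Integration.integrable_scaleR_left integrable_real_indicator) (auto simp: emeasure_lborel_Icc_eq)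
  show "(\<lambda>x. indicator {a..b} x *\<^sub>R f x) \<in> borel_measurable lborel" using assms(1) by simp
  show "AE x in lborel. norm (indicator {a..b} x *\<^sub>R f x) \<le> norm (indicator {a..b} x *\<^sub>R B)"
  proof (intro AE_I2)
    fix x show "norm (indicator {a..b} x *\<^sub>R f x) \<le> norm (indicator {a..b} x *\<^sub>R B)"
      using assms(2)[of x] by (cases "x \<in> {a..b}") auto
  qed
qed

lemma set_integral_antisymmetric:
  fixes f :: "real \<Rightarrow> real"
  assumes "\<And>x. x \<in> {a..b} \<Longrightarrow> f (a + b - x) = - f x"
  shows "(LBINT x:{a..b}. f x) = 0"
proof -
  have "(LBINT x:{a..b}. f x) = (LINT x|lborel. indicator {a..b} (a + b + (-1) * x) *\<^sub>R f (a + b + (-1) * x))"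
    unfolding set_lebesgue_integral_def by (subst lborel_integral_real_affine[where c = "-1" and t = "a + b"]) auto
  also have "\<dots> = (LINT x|lborel. - (indicator {a..b} x *\<^sub>R f x))"
    by (intro Bochner_Integration.integral_cong refl) (auto simp: indicator_def assms)
  also have "\<dots> = - (LBINT x:{a..b}. f x)" by (simp add: set_lebesgue_integral_def)
  finally show ?thesis by simp
qed

lemma measurable_sin_weight [measurable]: "sin_weight \<mu> \<in> borel_measurable borel"
  unfolding sin_weight_def by measurable

lemma measurable_abs_weight [measurable]: "abs_weight \<mu> \<in> borel_measurable borel"
  unfolding abs_weight_def by measurable

lemma sin_weight_bounds: "\<mu> \<ge> 0 \<Longrightarrow> 0 \<le> sin_weight \<mu> \<alpha> \<and> sin_weight \<mu> \<alpha> \<le> 1"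
  by (auto simp: sin_weight_def intro!: powr_le1)

lemma abs_weight_bounds: "\<mu> \<ge> 0 \<Longrightarrow> \<bar>s\<bar> \<le> 1 \<Longrightarrow> 0 \<le> abs_weight \<mu> s \<and> abs_weight \<mu> s \<le> 1"
  by (auto simp: abs_weight_def intro!: powr_le1)

lemma set_integrable_cos_sin_weight:
  assumes "\<mu> \<ge> 0"
  shows "set_integrable lborel {a..b} (\<lambda>\<alpha>. cos \<alpha> ^ j * sin \<alpha> ^ l * sin_weight \<mu> \<alpha>)"
proof (rule set_integrable_bounded[of _ _ _ 1])
  fix \<alpha> :: real
  have "\<bar>cos \<alpha> ^ j * sin \<alpha> ^ l\<bar> \<le> 1 * 1" unfolding abs_mult power_abs
    by (intro mult_mono power_le_one) auto
  then show "\<bar>cos \<alpha> ^ j * sin \<alpha> ^ l * sin_weight \<mu> \<alpha>\<bar> \<le> 1"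
    unfolding abs_mult[of _ "sin_weight \<mu> \<alpha>"]
    using mult_mono[of "\<bar>cos \<alpha> ^ j * sin \<alpha> ^ l\<bar>" 1 "\<bar>sin_weight \<mu> \<alpha>\<bar>" 1] sin_weight_bounds[OF assms, of \<alpha>] by simp
qed measurable

text \<open>For odd l the reflection of [0, 2 pi] flips the sine. For odd j the interval is split at
  pi, because the reflections that flip the cosine and keep the sine are those of the two
  halves.\<close>

lemma cos_sin_weight_odd:
  assumes mu: "\<mu> \<ge> 0" and "odd j \<or> odd l"
  shows "(LBINT \<alpha>:{0..2 * pi}. cos \<alpha> ^ j * sin \<alpha> ^ l * sin_weight \<mu> \<alpha>) = 0"
proof (cases "odd l")
  case True
  show ?thesis
  proof (rule set_integral_antisymmetric)
    fix x :: real
    have e: "cos (0 + 2 * pi - x) = cos x" "sin (0 + 2 * pi - x) = - sin x" by (simp_all add: cos_diff sin_diff)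
    show "cos (0 + 2 * pi - x) ^ j * sin (0 + 2 * pi - x) ^ l * sin_weight \<mu> (0 + 2 * pi - x) = - (cos x ^ j * sin x ^ l * sin_weight \<mu> x)"
      unfolding sin_weight_def e using True by simp
  qed
next
  case False
  then have j: "odd j" using assms by simp
  let ?f = "\<lambda>\<alpha>. cos \<alpha> ^ j * sin \<alpha> ^ l * sin_weight \<mu> \<alpha>"
  have s: "{0..2 * pi} = {0..pi} \<union> {pi..2 * pi}" by auto
  have "(LBINT \<alpha>:{0..2 * pi}. ?f \<alpha>) = (LBINT \<alpha>:{0..pi}. ?f \<alpha>) + (LBINT \<alpha>:{pi..2 * pi}. ?f \<alpha>)"
    unfolding s
  proof (rule set_integral_Un_AE)
    show "AE x in lborel. \<not> (x \<in> {0..pi} \<and> x \<in> {pi..2 * pi})"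
      using AE_lborel_singleton[of pi] by eventually_elim auto
  qed (auto intro: set_integrable_cos_sin_weight mu)
  moreover have "(LBINT \<alpha>:{0..pi}. ?f \<alpha>) = 0"
  proof (rule set_integral_antisymmetric)
    fix x :: real
    have e: "cos (0 + pi - x) = - cos x" "sin (0 + pi - x) = sin x" by (simp_all add: cos_diff sin_diff)
    show "?f (0 + pi - x) = - ?f x" unfolding sin_weight_def e using j by simp
  qed
  moreover have "(LBINT \<alpha>:{pi..2 * pi}. ?f \<alpha>) = 0"
  proof (rule set_integral_antisymmetric)
    fix x :: real
    have "pi + 2 * pi - x = (pi - x) + 2 * pi" by simp
    then have e: "cos (pi + 2 * pi - x) = - cos x" "sin (pi + 2 * pi - x) = sin x"
      by (simp_all only: sin_periodic cos_periodic) (simp_all add: cos_diff sin_diff)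
    show "?f (pi + 2 * pi - x) = - ?f x" unfolding sin_weight_def e using j by simp
  qed
  ultimately show ?thesis by simp
qed

lemma homogeneous_rot3:
  assumes "homogeneous_poly k P" shows "homogeneous_poly k (\<lambda>x. P (rot3 \<theta> x))"
proof (rule homogeneous_compose[OF assms])
  fix i :: 3
  have "i = 1 \<or> i = 2 \<or> i = 3" using exhaust_3 by blast
  moreover have "homogeneous_poly (Suc 0) (\<lambda>x. cos \<theta> * x $ 1 + (- sin \<theta>) * x $ 2)"
     "homogeneous_poly (Suc 0) (\<lambda>x. sin \<theta> * x $ 1 + cos \<theta> * x $ 2)"
    by (intro homogeneous_add homogeneous_scale homogeneous_nth)+
  ultimately show "homogeneous_poly (Suc 0) (\<lambda>x. rot3 \<theta> x $ i)"
    using homogeneous_nth[of 3] by (auto simp: mult.commute)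
qed

text \<open>After the rotation a monomial contributes t^i (1 - t^2)^((j+l)/2) times an angular
  moment. The moment vanishes unless j and l are both even, so no half-integral power of 1 - t^2
  survives, and rounding in \<open>(j + l) div 2\<close> does no harm.\<close>

lemma circle_average_poly:
  assumes mu: "\<mu> \<ge> 0" and M: "homogeneous_poly d M"
  obtains q where "degree q \<le> d"
    "\<And>t. t \<in> {-1..1} \<Longrightarrow> (LBINT \<alpha>:{0..2 * pi}. M (circ \<theta> t \<alpha>) * sin_weight \<mu> \<alpha>) = poly q t"
proof -
  let ?I = "{(i, j, l). i + j + l = d}"
  obtain c where c: "\<And>x. M (rot3 \<theta> x) = monomial_sum ?I c x"
    using homogeneous_expand[OF homogeneous_rot3[OF M]] by blast
  define A where "A j l = (LBINT \<alpha>:{0..2 * pi}. cos \<alpha> ^ j * sin \<alpha> ^ l * sin_weight \<mu> \<alpha>)" for j l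
  define q where "q = (\<Sum>s\<in>?I. case s of (i, j, l) \<Rightarrow> smult (c i j l * A j l) (monom 1 i * [:1, 0, -1:] ^ ((j + l) div 2)))"
  show ?thesis
  proof (rule that)
    show "degree q \<le> d"
      unfolding q_def
    proof (rule degree_sum_le[OF finite_triples_eq])
      fix s assume "s \<in> ?I"
      then obtain i j l where s: "s = (i, j, l)" "i + j + l = d" by auto
      have "degree (monom 1 i * [:1, 0, -1::real:] ^ ((j + l) div 2)) \<le> i + 2 * ((j + l) div 2)"
        by (rule order.trans[OF degree_mult_le add_mono[OF degree_monom_le order.trans[OF degree_power_le]]]) simp
      also have "\<dots> \<le> d" using s by linarith
      finally show "degree (case s of (i, j, l) \<Rightarrow> smult (c i j l * A j l) (monom 1 i * [:1, 0, -1:] ^ ((j + l) div 2))) \<le> d"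
        unfolding s prod.case by (rule order.trans[OF degree_smult_le])
    qed
    fix t :: real assume t: "t \<in> {-1..1}"
    define s where "s = sqrt (1 - t\<^sup>2)"
    let ?h = "\<lambda>\<alpha> r. case r of (i, j, l) \<Rightarrow> c i j l * t ^ i * s ^ (j + l) * (cos \<alpha> ^ j * sin \<alpha> ^ l * sin_weight \<mu> \<alpha>)"
    have s2: "s\<^sup>2 = 1 - t\<^sup>2" using t by (simp add: s_def abs_square_le_1 abs_le_iff)
    have "(LBINT \<alpha>:{0..2 * pi}. M (circ \<theta> t \<alpha>) * sin_weight \<mu> \<alpha>)
      = (LBINT \<alpha>:{0..2 * pi}. (\<Sum>r\<in>?I. ?h \<alpha> r))"
      unfolding c sum_distrib_right
      by (intro arg_cong[of _ _ "\<lambda>f. set_lebesgue_integral lborel {0..2 * pi} f"] ext sum.cong refl)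
         (auto simp: s_def[symmetric] power_mult_distrib power_add)
    also have "\<dots> = (\<Sum>r\<in>?I. (LBINT \<alpha>:{0..2 * pi}. ?h \<alpha> r))"
      unfolding set_lebesgue_integral_def scaleR_sum_right
      by (rule Bochner_Integration.integral_sum)
         (use set_integrable_cos_sin_weight[OF mu] in \<open>auto simp: split_beta set_integrable_def[symmetric] simp del: real_scaleR_def
           intro!: set_integrable_mult_right\<close>)
    also have "\<dots> = poly q t"
      unfolding q_def poly_sum
    proof (intro sum.cong refl)
      fix r assume "r \<in> ?I"
      then obtain i j l where r: "r = (i, j, l)" "i + j + l = d" by auto
      have "s ^ (j + l) * A j l = (1 - t\<^sup>2) ^ ((j + l) div 2) * A j l"
      proof (cases "odd j \<or> odd l")
        case True
        then have "A j l = 0" unfolding A_def by (rule cos_sin_weight_odd[OF mu])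
        then show ?thesis by simp
      next
        case False
        then have "j + l = 2 * ((j + l) div 2)" by auto
        then have "s ^ (j + l) = (s\<^sup>2) ^ ((j + l) div 2)" by (metis power_mult)
        then show ?thesis using s2 by simp
      qed
      then show "(LBINT \<alpha>:{0..2 * pi}. ?h \<alpha> r) =
         poly (case r of (i, j, l) \<Rightarrow> smult (c i j l * A j l) (monom 1 i * [:1, 0, -1:] ^ ((j + l) div 2))) t"
        unfolding r prod.case by (simp add: A_def[symmetric] poly_monom power2_eq_square[symmetric])
    qed
    finally show "(LBINT \<alpha>:{0..2 * pi}. M (circ \<theta> t \<alpha>) * sin_weight \<mu> \<alpha>) = poly q t" .
  qed
qed

lemma poly_degree_less_homogeneous:
  assumes "homogeneous_poly i P" "i < k" shows "poly_degree_less k P"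
proof -
  obtain c where c: "\<And>x. P x = (\<Sum>(i', j, l)\<in>{(i', j, l). i' + j + l = i}. c i' j l * x $ 1 ^ i' * x $ 2 ^ j * x $ 3 ^ l)"
    using homogeneous_expand[OF assms(1)] by blast
  show ?thesis unfolding c[abs_def]
    by (rule poly_degree_less_sum) (use assms(2) in \<open>auto intro!: poly_degree_less_monomial\<close>)
qed

section \<open>Zonal functions and slicing along an equatorial axis\<close>

definition equator_point :: "real \<Rightarrow> real^3" where
  "equator_point \<theta> = vector [cos \<theta>, sin \<theta>, 0]"

definition zonal :: "real \<Rightarrow> real poly \<Rightarrow> real^3 \<Rightarrow> real" where
  "zonal \<theta> p x = poly p (x $ 1 * cos \<theta> + x $ 2 * sin \<theta>)"

lemma zonal_continuous: "continuous_on A (zonal \<theta> p)"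
  unfolding zonal_def by (intro continuous_intros)

lemma zonal_rot3: "zonal \<theta> p (circ \<theta> t \<alpha>) = poly p t"
proof -
  let ?s = "sqrt (1 - t\<^sup>2) * cos \<alpha>"
  have "(t * cos \<theta> - ?s * sin \<theta>) * cos \<theta> + (t * sin \<theta> + ?s * cos \<theta>) * sin \<theta> = t * ((sin \<theta>)\<^sup>2 + (cos \<theta>)\<^sup>2)"
    by algebra
  then show ?thesis by (simp add: zonal_def)
qed

lemma homogeneous_equatorial:
  "homogeneous_poly (Suc 0) (\<lambda>x. x $ 1 * cos \<theta> + x $ 2 * sin \<theta>)"
  using homogeneous_add[OF homogeneous_scale[OF homogeneous_nth[of 1], of "cos \<theta>"]
      homogeneous_scale[OF homogeneous_nth[of 2], of "sin \<theta>"]]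
  by (simp add: mult.commute)

lemma zonal_poly_degree_less:
  assumes "degree p < k" shows "poly_degree_less k (zonal \<theta> p)"
proof -
  have "poly_degree_less k (\<lambda>x. \<Sum>i\<le>degree p. coeff p i * (x $ 1 * cos \<theta> + x $ 2 * sin \<theta>) ^ i)"
  proof (rule poly_degree_less_sum)
    fix i assume "i \<in> {..degree p}"
    then have "i < k" using assms by simp
    moreover have "homogeneous_poly i (\<lambda>x. coeff p i * (x $ 1 * cos \<theta> + x $ 2 * sin \<theta>) ^ i)"
      using homogeneous_scale[OF homogeneous_power[OF homogeneous_equatorial, of i]] by simp
    ultimately show "poly_degree_less k (\<lambda>x. coeff p i * (x $ 1 * cos \<theta> + x $ 2 * sin \<theta>) ^ i)"
      by (rule poly_degree_less_homogeneous[rotated])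
  qed
  then show ?thesis by (simp add: zonal_def[abs_def] poly_altdef)
qed

text \<open>Endpoints must be ignored because factors such as \<open>(1 - u) powr 0\<close> take the
  value 0 there instead of 1.\<close>

lemma set_integral_interior_cong:
  fixes f g :: "real \<Rightarrow> real"
  assumes "set_borel_measurable lborel {a..b} f" "set_borel_measurable lborel {a..b} g"
    and "\<And>x. a < x \<Longrightarrow> x < b \<Longrightarrow> f x = g x"
  shows "(LBINT x:{a..b}. f x) = (LBINT x:{a..b}. g x)"
  unfolding set_lebesgue_integral_def
proof (rule integral_cong_AE)
  show "AE x in lborel. indicator {a..b} x *\<^sub>R f x = indicator {a..b} x *\<^sub>R g x"
    using AE_lborel_singleton[of a] AE_lborel_singleton[of b]
    by eventually_elim (auto simp: indicator_def assms(3))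
qed (use assms in \<open>auto simp: set_borel_measurable_def\<close>)

text \<open>A zonal function is constant on each slice and leaves the inner integral together with
  the factor \<open>(1 - t\<^sup>2) powr \<mu>\<close> of the weight; the rest is the circle average
  of \<open>M\<close>.\<close>

lemma sphere_inner_zonal:
  assumes mu: "\<mu> \<ge> 0" and M: "continuous_on UNIV M"
    and q: "\<And>t. t \<in> {-1..1} \<Longrightarrow> (LBINT \<alpha>:{0..2 * pi}. M (circ \<theta> t \<alpha>) * sin_weight \<mu> \<alpha>) = poly q t"
  shows "sphere_inner \<mu> (zonal \<theta> p) M = (LBINT t:{-1..1}. poly p t * poly q t * (1 - t\<^sup>2) powr \<mu>)"
proof -
  let ?F = "\<lambda>t. (LBINT \<alpha>:{0..2 * pi}. zonal \<theta> p (circ \<theta> t \<alpha>) * M (circ \<theta> t \<alpha>) * sphere_weight \<mu> (circ \<theta> t \<alpha>))"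
  have F: "?F t = poly p t * poly q t * (1 - t\<^sup>2) powr \<mu>" if "-1 < t" "t < 1" for t
  proof -
    have "\<bar>t\<bar> < 1" using that by auto
    then have "?F t = (LBINT \<alpha>:{0..2 * pi}. (poly p t * (1 - t\<^sup>2) powr \<mu>) * (M (circ \<theta> t \<alpha>) * sin_weight \<mu> \<alpha>))"
      by (simp add: sphere_weight_rot3 zonal_rot3 mult_ac)
    also have "\<dots> = (poly p t * (1 - t\<^sup>2) powr \<mu>) * poly q t" using q that by simp
    finally show ?thesis by simp
  qed
  have "sphere_inner \<mu> (zonal \<theta> p) M = (LBINT t:{-1..1}. ?F t)"
    unfolding sphere_inner_def
    by (rule sphere_integral_iterated(1)[OF orthogonal_rot3 integrable_sphere_continuous2[OF zonal_continuous M mu]])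
  also have "\<dots> = (LBINT t:{-1..1}. poly p t * poly q t * (1 - t\<^sup>2) powr \<mu>)"
  proof (rule set_integral_interior_cong)
    show "set_borel_measurable lborel {-1..1} ?F"
      using sphere_integral_iterated(2)[OF orthogonal_rot3 integrable_sphere_continuous2[OF zonal_continuous M mu]]
      unfolding set_integrable_def set_borel_measurable_def by (rule borel_measurable_integrable)
    have [measurable]: "poly r \<in> borel_measurable borel" for r :: "real poly"
      by (intro borel_measurable_continuous_onI continuous_intros)
    show "set_borel_measurable lborel {-1..1} (\<lambda>t. poly p t * poly q t * (1 - t\<^sup>2) powr \<mu>)"
      unfolding set_borel_measurable_def by measurable
  qed (rule F)
  finally show ?thesis .
qed


lemma set_integrable_abs_weight_monomial:
  assumes mu: "\<mu> \<ge> 0"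
  shows "set_integrable lborel {-1..1} (\<lambda>s. (s\<^sup>2) ^ i * abs_weight \<mu> s)"
proof (rule set_integrable_bounded[of _ _ _ 1])
  fix s :: real assume "s \<in> {-1..1}"
  then have s: "\<bar>s\<bar> \<le> 1" by auto
  then have "\<bar>(s\<^sup>2) ^ i\<bar> \<le> 1" by (simp add: power_le_one abs_square_le_1)
  then show "\<bar>(s\<^sup>2) ^ i * abs_weight \<mu> s\<bar> \<le> 1"
    unfolding abs_mult using mult_mono[of "\<bar>(s\<^sup>2) ^ i\<bar>" 1 "\<bar>abs_weight \<mu> s\<bar>" 1] abs_weight_bounds[OF mu s] by simp
qed measurable

lemma abs_weight_monomial:
  assumes mu: "\<mu> \<ge> 0"
  shows "(LBINT s:{-1..1}. (s\<^sup>2) ^ i * abs_weight \<mu> s) = 1 / (real i + \<mu> + 1/2)"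
proof -
  let ?f = "\<lambda>s. (s\<^sup>2) ^ i * abs_weight \<mu> s"
  have p: "((\<lambda>s. s powr (2 * real i + 2 * \<mu>)) has_integral 1 powr (2 * real i + 2 * \<mu> + 1) / (2 * real i + 2 * \<mu> + 1)) {0..1}"
    using mu by (intro has_integral_powr_from_0) auto
  \<comment> \<open>The point 0 is removed because for i = 0 and \<mu> = 0 the integrand is 1 there,
    whereas \<open>0 powr 0 = 0\<close>.\<close>
  have h1: "(?f has_integral 1 / (2 * real i + 2 * \<mu> + 1)) {0..1}"
  proof (rule has_integral_spike_finite[of "{0}"])
    fix s :: real assume s: "s \<in> {0..1} - {0}"
    then have "(s\<^sup>2) ^ i = s powr (2 * real i)"
      using powr_realpow[of s "2 * i"] by (simp add: power_mult)
    then show "?f s = s powr (2 * real i + 2 * \<mu>)" using s by (simp add: abs_weight_def powr_add)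
  qed (use p in auto)
  have ev: "(\<lambda>s. ?f (- s)) = ?f" by (simp add: abs_weight_def fun_eq_iff)
  have "((\<lambda>s. ?f (- s)) has_integral 1 / (2 * real i + 2 * \<mu> + 1)) {-1..-0}"
    using h1 has_integral_reflect_real[of ?f "1 / (2 * real i + 2 * \<mu> + 1)" 1 0] by simp
  then have "(?f has_integral 1 / (2 * real i + 2 * \<mu> + 1)) {-1..0}" unfolding ev by simp
  then have "(?f has_integral 1 / (2 * real i + 2 * \<mu> + 1) + 1 / (2 * real i + 2 * \<mu> + 1)) {-1..1}"
    using h1 by (intro has_integral_combine[of "-1" 0 1]) auto
  moreover have "1 / (2 * real i + 2 * \<mu> + 1) + 1 / (2 * real i + 2 * \<mu> + 1) = 1 / (real i + \<mu> + 1/2)"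
    using mu by (simp add: field_simps)
  ultimately show ?thesis using set_borel_integral_eq_integral(2)[OF set_integrable_abs_weight_monomial[OF mu]] by (simp add: integral_unique)
qed

text \<open>The agreement with \<open>abs_weight_monomial\<close> expresses the substitution u = s^2
  on monomials.\<close>

lemma powr_monomial_01:
  assumes "\<mu> \<ge> 0"
  shows "(LBINT u:{0..1}. u ^ i * u powr (\<mu> - 1/2)) = 1 / (real i + \<mu> + 1/2)"
proof -
  have "(LBINT u:{0..1}. u ^ i * u powr (\<mu> - 1/2)) = (LBINT u:{0..1}. u powr (\<mu> - 1/2 + real i) * (1 - u) powr 0)"
  proof (rule set_integral_interior_cong)
    show "set_borel_measurable lborel {0..1} (\<lambda>u::real. u ^ i * u powr (\<mu> - 1/2))"
      "set_borel_measurable lborel {0..1} (\<lambda>u::real. u powr (\<mu> - 1/2 + real i) * (1 - u) powr 0)"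
      unfolding set_borel_measurable_def by measurable
  qed (auto simp: powr_add powr_realpow)
  also have "\<dots> = Beta (\<mu> - 1/2 + real i + 1) (0 + 1)"
    using assms by (intro beta_set_integrable(2)) auto
  also have "\<dots> = 1 / (real i + \<mu> + 1/2)"
  proof -
    define z where "z = \<mu> - 1/2 + real i + 1"
    have pos: "z > 0" using assms by (simp add: z_def)
    then have "z \<notin> \<int>\<^sub>\<le>\<^sub>0" by (auto simp only: nonpos_Ints_def mem_Collect_eq not_less)
    then have "Beta z (0 + 1) = 1 / z"
      using Gamma_plus1[of z] less_imp_neq[OF Gamma_real_pos[OF pos]] pos by (simp add: Beta_def)
    then show ?thesis by (simp add: z_def algebra_simps)
  qed
  finally show ?thesis .
qed


lemma sphere_inner_cong:
  assumes "\<And>x. x \<in> sphere 0 1 \<Longrightarrow> f x = f' x" "\<And>x. x \<in> sphere 0 1 \<Longrightarrow> g x = g' x"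
  shows "sphere_inner \<mu> f g = sphere_inner \<mu> f' g'"
  unfolding sphere_inner_def by (intro Bochner_Integration.integral_cong) (auto simp: assms)

lemma sphere_total_weight:
  assumes mu: "\<mu> \<ge> 0"
  shows "(LINT x|sphere_measure. sphere_weight \<mu> x) = 2 * pi / (\<mu> + 1/2)"
proof -
  have "integrable sphere_measure (\<lambda>x. sphere_weight \<mu> x)"
    using integrable_sphere_continuous[of "\<lambda>_. 1" \<mu>] mu by simp
  from sphere_integral_iterated(1)[OF orthogonal_cycle3 this]
  have "(LINT x|sphere_measure. sphere_weight \<mu> x) = (LBINT t:{-1..1}. (LBINT \<alpha>:{0..2 * pi}. abs_weight \<mu> t))"
    by (simp add: sphere_weight_cycle3)
  also have "\<dots> = (LBINT t:{-1..1}. 2 * pi * ((t\<^sup>2) ^ 0 * abs_weight \<mu> t))"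
    by (simp add: set_lebesgue_integral_def mult_ac)
  also have "\<dots> = 2 * pi * (1 / (real 0 + \<mu> + 1/2))"
    unfolding set_integral_mult_right abs_weight_monomial[OF mu] ..
  finally show ?thesis by simp
qed

text \<open>Both sides are the total weight of the sphere, sliced along an equatorial axis on the
  left and along the third axis on the right. The product is all that the Funk-Hecke constant
  requires, so neither factor has to be evaluated.\<close>

lemma circle_weight_constant:
  assumes mu: "\<mu> \<ge> 0"
  shows "(LBINT \<alpha>:{0..2 * pi}. sin_weight \<mu> \<alpha>) * (LBINT t:{-1..1}. (1 - t\<^sup>2) powr \<mu>) = 2 * pi / (\<mu> + 1/2)"
proof -
  define B where "B = (LBINT \<alpha>:{0..2 * pi}. sin_weight \<mu> \<alpha>)"
  have "sphere_inner \<mu> (zonal 0 1) (\<lambda>_. 1) = (LBINT t:{-1..1}. poly 1 t * poly [:B:] t * (1 - t\<^sup>2) powr \<mu>)"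
    by (rule sphere_inner_zonal[OF mu]) (auto simp: B_def)
  then have "sphere_inner \<mu> (zonal 0 1) (\<lambda>_. 1) = B * (LBINT t:{-1..1}. (1 - t\<^sup>2) powr \<mu>)" by simp
  then show ?thesis using sphere_total_weight[OF mu] by (simp add: sphere_inner_def zonal_def B_def)
qed

text \<open>The average of \<open>h\<close> over the circles is a polynomial in t of degree at most
  k, and orthogonality of \<open>h\<close> to zonal polynomials of lower degree makes it a multiple
  of C_k. The multiple is found at t = 1, where the circle shrinks to the point at angle \<theta>.
  The norm of C_k and the total weight then give the constant.\<close>

lemma funk_hecke:
  assumes mu: "\<mu> \<ge> 0" and h: "h \<in> harmonic_space \<mu> k"
  shows "sphere_inner \<mu> (zonal \<theta> (geg \<mu> k)) h = h (equator_point \<theta>) * (2 * pi / (real k + \<mu> + 1/2))"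
proof -
  let ?G = "geg \<mu> k"
  have m: "\<mu> > -1/2" using mu by simp
  note hp = harmonic_space_homogeneous[OF h] and hc = harmonic_space_continuous[OF h, of UNIV]
  obtain q where q: "degree q \<le> k"
    "\<And>t. t \<in> {-1..1} \<Longrightarrow> (LBINT \<alpha>:{0..2 * pi}. h (circ \<theta> t \<alpha>) * sin_weight \<mu> \<alpha>) = poly q t"
    using circle_average_poly[OF mu hp] by blast
  have "(LBINT s:{-1..1}. poly q s * poly p s * (1 - s\<^sup>2) powr \<mu>) = 0" if "degree p < k" for p
  proof -
    have "sphere_inner \<mu> h (zonal \<theta> p) = 0"
      using h zonal_poly_degree_less[OF that] by (simp add: harmonic_space_def)
    then show ?thesis
      using sphere_inner_zonal[OF mu hc q(2), where p = p] by (simp add: sphere_inner_commute[of \<mu> h] mult_ac)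
  qed
  from gegenbauer_unique[OF m q(1) this] have qG: "q = smult (poly q 1 / poly ?G 1) ?G" by blast
  have "rot3 \<theta> (sph_point 1 \<alpha>) = equator_point \<theta>" for \<alpha> by (simp add: vec3_eq_iff equator_point_def)
  then have q1: "poly q 1 = h (equator_point \<theta>) * (LBINT \<alpha>:{0..2 * pi}. sin_weight \<mu> \<alpha>)"
    using q(2)[of 1] by simp
  have "sphere_inner \<mu> (zonal \<theta> ?G) h = (LBINT t:{-1..1}. poly ?G t * poly q t * (1 - t\<^sup>2) powr \<mu>)"
    by (rule sphere_inner_zonal[OF mu hc q(2)])
  also have "\<dots> = poly q 1 / poly ?G 1 * (LBINT t:{-1..1}. poly ?G t * poly ?G t * (1 - t\<^sup>2) powr \<mu>)"
    by (subst qG) (simp add: mult_ac flip: set_integral_mult_right)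
  also have "\<dots> = poly q 1 * ((\<mu> + 1/2) / (real k + \<mu> + 1/2)) * (LBINT s:{-1..1}. (1 - s\<^sup>2) powr \<mu>)"
    unfolding gegenbauer_sqnorm[OF m] using gegenbauer_at_1[OF m, of k] by simp
  also have "\<dots> = h (equator_point \<theta>) * ((\<mu> + 1/2) / (real k + \<mu> + 1/2)) *
     ((LBINT \<alpha>:{0..2 * pi}. sin_weight \<mu> \<alpha>) * (LBINT s:{-1..1}. (1 - s\<^sup>2) powr \<mu>))"
    unfolding q1 by (simp only: mult_ac)
  also have "\<dots> = h (equator_point \<theta>) * (2 * pi / (real k + \<mu> + 1/2))"
    unfolding circle_weight_constant[OF mu] using mu by simp
  finally show ?thesis .
qed

text \<open>The zonal Gegenbauer function, with terms of lower degree multiplied by powers of |x|^2,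
  which is 1 on the sphere. By parity k - i is even whenever the coefficient is nonzero, so the
  division is exact.\<close>

definition zonal_harmonic :: "real \<Rightarrow> nat \<Rightarrow> real \<Rightarrow> real^3 \<Rightarrow> real" where
  "zonal_harmonic \<mu> k \<theta> x = (\<Sum>i\<le>k. coeff (geg \<mu> k) i * (x $ 1 * cos \<theta> + x $ 2 * sin \<theta>) ^ i *
     ((x $ 1)\<^sup>2 + (x $ 2)\<^sup>2 + (x $ 3)\<^sup>2) ^ ((k - i) div 2))"

lemma zonal_harmonic_sphere:
  assumes mu: "\<mu> \<ge> 0" and x: "x \<in> sphere 0 1"
  shows "zonal_harmonic \<mu> k \<theta> x = zonal \<theta> (geg \<mu> k) x"
proof -
  have "(x $ 1)\<^sup>2 + (x $ 2)\<^sup>2 + (x $ 3)\<^sup>2 = 1" using x norm_vec3_sq[of x] by simp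
  then show ?thesis using gegenbauer_degree[of \<mu> k] mu
    by (simp add: zonal_harmonic_def zonal_def poly_altdef)
qed

lemma gegenbauer_coeff_parity:
  assumes mu: "\<mu> \<ge> 0" and "odd (k + i)"
  shows "coeff (geg \<mu> k) i = 0"
proof -
  let ?G = "geg \<mu> k"
  have "?G \<circ>\<^sub>p [:0, -1:] = smult ((-1) ^ k) ?G"
    using gegenbauer_minus[of \<mu> k] mu by (intro poly_eq_poly_eq_iff[THEN iffD1] ext) (simp add: poly_pcompose)
  from arg_cong[OF this, of "\<lambda>p. coeff p i"] have "(-1) ^ i * coeff ?G i = (-1) ^ k * coeff ?G i"
    by (simp add: coeff_pcompose_linear)
  moreover have "(-1::real) ^ i = - ((-1) ^ k)" using assms(2) by (cases "even k") auto
  ultimately have "(-1) ^ k * coeff ?G i = 0" by simp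
  then show ?thesis by simp
qed

lemma homogeneous_norm_sq: "homogeneous_poly 2 (\<lambda>x. (x $ 1)\<^sup>2 + (x $ 2)\<^sup>2 + (x $ 3)\<^sup>2)"
proof -
  have "homogeneous_poly (Suc 0 * 2) (\<lambda>x. (x $ i)\<^sup>2)" for i
    by (rule homogeneous_power[OF homogeneous_nth])
  then have "homogeneous_poly 2 (\<lambda>x. (x $ i)\<^sup>2)" for i by simp
  then show ?thesis by (intro homogeneous_add)
qed

text \<open>A monomial of degree below k has a circle average of degree below k in t, and C_k is
  orthogonal to it.\<close>

lemma zonal_harmonic_mem:
  assumes mu: "\<mu> \<ge> 0"
  shows "zonal_harmonic \<mu> k \<theta> \<in> harmonic_space \<mu> k"
proof (rule harmonic_spaceI[OF mu])
  show "homogeneous_poly k (zonal_harmonic \<mu> k \<theta>)"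
    unfolding zonal_harmonic_def[abs_def]
  proof (rule homogeneous_sum)
    fix i assume i: "i \<in> {..k}"
    show "homogeneous_poly k (\<lambda>x. coeff (geg \<mu> k) i * (x $ 1 * cos \<theta> + x $ 2 * sin \<theta>) ^ i *
     ((x $ 1)\<^sup>2 + (x $ 2)\<^sup>2 + (x $ 3)\<^sup>2) ^ ((k - i) div 2))"
    proof (cases "odd (k + i)")
      case True
      then show ?thesis by (simp add: gegenbauer_coeff_parity[OF mu] homogeneous_zero)
    next
      case False
      then have k: "k = Suc 0 * i + 2 * ((k - i) div 2)" using i by auto
      show ?thesis
        by (subst k) (intro homogeneous_mult homogeneous_scale homogeneous_power homogeneous_equatorial homogeneous_norm_sq)
    qed
  qed
  fix a b c :: nat assume abc: "a + b + c < k"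
  let ?M = "\<lambda>x::real^3. x $ 1 ^ a * x $ 2 ^ b * x $ 3 ^ c"
  have M: "homogeneous_poly (a + b + c) ?M"
    using homogeneous_monomial[of a b c "a + b + c" 1] by simp
  obtain q where q: "degree q \<le> a + b + c"
    "\<And>t. t \<in> {-1..1} \<Longrightarrow> (LBINT \<alpha>:{0..2 * pi}. ?M (circ \<theta> t \<alpha>) * sin_weight \<mu> \<alpha>) = poly q t"
    using circle_average_poly[OF mu M] by blast
  have "sphere_inner \<mu> (zonal_harmonic \<mu> k \<theta>) ?M = sphere_inner \<mu> (zonal \<theta> (geg \<mu> k)) ?M"
    by (intro sphere_inner_cong) (auto simp: zonal_harmonic_sphere[OF mu])
  also have "\<dots> = (LBINT t:{-1..1}. poly (geg \<mu> k) t * poly q t * (1 - t\<^sup>2) powr \<mu>)"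
    by (rule sphere_inner_zonal[OF mu homogeneous_continuous[OF M] q(2)])
  also have "\<dots> = 0" using q(1) abc mu by (intro gegenbauer_orth) auto
  finally show "sphere_inner \<mu> (zonal_harmonic \<mu> k \<theta>) ?M = 0" .
qed

lemma zonal_harmonic_reflect: "zonal_harmonic \<mu> k \<theta> (reflect3 x) = zonal_harmonic \<mu> k \<theta> x"
  by (simp add: zonal_harmonic_def)

lemma zonal_harmonic_reproducing:
  assumes mu: "\<mu> \<ge> 0" and h: "h \<in> harmonic_space \<mu> k"
  shows "sphere_inner \<mu> (zonal_harmonic \<mu> k \<theta>) h = h (equator_point \<theta>) * (2 * pi / (real k + \<mu> + 1/2))"
  unfolding funk_hecke[OF assms, symmetric] by (intro sphere_inner_cong) (auto simp: zonal_harmonic_sphere[OF mu])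

section \<open>The disk basis as functions on the sphere\<close>

text \<open>The substitution \<open>u = s\<^sup>2\<close>, obtained by comparing both sides on monomials.\<close>

lemma abs_weight_poly:
  assumes mu: "\<mu> \<ge> 0"
  shows "(LBINT s:{-1..1}. poly R (s\<^sup>2) * abs_weight \<mu> s) = (LBINT u:{0..1}. poly R u * u powr (\<mu> - 1/2))"
proof -
  have i1: "set_integrable lborel {-1..1} (\<lambda>s. coeff R i * ((s\<^sup>2) ^ i * abs_weight \<mu> s))" for i
    by (intro set_integrable_mult_right set_integrable_abs_weight_monomial mu)
  have "set_integrable lborel {0..1::real} (\<lambda>u. u powr (\<mu> - 1/2) * (1 - u) powr 0)"
    using mu by (intro beta_set_integrable(1)) auto
  \<comment> \<open>At u = 1 the factor \<open>(1 - u) powr 0\<close> is 0, so the Beta integrand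
    with second exponent 0 agrees with the power of u only almost everywhere.\<close>
  moreover have "indicator {0..1} u *\<^sub>R (u powr (\<mu> - 1/2) * (1 - u) powr 0) = indicator {0..1} u *\<^sub>R (u powr (\<mu> - 1/2))" if "u \<noteq> 1" for u :: real
    using that by (simp add: indicator_def)
  then have "AE u in lborel. indicator {0..1} u *\<^sub>R (u powr (\<mu> - 1/2) * (1 - u) powr 0) = indicator {0..1} u *\<^sub>R (u powr (\<mu> - 1/2))"
    using AE_lborel_singleton[of "1::real"] by (rule eventually_mono[rotated])
  ultimately have "set_integrable lborel {0..1::real} (\<lambda>u. u powr (\<mu> - 1/2))"
    unfolding set_integrable_def by (subst (asm) integrable_cong_AE) auto
  then have i2: "set_integrable lborel {0..1::real} (\<lambda>u. coeff R i * (u ^ i * u powr (\<mu> - 1/2)))" for i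
    using set_integrable_poly_weight[of 0 1 "\<lambda>u. u powr (\<mu> - 1/2)" "monom 1 i"] by (simp add: poly_monom)
  have "(LBINT s:{-1..1}. poly R (s\<^sup>2) * abs_weight \<mu> s) = (LBINT s:{-1..1}. (\<Sum>i\<le>degree R. coeff R i * ((s\<^sup>2) ^ i * abs_weight \<mu> s)))"
    by (simp add: poly_altdef sum_distrib_right mult.assoc)
  also have "\<dots> = (\<Sum>i\<le>degree R. LBINT s:{-1..1}. coeff R i * ((s\<^sup>2) ^ i * abs_weight \<mu> s))"
    using i1 unfolding set_lebesgue_integral_def set_integrable_def scaleR_sum_right by (rule Bochner_Integration.integral_sum)
  also have "\<dots> = (\<Sum>i\<le>degree R. LBINT u:{0..1}. coeff R i * (u ^ i * u powr (\<mu> - 1/2)))"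
    unfolding set_integral_mult_right abs_weight_monomial[OF mu] powr_monomial_01[OF mu] ..
  also have "\<dots> = (LBINT u:{0..1}. (\<Sum>i\<le>degree R. coeff R i * (u ^ i * u powr (\<mu> - 1/2))))"
    using i2 unfolding set_lebesgue_integral_def set_integrable_def scaleR_sum_right by (rule Bochner_Integration.integral_sum[symmetric])
  also have "\<dots> = (LBINT u:{0..1}. poly R u * u powr (\<mu> - 1/2))"
    by (simp add: poly_altdef sum_distrib_right mult.assoc)
  finally show ?thesis .
qed

text \<open>The homogeneous extension of a disk basis function without the factor
  \<open>h_coeff\<close>. On the sphere the Jacobi argument 2 r^2 - 1 is x_1^2 + x_2^2 - x_3^2, the
  missing degrees are filled with |x|^2, and the angular part is the real or imaginary part of (x_1
  + i x_2)^(k-2l).\<close>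

definition ball_harmonic :: "real \<Rightarrow> nat \<Rightarrow> nat \<Rightarrow> nat \<Rightarrow> real^3 \<Rightarrow> real" where
  "ball_harmonic \<mu> k l e x =
     (\<Sum>i\<le>l. coeff (jacobi_orthonormal l (\<mu> - 1/2) (real (k - 2 * l))) i *
        ((x $ 1)\<^sup>2 + (x $ 2)\<^sup>2 - (x $ 3)\<^sup>2) ^ i * ((x $ 1)\<^sup>2 + (x $ 2)\<^sup>2 + (x $ 3)\<^sup>2) ^ (l - i)) *
     (if e = 0 then Re (Complex (x $ 1) (x $ 2) ^ (k - 2 * l)) else Im (Complex (x $ 1) (x $ 2) ^ (k - 2 * l)))"

lemma degree_jacobi_orthonormal:
  assumes "\<alpha> > -1" "\<beta> > -1" shows "degree (jacobi_orthonormal n \<alpha> \<beta>) = n"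
  using jacobi_sqnorm_pos[OF assms, of n] by (simp add: jacobi_orthonormal_eq[OF assms] jacobi_std_degree[OF assms])

lemma S_angular_rcis:
  "(if e = 0 then Re (rcis r \<phi> ^ j) else Im (rcis r \<phi> ^ j)) = r ^ j * S_angular j e \<phi>"
  by (simp add: S_angular_def DeMoivre2)

lemma disk_basis_eq_ball_harmonic:
  assumes mu: "\<mu> \<ge> 0" and x: "x \<in> sphere 0 1"
  shows "disk_basis \<mu> k l e (x $ 1) (x $ 2) = h_coeff \<mu> l k * ball_harmonic \<mu> k l e x"
proof -
  let ?P = "jacobi_orthonormal l (\<mu> - 1/2) (real (k - 2 * l))"
  define r where "r = sqrt ((x $ 1)\<^sup>2 + (x $ 2)\<^sup>2)"
  have n: "(x $ 1)\<^sup>2 + (x $ 2)\<^sup>2 + (x $ 3)\<^sup>2 = 1" using x norm_vec3_sq[of x] by simp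
  have r2: "r\<^sup>2 = (x $ 1)\<^sup>2 + (x $ 2)\<^sup>2" by (simp add: r_def)
  have "degree ?P = l" using mu by (intro degree_jacobi_orthonormal) auto
  moreover have "2 * r\<^sup>2 - 1 = (x $ 1)\<^sup>2 + (x $ 2)\<^sup>2 - (x $ 3)\<^sup>2" using n r2 by simp
  ultimately have P: "poly ?P (2 * r\<^sup>2 - 1) = (\<Sum>i\<le>l. coeff ?P i *
        ((x $ 1)\<^sup>2 + (x $ 2)\<^sup>2 - (x $ 3)\<^sup>2) ^ i * ((x $ 1)\<^sup>2 + (x $ 2)\<^sup>2 + (x $ 3)\<^sup>2) ^ (l - i))"
    unfolding n by (simp add: poly_altdef)
  let ?z = "Complex (x $ 1) (x $ 2)"
  have "cmod ?z = r" by (simp add: r_def cmod_def)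
  then have z: "?z = rcis r (Arg ?z)" using rcis_cmod_Arg[of ?z] by simp
  have S: "(if e = 0 then Re (?z ^ (k - 2 * l)) else Im (?z ^ (k - 2 * l))) = r ^ (k - 2 * l) * S_angular (k - 2 * l) e (Arg ?z)"
    unfolding S_angular_rcis[symmetric] z[symmetric] ..
  show ?thesis
    unfolding disk_basis_def ball_harmonic_def Let_def S r_def[symmetric] P[symmetric] by (simp only: mult.assoc)
qed

lemma ball_harmonic_cycle3:
  assumes mu: "\<mu> \<ge> 0" and s: "s \<in> {-1..1}"
  shows "ball_harmonic \<mu> k l e (cycle3 (sph_point s \<phi>)) =
    poly (jacobi_orthonormal l (\<mu> - 1/2) (real (k - 2 * l))) (1 - 2 * s\<^sup>2) * sqrt (1 - s\<^sup>2) ^ (k - 2 * l) * S_angular (k - 2 * l) e \<phi>"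
proof -
  let ?P = "jacobi_orthonormal l (\<mu> - 1/2) (real (k - 2 * l))"
  have d: "degree ?P = l" using mu by (intro degree_jacobi_orthonormal) auto
  have s2: "(sqrt (1 - s\<^sup>2))\<^sup>2 = 1 - s\<^sup>2" using s by (simp add: abs_square_le_1 abs_le_iff)
  have e: "(sqrt (1 - s\<^sup>2) * cos \<phi>)\<^sup>2 + (sqrt (1 - s\<^sup>2) * sin \<phi>)\<^sup>2 = 1 - s\<^sup>2"
    unfolding power_mult_distrib s2 by (simp flip: distrib_left)
  have e1: "1 - s\<^sup>2 - s\<^sup>2 = 1 - 2 * s\<^sup>2" "1 - s\<^sup>2 + s\<^sup>2 = 1" by auto
  have z: "Complex (sqrt (1 - s\<^sup>2) * cos \<phi>) (sqrt (1 - s\<^sup>2) * sin \<phi>) = rcis (sqrt (1 - s\<^sup>2)) \<phi>"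
    by (simp add: complex_eq_iff)
  show ?thesis
    unfolding ball_harmonic_def cycle3_nth sph_point_nth e e1 z S_angular_rcis
    by (simp add: poly_altdef d)
qed

lemma homogeneous_ball_harmonic:
  assumes "2 * l \<le> k" shows "homogeneous_poly k (ball_harmonic \<mu> k l e)"
proof -
  have sq: "homogeneous_poly 2 (\<lambda>x. (x $ i)\<^sup>2)" for i
    using homogeneous_power[OF homogeneous_nth, of 2 i] by (simp add: numeral_2_eq_2)
  have d: "homogeneous_poly 2 (\<lambda>x. (x $ 1)\<^sup>2 + (x $ 2)\<^sup>2 - (x $ 3)\<^sup>2)"
    using homogeneous_add[OF homogeneous_add[OF sq[of 1] sq[of 2]] homogeneous_scale[OF sq[of 3], of "-1"]] by simp
  have rad: "homogeneous_poly (2 * l) (\<lambda>x. \<Sum>i\<le>l. coeff P i * ((x $ 1)\<^sup>2 + (x $ 2)\<^sup>2 - (x $ 3)\<^sup>2) ^ i *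
       ((x $ 1)\<^sup>2 + (x $ 2)\<^sup>2 + (x $ 3)\<^sup>2) ^ (l - i))" for P :: "real poly"
  proof (rule homogeneous_sum)
    fix i assume "i \<in> {..l}"
    then have l: "2 * l = 2 * i + 2 * (l - i)" by simp
    show "homogeneous_poly (2 * l) (\<lambda>x. coeff P i * ((x $ 1)\<^sup>2 + (x $ 2)\<^sup>2 - (x $ 3)\<^sup>2) ^ i *
       ((x $ 1)\<^sup>2 + (x $ 2)\<^sup>2 + (x $ 3)\<^sup>2) ^ (l - i))"
      by (subst l) (intro homogeneous_mult homogeneous_scale homogeneous_power d homogeneous_norm_sq)
  qed
  have ang: "homogeneous_poly j (\<lambda>x. Re (Complex (x $ 1) (x $ 2) ^ j)) \<and> homogeneous_poly j (\<lambda>x. Im (Complex (x $ 1) (x $ 2) ^ j))" for j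
  proof (induction j)
    case 0
    show ?case using homogeneous_const[of 1] homogeneous_const[of 0] by simp
  next
    case (Suc j)
    then have IH: "homogeneous_poly j (\<lambda>x. Re (Complex (x $ 1) (x $ 2) ^ j))" "homogeneous_poly j (\<lambda>x. Im (Complex (x $ 1) (x $ 2) ^ j))" by auto
    have m: "homogeneous_poly (Suc j) (\<lambda>x. x $ i * R x)" if "homogeneous_poly j R" for i R
      using homogeneous_mult[OF homogeneous_nth that] by simp
    have "homogeneous_poly (Suc j) (\<lambda>x. x $ 1 * Re (Complex (x $ 1) (x $ 2) ^ j) + (-1) * (x $ 2 * Im (Complex (x $ 1) (x $ 2) ^ j)))"
      "homogeneous_poly (Suc j) (\<lambda>x. x $ 1 * Im (Complex (x $ 1) (x $ 2) ^ j) + x $ 2 * Re (Complex (x $ 1) (x $ 2) ^ j))"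
      by (intro homogeneous_add homogeneous_scale m IH)+
    then show ?case by simp
  qed
  have "homogeneous_poly (2 * l + (k - 2 * l)) (ball_harmonic \<mu> k l e)"
    unfolding ball_harmonic_def[abs_def] using ang by (cases "e = 0") (auto intro!: homogeneous_mult rad)
  then show ?thesis using assms by simp
qed

lemma ball_harmonic_reflect: "ball_harmonic \<mu> k l e (reflect3 x) = ball_harmonic \<mu> k l e x"
  by (simp add: ball_harmonic_def)

lemma ball_harmonic_equator:
  "ball_harmonic \<mu> k l e (equator_point \<phi>) =
    (\<Sum>i\<le>l. coeff (jacobi_orthonormal l (\<mu> - 1/2) (real (k - 2 * l))) i) * S_angular (k - 2 * l) e \<phi>"
proof -
  have z: "Complex (cos \<phi>) (sin \<phi>) = rcis 1 \<phi>" by (simp add: complex_eq_iff)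
  show ?thesis
    unfolding ball_harmonic_def equator_point_def vector_3 z S_angular_rcis by simp
qed

text \<open>On the slices x_3 = s the integral over the longitude vanishes unless a + b is at least
  j = k - 2l and of the same parity, and an odd power of x_3 integrates to 0. In the remaining case
  u = s^2 leads to the Jacobi weight with exponents \<mu> - 1/2 and j, and the polynomial is
  orthogonal to lower degrees.\<close>

lemma ball_harmonic_mem:
  assumes mu: "\<mu> \<ge> 0" and l: "2 * l \<le> k"
  shows "ball_harmonic \<mu> k l e \<in> harmonic_space \<mu> k"
proof (rule harmonic_spaceI[OF mu homogeneous_ball_harmonic[OF l]])
  let ?P = "jacobi_orthonormal l (\<mu> - 1/2) (real (k - 2 * l))"
  let ?j = "k - 2 * l"
  let ?Z = "ball_harmonic \<mu> k l e"
  fix a b c :: nat assume abc: "a + b + c < k"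
  let ?M = "\<lambda>x::real^3. x $ 1 ^ a * x $ 2 ^ b * x $ 3 ^ c"
  have int: "integrable sphere_measure (\<lambda>x. ?Z x * ?M x * sphere_weight \<mu> x)"
    by (intro integrable_sphere_continuous2 mu homogeneous_continuous[OF homogeneous_ball_harmonic[OF l]] continuous_intros)
  define I where "I = (LBINT \<phi>:{0..2 * pi}. cos \<phi> ^ a * sin \<phi> ^ b * S_angular ?j e \<phi>)"
  have "sphere_inner \<mu> ?Z ?M = (LBINT s:{-1..1}. (LBINT \<phi>:{0..2 * pi}. ?Z (cycle3 (sph_point s \<phi>)) * ?M (cycle3 (sph_point s \<phi>)) * sphere_weight \<mu> (cycle3 (sph_point s \<phi>))))"
    unfolding sphere_inner_def by (rule sphere_integral_iterated(1)[OF orthogonal_cycle3 int])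
  also have "\<dots> = (LBINT s:{-1..1}. poly ?P (1 - 2 * s\<^sup>2) * sqrt (1 - s\<^sup>2) ^ (?j + a + b) * s ^ c * abs_weight \<mu> s * I)"
  proof (rule set_lebesgue_integral_cong, simp, intro allI impI)
    fix s :: real assume s: "s \<in> {-1..1}"
    have "(LBINT \<phi>:{0..2 * pi}. ?Z (cycle3 (sph_point s \<phi>)) * ?M (cycle3 (sph_point s \<phi>)) * sphere_weight \<mu> (cycle3 (sph_point s \<phi>)))
      = (LBINT \<phi>:{0..2 * pi}. (poly ?P (1 - 2 * s\<^sup>2) * sqrt (1 - s\<^sup>2) ^ (?j + a + b) * s ^ c * abs_weight \<mu> s) * (cos \<phi> ^ a * sin \<phi> ^ b * S_angular ?j e \<phi>))"
      unfolding ball_harmonic_cycle3[OF mu s] sphere_weight_cycle3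
      by (simp add: power_mult_distrib power_add mult_ac)
    then show "(LBINT \<phi>:{0..2 * pi}. ?Z (cycle3 (sph_point s \<phi>)) * ?M (cycle3 (sph_point s \<phi>)) * sphere_weight \<mu> (cycle3 (sph_point s \<phi>)))
       = poly ?P (1 - 2 * s\<^sup>2) * sqrt (1 - s\<^sup>2) ^ (?j + a + b) * s ^ c * abs_weight \<mu> s * I"
      unfolding set_integral_mult_right I_def .
  qed
  also have "\<dots> = I * (LBINT s:{-1..1}. poly ?P (1 - 2 * s\<^sup>2) * sqrt (1 - s\<^sup>2) ^ (?j + a + b) * s ^ c * abs_weight \<mu> s)"
    by simp
  also have "\<dots> = 0"
  proof (cases "?j > a + b \<or> odd (?j + (a + b))")
    case True
    then have "I = 0" unfolding I_def by (rule cos_sin_S_angular_orth)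
    then show ?thesis by simp
  next
    case False
    then obtain i where i: "a + b = ?j + 2 * i"
      by (metis add_diff_inverse_nat even_diff_nat even_add evenE)
    show ?thesis
    proof (cases "odd c")
      case True
      have "(LBINT s:{-1..1}. poly ?P (1 - 2 * s\<^sup>2) * sqrt (1 - s\<^sup>2) ^ (?j + a + b) * s ^ c * abs_weight \<mu> s) = 0"
        by (rule set_integral_antisymmetric) (use True in \<open>simp add: abs_weight_def\<close>)
      then show ?thesis by simp
    next
      case False
      then obtain d where c: "c = 2 * d" by auto
      \<comment> \<open>Of the factor (1 - u)^(j+i), the power j becomes part of the Jacobi weight;
        the power i and the even power of x_3 form the test polynomial.\<close>
      define q where "q = [:1, -1:] ^ i * monom (1::real) d"
      define R where "R = (?P \<circ>\<^sub>p [:1, -2:]) * [:1, -1:] ^ ?j * q"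
      have "degree q \<le> i + d" unfolding q_def
        by (rule order.trans[OF degree_mult_le add_mono[OF order.trans[OF degree_power_le] degree_monom_le]]) simp
      \<comment> \<open>From a + b = j + 2i, c = 2d and k = j + 2l, the bound a + b + c < k reads i
        + d < l.\<close>
      then have q: "degree q < l" using i abc c l by linarith
      have "(LBINT s:{-1..1}. poly ?P (1 - 2 * s\<^sup>2) * sqrt (1 - s\<^sup>2) ^ (?j + a + b) * s ^ c * abs_weight \<mu> s)
        = (LBINT s:{-1..1}. poly R (s\<^sup>2) * abs_weight \<mu> s)"
      proof (rule set_lebesgue_integral_cong, simp, intro allI impI)
        fix s :: real assume s: "s \<in> {-1..1}"
        then have s2: "(sqrt (1 - s\<^sup>2))\<^sup>2 = 1 - s\<^sup>2" by (simp add: abs_square_le_1 abs_le_iff)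
        have "?j + a + b = 2 * (?j + i)" using i by simp
        then have "sqrt (1 - s\<^sup>2) ^ (?j + a + b) = (1 - s\<^sup>2) ^ ?j * (1 - s\<^sup>2) ^ i"
          by (metis power_mult power_add s2)
        moreover have "s ^ c = (s\<^sup>2) ^ d" unfolding c by (rule power_mult)
        ultimately show "poly ?P (1 - 2 * s\<^sup>2) * sqrt (1 - s\<^sup>2) ^ (?j + a + b) * s ^ c * abs_weight \<mu> s = poly R (s\<^sup>2) * abs_weight \<mu> s"
          by (simp add: R_def q_def poly_pcompose poly_monom mult_ac)
      qed
      also have "\<dots> = (LBINT u:{0..1}. poly R u * u powr (\<mu> - 1/2))" by (rule abs_weight_poly[OF mu])
      also have "\<dots> = (LBINT u:{0..1}. poly ?P (1 - 2 * u) * poly q u * (u powr (\<mu> - 1/2) * (1 - u) powr real ?j))"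
      proof (rule set_integral_interior_cong)
        have [measurable]: "poly r \<in> borel_measurable borel" for r :: "real poly"
          by (intro borel_measurable_continuous_onI continuous_intros)
        show "set_borel_measurable lborel {0..1} (\<lambda>u. poly R u * u powr (\<mu> - 1/2))"
          "set_borel_measurable lborel {0..1} (\<lambda>u. poly ?P (1 - 2 * u) * poly q u * (u powr (\<mu> - 1/2) * (1 - u) powr real ?j))"
          unfolding set_borel_measurable_def by measurable
        fix u :: real assume "0 < u" "u < 1"
        then show "poly R u * u powr (\<mu> - 1/2) = poly ?P (1 - 2 * u) * poly q u * (u powr (\<mu> - 1/2) * (1 - u) powr real ?j)"
          by (simp add: R_def poly_pcompose powr_realpow mult_ac del: of_nat_diff)
      qed
      also have "\<dots> = 0" using q mu by (intro jacobi_orthonormal_orth01) auto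
      finally show ?thesis by simp
    qed
  qed
  finally show "sphere_inner \<mu> ?Z ?M = 0" .
qed

section \<open>Interpolation on the equator and the projections\<close>

text \<open>On the equator the radial argument 2 r^2 - 1 is 1, so this product is the factor with
  which the index l enters the kernel there, and the Dirichlet kernel calls for 1/d. The quotient of
  Gamma values in \<open>h_coeff\<close> is a Pochhammer symbol, and the Pochhammer symbols and
  factorials in \<open>lam_coeff\<close> cancel those of h and of the Jacobi norm.\<close>

lemma ball_harmonic_constants:
  assumes mu: "\<mu> \<ge> 0" and l: "2 * l \<le> k"
  shows "lam_coeff \<mu> l k * (h_coeff \<mu> l k)\<^sup>2 *
    (poly (jacobi_orthonormal l (\<mu> - 1/2) (real (k - 2 * l))) 1)\<^sup>2 = 1 / d_coeff l k"
proof -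
  define j where "j = k - 2 * l"
  have kl: "k - l = j + l" "k = j + 2 * l" using l by (auto simp: j_def)
  define X where "X = real (k - l) + \<mu> + 1/2"
  have X: "X > 0" "real k + \<mu> + 1/2 = X + real l" using mu by (auto simp: X_def kl)
  have m: "\<mu> + 3/2 > 0" "\<mu> + 1/2 > 0" using mu by auto
  define a where "a = pochhammer (\<mu> + 3/2) j"
  define b where "b = pochhammer (\<mu> + 3/2 + real j) l"
  define c where "c = pochhammer (\<mu> + 1/2) l"
  define g where "g = pochhammer (real j + 1) l"
  define u where "u = pochhammer X l"
  define v where "v = pochhammer (X + 1) l"
  have pos: "a > 0" "b > 0" "c > 0" "g > 0" "u > 0" "v > 0"
    using m X by (auto simp: a_def b_def c_def g_def u_def v_def intro!: pochhammer_pos)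
  have nn: "\<mu> + 3/2 \<notin> \<int>\<^sub>\<le>\<^sub>0" using m(1) by (auto simp only: nonpos_Ints_def mem_Collect_eq not_less)
  have Ga: "Gamma (real j + \<mu> + 3/2) / Gamma (\<mu> + 3/2) = a"
    using pochhammer_Gamma[OF nn, of j] by (simp add: a_def add_ac)
  have Gf: "Gamma (real j + 1) = fact j" using Gamma_fact[of j, where 'a = real] by (simp add: add.commute)
  have "h_coeff \<mu> l k = sqrt (1 / d_coeff l k * (a / fact j))"
    unfolding h_coeff_def j_def[symmetric] Gf Ga[symmetric] by (simp add: field_simps)
  then have h: "(h_coeff \<mu> l k)\<^sup>2 = 1 / d_coeff l k * (a / fact j)"
    using pos by (simp add: d_coeff_def)
  have p: "(poly (jacobi_orthonormal l (\<mu> - 1/2) (real j)) 1)\<^sup>2 = 1 / jacobi_sqnorm l (\<mu> - 1/2) (real j)"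
    using mu by (intro jacobi_orthonormal_at_1) auto
  have args: "real l + (\<mu> - 1/2) + real j + 1 = X" "(\<mu> - 1/2) + 1 = \<mu> + 1/2" "(\<mu> - 1/2) + real j + 2 + real l = X + 1"
     "(\<mu> - 1/2) + real j + 2 = \<mu> + 3/2 + real j" by (auto simp: X_def kl)
  have sq: "jacobi_sqnorm l (\<mu> - 1/2) (real j) = u * fact l * g / (c * v * b)"
    unfolding jacobi_sqnorm_def args(1-3) unfolding args(4) u_def v_def c_def b_def g_def ..
  \<comment> \<open>Both sides are the Pochhammer symbol of X with l + 1 factors, split at its last
    and at its first factor. The two linear factors in \<open>lam_coeff\<close> are there to absorb
    this shift.\<close>
  have uv: "u * (X + real l) = X * v"
    unfolding u_def v_def using pochhammer_rec[of X l] pochhammer_rec'[of X l] by (simp add: mult.commute)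
  have fj: "(fact (k - l) :: real) = fact j * g"
    using pochhammer_product'[of "1::real" j l] unfolding kl(1) g_def by (simp add: pochhammer_fact add.commute)
  have ab: "pochhammer (\<mu> + 3/2) (k - l) = a * b"
    unfolding kl(1) a_def b_def by (rule pochhammer_product')
  have lam: "lam_coeff \<mu> l k = fact l * (fact j * g) * X / (c * (a * b) * (X + real l))"
    unfolding lam_coeff_def fj ab c_def[symmetric] X_def[symmetric] X(2) ..
  have dp: "d_coeff l k > 0" by (simp add: d_coeff_def)
  have "lam_coeff \<mu> l k * (h_coeff \<mu> l k)\<^sup>2 * (1 / jacobi_sqnorm l (\<mu> - 1/2) (real j))
     = 1 / d_coeff l k * ((X * v) / (u * (X + real l)))"
  proof -
    define w d F f' where "w = X + real l" and "d = d_coeff l k" and "F = (fact l :: real)" and "f' = (fact j :: real)"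
    have "w > 0" "d > 0" "F > 0" "f' > 0" using X dp by (auto simp: w_def d_def F_def f'_def)
    then show ?thesis
      unfolding lam h sq w_def[symmetric] d_def[symmetric] F_def[symmetric] f'_def[symmetric]
      using pos X(1) by simp
  qed
  also have "(X * v) / (u * (X + real l)) = 1" unfolding uv using pos X by simp
  finally show ?thesis unfolding p[unfolded j_def] j_def by simp
qed

lemma equator_point_sphere [simp]: "equator_point \<theta> \<in> sphere 0 1"
proof -
  have "(norm (equator_point \<theta>))\<^sup>2 = 1" unfolding norm_vec3_sq by (simp add: equator_point_def)
  then show ?thesis by (simp add: power2_eq_1_iff) (metis norm_ge_zero not_one_le_zero neg_0_le_iff_le)
qed

definition D_harmonic :: "real \<Rightarrow> nat \<Rightarrow> real \<Rightarrow> real^3 \<Rightarrow> real" where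
  "D_harmonic \<mu> k \<xi> x = (\<Sum>(l, e) \<in> disk_index k.
     (lam_coeff \<mu> l k * disk_basis \<mu> k l e (cos \<xi>) (sin \<xi>) * h_coeff \<mu> l k) * ball_harmonic \<mu> k l e x)"

lemma D_kernel_sphere:
  assumes "\<mu> \<ge> 0" "x \<in> sphere 0 1"
  shows "D_kernel \<mu> k \<xi> (x $ 1) (x $ 2) = D_harmonic \<mu> k \<xi> x"
  unfolding D_kernel_def D_harmonic_def disk_basis_eq_ball_harmonic[OF assms] by (simp only: mult.assoc)

lemma D_harmonic_mem:
  assumes "\<mu> \<ge> 0" shows "D_harmonic \<mu> k \<xi> \<in> harmonic_space \<mu> k"
  unfolding D_harmonic_def[abs_def] split_beta
  by (rule harmonic_space_sum[OF assms]) (auto simp: disk_index_def intro!: ball_harmonic_mem[OF assms])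

lemma D_harmonic_reflect: "D_harmonic \<mu> k \<xi> (reflect3 x) = D_harmonic \<mu> k \<xi> x"
  by (simp add: D_harmonic_def ball_harmonic_reflect)

lemma D_harmonic_equator:
  assumes mu: "\<mu> \<ge> 0"
  shows "of_real (D_harmonic \<mu> k \<xi> (equator_point \<phi>)) = dirichlet k (\<phi> - \<xi>)"
proof -
  have "D_harmonic \<mu> k \<xi> (equator_point \<phi>) =
     (\<Sum>(l, e) \<in> disk_index k. 1 / d_coeff l k * S_angular (k - 2 * l) e \<xi> * S_angular (k - 2 * l) e \<phi>)"
    unfolding D_harmonic_def
  proof (intro sum.cong refl, clarify)
    fix l e assume "(l, e) \<in> disk_index k"
    then have l: "2 * l \<le> k" by (auto simp: disk_index_def)
    let ?P = "jacobi_orthonormal l (\<mu> - 1/2) (real (k - 2 * l))"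
    have "degree ?P = l" using mu by (intro degree_jacobi_orthonormal) auto
    then have p1: "(\<Sum>i\<le>l. coeff ?P i) = poly ?P 1" by (simp add: poly_altdef)
    have "disk_basis \<mu> k l e (cos \<xi>) (sin \<xi>) = h_coeff \<mu> l k * ball_harmonic \<mu> k l e (equator_point \<xi>)"
      using disk_basis_eq_ball_harmonic[OF mu equator_point_sphere[of \<xi>], of k l e] by (simp add: equator_point_def)
    then show "lam_coeff \<mu> l k * disk_basis \<mu> k l e (cos \<xi>) (sin \<xi>) * h_coeff \<mu> l k * ball_harmonic \<mu> k l e (equator_point \<phi>)
      = 1 / d_coeff l k * S_angular (k - 2 * l) e \<xi> * S_angular (k - 2 * l) e \<phi>"
      unfolding ball_harmonic_equator p1 ball_harmonic_constants[OF mu l, symmetric]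
      by (simp add: power2_eq_square mult_ac)
  qed
  then show ?thesis using dirichlet_disk_index[of k \<xi> \<phi>] by simp
qed

text \<open>Monomials containing x_3 vanish on the equator; the others become products of k cosines
  and sines in total.\<close>

lemma trig_span_equator:
  assumes "homogeneous_poly k h"
  shows "trig_span k (\<lambda>\<phi>. of_real (h (equator_point \<phi>)))"
proof -
  let ?I = "{(i, j, l). i + j + l = k}"
  obtain c where c: "\<And>x. h x = monomial_sum ?I c x"
    using homogeneous_expand[OF assms] by blast
  have "trig_span k (\<lambda>\<phi>. \<Sum>s\<in>?I. of_real (case s of (i, j, l) \<Rightarrow> if l = 0 then c i j l else 0) *
      (case s of (i, j, l) \<Rightarrow> if l = 0 then of_real (cos \<phi> ^ i * sin \<phi> ^ j) else 0))"
  proof (rule trig_span_sum)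
    fix s assume "s \<in> ?I"
    then obtain i j l where s: "s = (i, j, l)" "i + j + l = k" by auto
    have "trig_span k (\<lambda>\<phi>. 0)" unfolding trig_span_def by (intro exI[of _ "\<lambda>_. 0"]) simp
    then show "trig_span k (\<lambda>\<phi>. case s of (i, j, l) \<Rightarrow> if l = 0 then of_real (cos \<phi> ^ i * sin \<phi> ^ j) else 0)"
      using s trig_span_cos_sin[of i j] by (cases "l = 0") auto
  qed
  moreover have "(of_real (h (equator_point \<phi>)) :: complex) = (\<Sum>s\<in>?I. of_real (case s of (i, j, l) \<Rightarrow> if l = 0 then c i j l else 0) *
      (case s of (i, j, l) \<Rightarrow> if l = 0 then of_real (cos \<phi> ^ i * sin \<phi> ^ j) else 0))" for \<phi>
    unfolding c of_real_sum equator_point_def vector_3 by (intro sum.cong refl) (auto simp: mult_ac)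
  ultimately show ?thesis by simp
qed

lemma harmonic_interpolation:
  assumes mu: "\<mu> \<ge> 0" and k: "k \<le> 2 * m" and H: "H \<in> harmonic_space \<mu> k" and even: "\<And>x. H (reflect3 x) = H x"
  shows "(\<Sum>\<nu>\<le>2 * m. H (equator_point (node_angle m \<nu>)) * D_harmonic \<mu> k (node_angle m \<nu>) x) = (2 * real m + 1) * H x"
proof -
  let ?S = "\<lambda>x. \<Sum>\<nu>\<le>2 * m. H (equator_point (node_angle m \<nu>)) * D_harmonic \<mu> k (node_angle m \<nu>) x"
  have S: "?S \<in> harmonic_space \<mu> k"
    by (intro harmonic_space_sum[OF mu] D_harmonic_mem[OF mu])
  \<comment> \<open>The difference is written as a linear combination so that
    \<open>harmonic_space_lincomb2\<close> applies to it literally.\<close>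
  have "1 * ?S x + (- (2 * real m + 1)) * H x = 0"
  proof (rule harmonic_space_zero_equator[OF mu harmonic_space_lincomb2[OF mu S H]])
    fix x show "1 * ?S (reflect3 x) + (- (2 * real m + 1)) * H (reflect3 x) = 1 * ?S x + (- (2 * real m + 1)) * H x"
      by (simp add: D_harmonic_reflect even)
  next
    fix \<phi>
    have "complex_of_real (?S (equator_point \<phi>)) = of_nat (2 * m + 1) * of_real (H (equator_point \<phi>))"
      unfolding dirichlet_interpolation[OF trig_span_equator[OF harmonic_space_homogeneous[OF H]] k, symmetric]
      by (simp add: D_harmonic_equator[OF mu])
    also have "\<dots> = of_real ((2 * real m + 1) * H (equator_point \<phi>))" by simp
    finally have "?S (equator_point \<phi>) = (2 * real m + 1) * H (equator_point \<phi>)" by (simp only: of_real_eq_iff)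
    then show "1 * ?S (vector [cos \<phi>, sin \<phi>, 0]) + (- (2 * real m + 1)) * H (vector [cos \<phi>, sin \<phi>, 0]) = 0"
      unfolding equator_point_def by (simp only: mult_1_left mult_minus_left add.right_inverse)
  qed
  then show ?thesis by (simp only: mult_1_left mult_minus_left add_uminus_conv_diff right_minus_eq)
qed

text \<open>The constant is the reciprocal of the one produced by the Funk-Hecke formula.\<close>

definition eval_harmonic :: "real \<Rightarrow> nat \<Rightarrow> real \<Rightarrow> real^3 \<Rightarrow> real" where
  "eval_harmonic \<mu> k \<theta> x = (real k + \<mu> + 1/2) / (2 * pi) * zonal_harmonic \<mu> k \<theta> x"

lemma eval_harmonic_mem:
  assumes "\<mu> \<ge> 0" shows "eval_harmonic \<mu> k \<theta> \<in> harmonic_space \<mu> k"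
  using harmonic_space_sum[OF assms, of "{()}" "\<lambda>_. zonal_harmonic \<mu> k \<theta>" k "\<lambda>_. (real k + \<mu> + 1/2) / (2 * pi)"]
    zonal_harmonic_mem[OF assms] by (simp add: eval_harmonic_def[abs_def])

lemma sphere_inner_scale_left: "sphere_inner \<mu> (\<lambda>x. c * f x) g = c * sphere_inner \<mu> f g"
  unfolding sphere_inner_def by (simp add: mult.assoc)

lemma eval_harmonic_reproducing:
  assumes mu: "\<mu> \<ge> 0" and h: "h \<in> harmonic_space \<mu> k"
  shows "sphere_inner \<mu> (eval_harmonic \<mu> k \<theta>) h = h (equator_point \<theta>)"
  unfolding eval_harmonic_def[abs_def] sphere_inner_scale_left zonal_harmonic_reproducing[OF assms] using mu by simp

text \<open>Let E be the difference of the two sides. Pairing the left side with E and using the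
  reproducing property gives a sum of the numbers E(\<zeta>_\<nu>) times the pairings of D_\<nu>
  with H. Expanding (2 m + 1) E by \<open>harmonic_interpolation\<close> and pairing with H gives
  the same sum for 2 m + 1 times the pairing of H with E. Hence E is orthogonal to itself.\<close>

lemma harmonic_dual_interpolation:
  assumes mu: "\<mu> \<ge> 0" and k: "k \<le> 2 * m" and H: "H \<in> harmonic_space \<mu> k" and even: "\<And>x. H (reflect3 x) = H x"
  shows "(\<Sum>\<nu>\<le>2 * m. sphere_inner \<mu> (D_harmonic \<mu> k (node_angle m \<nu>)) H * eval_harmonic \<mu> k (node_angle m \<nu>) x) = (2 * real m + 1) * H x"
proof -
  let ?d = "\<lambda>\<nu>. sphere_inner \<mu> (D_harmonic \<mu> k (node_angle m \<nu>)) H"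
  let ?c = "\<lambda>\<nu>. eval_harmonic \<mu> k (node_angle m \<nu>)"
  let ?S = "\<lambda>x. \<Sum>\<nu>\<le>2 * m. ?d \<nu> * ?c \<nu> x"
  let ?N = "2 * real m + 1"
  let ?E = "\<lambda>x. 1 * ?S x + (- ?N) * H x"
  have S: "?S \<in> harmonic_space \<mu> k"
    by (intro harmonic_space_sum[OF mu] eval_harmonic_mem[OF mu])
  have E: "?E \<in> harmonic_space \<mu> k" by (rule harmonic_space_lincomb2[OF mu S H])
  have Eev: "?E (reflect3 x) = ?E x" for x
    by (simp add: even eval_harmonic_def zonal_harmonic_reflect)
  note int = integrable_sphere_continuous2[OF _ _ mu]
  have SE: "sphere_inner \<mu> ?S ?E = (\<Sum>\<nu>\<le>2 * m. ?d \<nu> * ?E (equator_point (node_angle m \<nu>)))"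
    by (subst sphere_inner_sum_left)
       (intro int harmonic_space_continuous[OF eval_harmonic_mem[OF mu]] harmonic_space_continuous[OF E],
        simp only: eval_harmonic_reproducing[OF mu E])
  have "?N * sphere_inner \<mu> H ?E = sphere_inner \<mu> (\<lambda>x. ?N * ?E x) H"
    by (simp only: sphere_inner_scale_left sphere_inner_commute[of \<mu> H])
  also have "\<dots> = sphere_inner \<mu> (\<lambda>x. \<Sum>\<nu>\<le>2 * m. ?E (equator_point (node_angle m \<nu>)) * D_harmonic \<mu> k (node_angle m \<nu>) x) H"
    by (simp only: harmonic_interpolation[OF mu k E Eev])
  also have "\<dots> = (\<Sum>\<nu>\<le>2 * m. ?E (equator_point (node_angle m \<nu>)) * ?d \<nu>)"
    by (intro sphere_inner_sum_left int harmonic_space_continuous[OF D_harmonic_mem[OF mu]] harmonic_space_continuous[OF H])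
  finally have HE: "?N * sphere_inner \<mu> H ?E = (\<Sum>\<nu>\<le>2 * m. ?d \<nu> * ?E (equator_point (node_angle m \<nu>)))"
    by (simp only: mult.commute)
  have "sphere_inner \<mu> ?E ?E = sphere_inner \<mu> (\<lambda>x. ?S x - ?N * H x) ?E"
    by (simp only: mult_1_left mult_minus_left add_uminus_conv_diff)
  also have "\<dots> = sphere_inner \<mu> ?S ?E - sphere_inner \<mu> (\<lambda>x. ?N * H x) ?E"
    by (intro sphere_inner_diff_left int continuous_on_mult continuous_on_const harmonic_space_continuous[OF S] harmonic_space_continuous[OF H] harmonic_space_continuous[OF E])
  also have "\<dots> = 0" unfolding SE sphere_inner_scale_left HE by simp
  finally have "?E x = 0" for x by (rule harmonic_space_self_zero[OF mu E])
  from this[of x] show ?thesis by (simp only: mult_1_left mult_minus_left add_uminus_conv_diff right_minus_eq)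
qed

section \<open>Projections of functions even in x_3\<close>

lemma harmonic_proj_eqI:
  assumes mu: "\<mu> \<ge> 0" and f: "f \<in> L2_sphere \<mu>" and g: "g \<in> harmonic_space \<mu> k"
    and orth: "\<And>h. h \<in> harmonic_space \<mu> k \<Longrightarrow> sphere_inner \<mu> f h = sphere_inner \<mu> g h"
  shows "harmonic_proj \<mu> k f = g"
  unfolding harmonic_proj_def
proof (rule the_equality)
  have d: "sphere_inner \<mu> (\<lambda>x. f x - g' x) h = sphere_inner \<mu> f h - sphere_inner \<mu> g' h"
    if "g' \<in> harmonic_space \<mu> k" "h \<in> harmonic_space \<mu> k" for g' h
    by (intro sphere_inner_diff_left integrable_sphere_L2[OF f _ mu] integrable_sphere_continuous2 mu harmonic_space_continuous[OF that(1)] harmonic_space_continuous[OF that(2)])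
  show "g \<in> harmonic_space \<mu> k \<and> (\<forall>h\<in>harmonic_space \<mu> k. sphere_inner \<mu> (\<lambda>x. f x - g x) h = 0)"
    using g d orth by simp
  fix g' assume g': "g' \<in> harmonic_space \<mu> k \<and> (\<forall>h\<in>harmonic_space \<mu> k. sphere_inner \<mu> (\<lambda>x. f x - g' x) h = 0)"
  let ?E = "\<lambda>x. 1 * g' x + (-1) * g x"
  have E: "?E \<in> harmonic_space \<mu> k" using g g' by (intro harmonic_space_lincomb2[OF mu]) auto
  have "sphere_inner \<mu> ?E ?E = sphere_inner \<mu> (\<lambda>x. g' x - g x) ?E" by simp
  also have "\<dots> = sphere_inner \<mu> g' ?E - sphere_inner \<mu> g ?E"
    using g g' by (intro sphere_inner_diff_left integrable_sphere_continuous2 mu harmonic_space_continuous[OF E]) (auto intro: harmonic_space_continuous)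
  also have "\<dots> = 0" using g' E d[of g' ?E] orth[OF E] by simp
  finally have "?E x = 0" for x by (rule harmonic_space_self_zero[OF mu E])
  then show "g' = g" by (intro ext) simp
qed

text \<open>An even function cannot distinguish a test function from its reflection, so it is enough
  to test with even harmonics, where interpolation is available. The hypothesis asks for integrable
  products so that it fits both a member of the weighted L^2 space and the polynomial proposed as
  its projection.\<close>

lemma sphere_inner_even_part:
  assumes mu: "\<mu> \<ge> 0" and f: "\<And>g. continuous_on UNIV g \<Longrightarrow> integrable sphere_measure (\<lambda>x. f x * g x * sphere_weight \<mu> x)"
    and even: "AE x in sphere_measure. f (reflect3 x) = f x" and h: "continuous_on UNIV h"
  shows "sphere_inner \<mu> f h = sphere_inner \<mu> f (\<lambda>x. 1/2 * h x + 1/2 * h (reflect3 x))"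
proof -
  have rc: "continuous_on UNIV reflect3"
    using orthogonal_reflect3 by (intro linear_continuous_on) (simp add: orthogonal_transformation_linear linear_linear)
  have hr: "continuous_on UNIV (\<lambda>x. h (reflect3 x))" by (rule continuous_on_compose2[OF h rc]) simp
  have "integrable sphere_measure (\<lambda>x. f (reflect3 x) * h (reflect3 x) * sphere_weight \<mu> x)"
    using integrable_sphere_orthogonal(1)[OF orthogonal_reflect3 f[OF h]] by (simp add: sphere_weight_reflect3)
  then have "sphere_inner \<mu> (\<lambda>x. f (reflect3 x)) (\<lambda>x. h (reflect3 x)) = sphere_inner \<mu> f (\<lambda>x. h (reflect3 x))"
    unfolding sphere_inner_def using f[OF hr] even
    by (intro integral_cong_AE borel_measurable_integrable) auto
  then have e: "sphere_inner \<mu> f (\<lambda>x. h (reflect3 x)) = sphere_inner \<mu> f h"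
    using sphere_inner_reflect[OF f[OF h]] by simp
  have "sphere_inner \<mu> f (\<lambda>x. 1/2 * h x + 1/2 * h (reflect3 x)) = (LINT x|sphere_measure. 1/2 * (f x * h x * sphere_weight \<mu> x) + 1/2 * (f x * h (reflect3 x) * sphere_weight \<mu> x))"
    unfolding sphere_inner_def by (rule arg_cong[of _ _ "integral\<^sup>L sphere_measure"]) (simp add: fun_eq_iff ring_distribs)
  also have "\<dots> = 1/2 * sphere_inner \<mu> f h + 1/2 * sphere_inner \<mu> f (\<lambda>x. h (reflect3 x))"
    unfolding sphere_inner_def by (subst Bochner_Integration.integral_add) (auto intro!: f h hr simp del: mult_divide_mult_cancel_left_if)
  finally show ?thesis unfolding e by simp
qed

lemma harmonic_proj_even:
  assumes mu: "\<mu> \<ge> 0" and f: "f \<in> L2_sphere \<mu>" and even: "AE x in sphere_measure. f (reflect3 x) = f x" and k: "k \<le> 2 * m"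
  shows "harmonic_proj \<mu> k f = (\<lambda>x. \<Sum>\<nu>\<le>2 * m. (sphere_inner \<mu> f (eval_harmonic \<mu> k (node_angle m \<nu>)) / (2 * real m + 1)) * D_harmonic \<mu> k (node_angle m \<nu>) x)"
    (is "_ = ?g")
proof (rule harmonic_proj_eqI[OF mu f])
  let ?N = "2 * real m + 1"
  let ?c = "\<lambda>\<nu>. eval_harmonic \<mu> k (node_angle m \<nu>)"
  let ?D = "\<lambda>\<nu>. D_harmonic \<mu> k (node_angle m \<nu>)"
  show g: "?g \<in> harmonic_space \<mu> k" by (intro harmonic_space_sum[OF mu] D_harmonic_mem[OF mu])
  fix h assume h: "h \<in> harmonic_space \<mu> k"
  define H where "H = (\<lambda>x. 1/2 * h x + 1/2 * h (reflect3 x))"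
  have H: "H \<in> harmonic_space \<mu> k" unfolding H_def by (rule harmonic_space_lincomb2[OF mu h harmonic_space_reflect[OF mu h]])
  have rr: "reflect3 (reflect3 x) = x" for x by (simp add: vec3_eq_iff)
  have Hev: "H (reflect3 x) = H x" for x by (simp add: H_def rr)
  have fh: "sphere_inner \<mu> f h = sphere_inner \<mu> f H" unfolding H_def
    by (rule sphere_inner_even_part[OF mu integrable_sphere_L2[OF f _ mu] even harmonic_space_continuous[OF h]])
  have gh: "sphere_inner \<mu> ?g h = sphere_inner \<mu> ?g H" unfolding H_def
    by (rule sphere_inner_even_part[OF mu integrable_sphere_continuous2[OF harmonic_space_continuous[OF g] _ mu] _ harmonic_space_continuous[OF h]])
       (simp_all add: D_harmonic_reflect)
  \<comment> \<open>Expanding H by the dual interpolation gives a sum of products of pairings of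
    D_\<nu> with H and of c_\<nu> with f. Read with the latter as coefficients, it is the pairing of
    the proposed projection with H.\<close>
  have "?N * sphere_inner \<mu> f H = sphere_inner \<mu> (\<lambda>x. ?N * H x) f"
    unfolding sphere_inner_scale_left by (simp only: sphere_inner_commute[of \<mu> f H])
  also have "\<dots> = sphere_inner \<mu> (\<lambda>x. \<Sum>\<nu>\<le>2 * m. sphere_inner \<mu> (?D \<nu>) H * ?c \<nu> x) f"
    by (simp only: harmonic_dual_interpolation[OF mu k H Hev])
  also have "\<dots> = (\<Sum>\<nu>\<le>2 * m. sphere_inner \<mu> (?D \<nu>) H * sphere_inner \<mu> (?c \<nu>) f)"
    using integrable_sphere_L2[OF f harmonic_space_continuous[OF eval_harmonic_mem[OF mu]] mu]
    by (intro sphere_inner_sum_left) (simp add: mult_ac)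
  also have "\<dots> = ?N * (\<Sum>\<nu>\<le>2 * m. (sphere_inner \<mu> f (?c \<nu>) / ?N) * sphere_inner \<mu> (?D \<nu>) H)"
    unfolding sum_distrib_left by (intro sum.cong refl) (simp add: sphere_inner_commute[of \<mu> f] mult_ac)
  also have "(\<Sum>\<nu>\<le>2 * m. (sphere_inner \<mu> f (?c \<nu>) / ?N) * sphere_inner \<mu> (?D \<nu>) H) = sphere_inner \<mu> ?g H"
    by (intro sphere_inner_sum_left[symmetric] integrable_sphere_continuous2 mu harmonic_space_continuous[OF D_harmonic_mem[OF mu]] harmonic_space_continuous[OF H])
  finally have "sphere_inner \<mu> f H = sphere_inner \<mu> ?g H" by simp
  then show "sphere_inner \<mu> f h = sphere_inner \<mu> ?g h" using fh gh by simp
qed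

text \<open>A polynomial in t is constant on each circle, so it may enter the inner integral as a
  zonal function; the iterated integral is then one over the sphere. The factor 1/2 comes from the
  normalization of the transform.\<close>

lemma Q_transform_poly:
  assumes mu: "\<mu> \<ge> 0" and f: "f \<in> L2_sphere \<mu>"
  shows "(LBINT t:{-1..1}. Q_transform \<mu> f (equator_point \<theta>) t * poly p t) = 1/2 * sphere_inner \<mu> f (zonal \<theta> p)"
    "set_integrable lborel {-1..1} (\<lambda>t. Q_transform \<mu> f (equator_point \<theta>) t * poly p t)"
proof -
  note int = integrable_sphere_L2[OF f zonal_continuous[of UNIV \<theta> p] mu]
  let ?F = "\<lambda>t. LBINT \<alpha>:{0..2 * pi}. f (circ \<theta> t \<alpha>) * zonal \<theta> p (circ \<theta> t \<alpha>) * sphere_weight \<mu> (circ \<theta> t \<alpha>)"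
  \<comment> \<open>True for every t: on a slice where f times the weight is not integrable, both
    sides have the default value 0.\<close>
  have Q: "Q_transform \<mu> f (equator_point \<theta>) t * poly p t = 1/2 * ?F t" for t
  proof -
    have "?F t = (LBINT \<alpha>:{0..2 * pi}. poly p t * (f (circ \<theta> t \<alpha>) * sphere_weight \<mu> (circ \<theta> t \<alpha>)))"
      unfolding zonal_rot3 by (simp only: mult_ac)
    then show ?thesis
      unfolding set_integral_mult_right by (simp add: Q_transform_def equator_point_def circle_point_eq_rot3)
  qed
  show "(LBINT t:{-1..1}. Q_transform \<mu> f (equator_point \<theta>) t * poly p t) = 1/2 * sphere_inner \<mu> f (zonal \<theta> p)"
    unfolding Q set_integral_mult_right sphere_inner_def sphere_integral_iterated(1)[OF orthogonal_rot3[of \<theta>] int] ..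
  show "set_integrable lborel {-1..1} (\<lambda>t. Q_transform \<mu> f (equator_point \<theta>) t * poly p t)"
    unfolding Q by (intro set_integrable_mult_right sphere_integral_iterated(2)[OF orthogonal_rot3 int])
qed

theorem corollary3p4:
  fixes \<mu> :: real and m :: nat and f :: "real^3 \<Rightarrow> real" and x :: "real^3"
  assumes "\<mu> \<ge> 0"
    and "f \<in> L2_sphere \<mu>"
    and "AE y in sphere_measure. f (vector [y $ 1, y $ 2, - (y $ 3)]) = f y"
    and "x \<in> sphere 0 1"
  shows "partial_sum_Y \<mu> (2 * m) f x =
           1 / (2 * real m + 1) *
           (\<Sum>\<nu>\<le>2 * m. a_const \<mu> *
              (LBINT t:{-1..1}. Q_transform \<mu> f (node m \<nu>) t *
                 Phi_kernel \<mu> (2 * m) (node_angle m \<nu>) t (x $ 1) (x $ 2)))"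
proof -
  let ?N = "2 * real m + 1"
  let ?G = "\<lambda>k. geg \<mu> k"
  let ?e = "\<lambda>k \<nu>. sphere_inner \<mu> f (eval_harmonic \<mu> k (node_angle m \<nu>))"
  let ?D = "\<lambda>k \<nu>. D_harmonic \<mu> k (node_angle m \<nu>) x"
  note mu = assms(1) and f = assms(2)
  have even: "AE x in sphere_measure. f (reflect3 x) = f x" using assms(3) by (simp add: reflect3_def)
  have node: "node m \<nu> = equator_point (node_angle m \<nu>)" for \<nu> by (simp add: node_def equator_point_def)
  have main: "a_const \<mu> * (LBINT t:{-1..1}. Q_transform \<mu> f (node m \<nu>) t *
                 Phi_kernel \<mu> (2 * m) (node_angle m \<nu>) t (x $ 1) (x $ 2)) = (\<Sum>k\<le>2 * m. ?e k \<nu> * ?D k \<nu>)" for \<nu>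
  proof -
    let ?b = "\<lambda>k. (real k + \<mu> + 1/2) / (\<mu> + 1/2) * ?D k \<nu>"
    have "(LBINT t:{-1..1}. Q_transform \<mu> f (node m \<nu>) t * Phi_kernel \<mu> (2 * m) (node_angle m \<nu>) t (x $ 1) (x $ 2))
      = (LBINT t:{-1..1}. (\<Sum>k\<le>2 * m. ?b k * (Q_transform \<mu> f (equator_point (node_angle m \<nu>)) t * poly (?G k) t)))"
      unfolding Phi_kernel_def node D_kernel_sphere[OF mu assms(4)] sum_distrib_left by (simp only: mult_ac)
    also have "\<dots> = (\<Sum>k\<le>2 * m. LBINT t:{-1..1}. ?b k * (Q_transform \<mu> f (equator_point (node_angle m \<nu>)) t * poly (?G k) t))"
      using set_integrable_mult_right[OF Q_transform_poly(2)[OF mu f]]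
      unfolding set_lebesgue_integral_def set_integrable_def scaleR_sum_right by (intro Bochner_Integration.integral_sum) blast
    also have "\<dots> = (\<Sum>k\<le>2 * m. ?b k * (1/2 * sphere_inner \<mu> f (zonal (node_angle m \<nu>) (?G k))))"
      unfolding set_integral_mult_right Q_transform_poly(1)[OF mu f] ..
    finally have "a_const \<mu> * (LBINT t:{-1..1}. Q_transform \<mu> f (node m \<nu>) t * Phi_kernel \<mu> (2 * m) (node_angle m \<nu>) t (x $ 1) (x $ 2))
      = (\<Sum>k\<le>2 * m. a_const \<mu> * (?b k * (1/2 * sphere_inner \<mu> f (zonal (node_angle m \<nu>) (?G k)))))"
      by (simp only: sum_distrib_left)
    also have "\<dots> = (\<Sum>k\<le>2 * m. ?e k \<nu> * ?D k \<nu>)"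
    proof (intro sum.cong refl)
      fix k
      have "?e k \<nu> = (real k + \<mu> + 1/2) / (2 * pi) * sphere_inner \<mu> f (zonal_harmonic \<mu> k (node_angle m \<nu>))"
        unfolding eval_harmonic_def[abs_def] sphere_inner_commute[of \<mu> f] sphere_inner_scale_left ..
      also have "sphere_inner \<mu> f (zonal_harmonic \<mu> k (node_angle m \<nu>)) = sphere_inner \<mu> f (zonal (node_angle m \<nu>) (?G k))"
        by (intro sphere_inner_cong) (auto simp: zonal_harmonic_sphere[OF mu])
      finally have e: "?e k \<nu> = (real k + \<mu> + 1/2) / (2 * pi) * sphere_inner \<mu> f (zonal (node_angle m \<nu>) (?G k))" .
      \<comment> \<open>The normalizations a_\<mu> and 1/2 and the kernel factor (k + \<mu> + 1/2) /
        (\<mu> + 1/2) combine to exactly the constant that makes the zonal harmonic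
        reproducing.\<close>
      have c: "a_const \<mu> * ((real k + \<mu> + 1/2) / (\<mu> + 1/2)) * (1/2) = (real k + \<mu> + 1/2) / (2 * pi)"
        using mu by (simp add: a_const_def)
      show "a_const \<mu> * (?b k * (1/2 * sphere_inner \<mu> f (zonal (node_angle m \<nu>) (?G k)))) = ?e k \<nu> * ?D k \<nu>"
        unfolding e c[symmetric] by (simp only: mult_ac)
    qed
    finally show ?thesis .
  qed
  have "partial_sum_Y \<mu> (2 * m) f x = (\<Sum>k\<le>2 * m. \<Sum>\<nu>\<le>2 * m. (?e k \<nu> / ?N) * ?D k \<nu>)"
    unfolding partial_sum_Y_def by (intro sum.cong refl) (simp add: harmonic_proj_even[OF mu f even])
  also have "\<dots> = (\<Sum>\<nu>\<le>2 * m. \<Sum>k\<le>2 * m. (?e k \<nu> / ?N) * ?D k \<nu>)" by (rule sum.swap)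
  also have "\<dots> = 1 / ?N * (\<Sum>\<nu>\<le>2 * m. \<Sum>k\<le>2 * m. ?e k \<nu> * ?D k \<nu>)"
    unfolding sum_distrib_left by simp
  finally show ?thesis unfolding main .
qed

end
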